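(* Let $G$ be a non-amenable group generated by two commuting infinite and finitely generated subgroups $H$ and $K$. Then for every Cayley graph ${\mathcal{G}}$ of $G$, the Bernoulli bond percolation on ${\mathcal{G}}$ at the parameter $p=p_u({\mathcal{G}})$ does not belong to the uniqueness phase.
   Context: "Commuting subgroups" means that every element of $H$ commutes with every element of $K$. Cayley graphs are taken with respect to finite generating sets of $G$. For a Cayley graph ${\mathcal{G}}=(G,\mathtt{E})$ and $p\in[0,1]$, Bernoulli bond percolation with retention parameter $p$ is the product probability measure $\mathbf{P}_p$ on $\{0,1\}^{\mathtt{E}}$ under which the edges are independently open (value $1$) with probability $p$ and closed (value $0$) with probability $1-p$. Clusters are the connected components of the subgraph of open edges (with vertex set $G$). The number of infinite clusters is $\mathbf{P}_p$-almost surely constant, equal to $0$, $1$ or $\infty$. The parameter $p$ belongs to the uniqueness phase if there is $\mathbf{P}_p$-almost surely exactly one infinite cluster, and $p_u({\mathcal{G}})$ is the infimum of the $p\in[0,1]$ that belong to the uniqueness phase. *)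

theory Defs
  imports "HOL-Algebra.Generated_Groups" "HOL-Probability.Probability"
begin

definition finitely_generated_subgroup :: "('a, 'b) monoid_scheme \<Rightarrow> 'a set \<Rightarrow> bool" where
  "finitely_generated_subgroup G H \<longleftrightarrow>
     subgroup H G \<and> (\<exists>A. finite A \<and> A \<subseteq> carrier G \<and> generate G A = H)"

definition commuting_subsets :: "('a, 'b) monoid_scheme \<Rightarrow> 'a set \<Rightarrow> 'a set \<Rightarrow> bool" where
  "commuting_subsets G H K \<longleftrightarrow> (\<forall>h\<in>H. \<forall>k\<in>K. h \<otimes>\<^bsub>G\<^esub> k = k \<otimes>\<^bsub>G\<^esub> h)"

text \<open>Amenability of a discrete group in von Neumann's sense: there is a left-invariant, finitely
  additive probability measure defined on all subsets of the group.\<close>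

definition amenable :: "('a, 'b) monoid_scheme \<Rightarrow> bool" where
  "amenable G \<longleftrightarrow>
     (\<exists>m :: 'a set \<Rightarrow> real.
        (\<forall>A. A \<subseteq> carrier G \<longrightarrow> 0 \<le> m A) \<and>
        m (carrier G) = 1 \<and>
        (\<forall>A B. A \<subseteq> carrier G \<longrightarrow> B \<subseteq> carrier G \<longrightarrow> A \<inter> B = {} \<longrightarrow> m (A \<union> B) = m A + m B) \<and>
        (\<forall>g\<in>carrier G. \<forall>A. A \<subseteq> carrier G \<longrightarrow> m (g <#\<^bsub>G\<^esub> A) = m A))"

definition finite_generating_set :: "('a, 'b) monoid_scheme \<Rightarrow> 'a set \<Rightarrow> bool" where
  "finite_generating_set G S \<longleftrightarrow> finite S \<and> S \<subseteq> carrier G \<and> generate G S = carrier G"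

text \<open>The Cayley graph is the simple undirected graph with vertex set \<open>carrier G\<close>; an edge is the
  two-element set of its endpoints. The generating set need not be symmetric and may
  contain the identity: orientations are forgotten, and loops and repetitions are discarded.\<close>

definition cayley_edges :: "('a, 'b) monoid_scheme \<Rightarrow> 'a set \<Rightarrow> 'a set set" where
  "cayley_edges G S =
     {{g, g \<otimes>\<^bsub>G\<^esub> s} | g s. g \<in> carrier G \<and> s \<in> S \<and> g \<noteq> g \<otimes>\<^bsub>G\<^esub> s}"

text \<open>Configurations are functions from edges to \<open>bool\<close> (\<open>True\<close> is open, \<open>False\<close> is closed).
  The measure is meaningful for \<open>p\<close> in \<open>[0,1]\<close> only.\<close>

definition bond_percolation ::
    "('a, 'b) monoid_scheme \<Rightarrow> 'a set \<Rightarrow> real \<Rightarrow> ('a set \<Rightarrow> bool) measure" where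
  "bond_percolation G S p = PiM (cayley_edges G S) (\<lambda>_. measure_pmf (bernoulli_pmf p))"

definition open_adjacency ::
    "('a, 'b) monoid_scheme \<Rightarrow> 'a set \<Rightarrow> ('a set \<Rightarrow> bool) \<Rightarrow> ('a \<times> 'a) set" where
  "open_adjacency G S \<omega> = {(x, y). {x, y} \<in> cayley_edges G S \<and> \<omega> {x, y}}"

definition clusters ::
    "('a, 'b) monoid_scheme \<Rightarrow> 'a set \<Rightarrow> ('a set \<Rightarrow> bool) \<Rightarrow> 'a set set" where
  "clusters G S \<omega> = carrier G // (open_adjacency G S \<omega>)\<^sup>*"

definition uniqueness_phase :: "('a, 'b) monoid_scheme \<Rightarrow> 'a set \<Rightarrow> real set" where
  "uniqueness_phase G S =
     {p \<in> {0..1}. AE \<omega> in bond_percolation G S p. \<exists>!C. C \<in> clusters G S \<omega> \<and> infinite C}"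

text \<open>For infinite \<open>G\<close> and a finite generating set \<open>S\<close> the infimum is over a nonempty set, as
  \<open>p = 1\<close> belongs to the uniqueness phase; in particular \<open>p_u G S\<close> lies in \<open>[0,1]\<close>.\<close>

definition p_u :: "('a, 'b) monoid_scheme \<Rightarrow> 'a set \<Rightarrow> real" where
  "p_u G S = Inf (uniqueness_phase G S)"

end

theory Submission
  imports Defs
begin

text \<open>Suppose that \<open>q = p\<^sub>u\<close> belongs to the uniqueness phase and let \<open>\<pi> x\<close> be the first vertex,
  in an equivariant order seen from \<open>x\<close>, that lies in the unique infinite cluster at \<open>q\<close>. Thin that
  percolation with density \<open>r < 1\<close> and write \<open>x ~ y\<close> if \<open>\<pi> x\<close> and \<open>\<pi> y\<close> remain connected. For fixed
  \<open>x\<close> and \<open>y\<close> the probability of \<open>x ~ y\<close> tends to \<open>1\<close> as \<open>r\<close> tends to \<open>1\<close>.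

  One of the two subgroups, say \<open>H\<close>, is non-amenable, so the Bernoulli shift has a spectral gap for
  \<open>H\<close>: events almost invariant under finitely many elements of \<open>H\<close> have probability near \<open>0\<close> or
  \<open>1\<close>. For \<open>k \<in> K\<close> the event \<open>\<one> ~ k\<close> is almost \<open>H\<close>-invariant because \<open>k\<close> commutes with \<open>H\<close>, and
  moving \<open>k\<close> by generators of \<open>K\<close> shows that its probability is near \<open>1\<close> uniformly in \<open>k\<close>. Mixing
  along the infinite group \<open>K\<close> then gives the same uniformly over \<open>H\<close>, hence over all of \<open>G\<close>.

  Regard the class of \<open>\<one>\<close> as a unit vector in the field of Hilbert spaces \<open>\<ell>\<^sup>2\<close>(classes). By
  uniformity the convex hull of its translates stays away from \<open>0\<close>, and its element of minimal norm
  is invariant; it singles out one cluster \<open>Z\<close> of the thinned percolation. Finally restore the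
  thinned edges with a small density. By mass transport, an infinite cluster missing \<open>Z\<close> would have
  infinitely many vertices at minimal distance from \<open>Z\<close>, and infinitely many disjoint paths of
  fixed length would join them to \<open>Z\<close>; one of these is restored. So there is exactly one infinite
  cluster at a parameter below \<open>q\<close>, contradicting the definition of \<open>p\<^sub>u\<close>.\<close>

section \<open>Infinite products of probability spaces\<close>

text \<open>Letting r tend to 1 controls only finitely many pairs of vertices at a time, while the
  choice of a cluster needs all pairs at once. Non-amenability bridges this: the spectral constant
  comes from how \<open>H\<close> moves finite sets of edge variables and does not depend on q, r or
  s, so it is fixed before r. It is then enough to make finitely many probabilities small, namely
  those for generators of \<open>H\<close> and \<open>K\<close> and for the finite subset of
  \<open>H\<close> that witnesses the gap.

  Commutation gives an unbounded family of events one common error: if \<open>h\<close> commutes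
  with \<open>k\<close>, then translating the pair of \<one> and \<open>k\<close> by
  \<open>h\<close> multiplies each of them by \<open>h\<close> on the right, and the cost of such a
  move does not depend on \<open>k\<close>.

  The thinned percolation may well have many infinite clusters, so uniqueness is never claimed for
  it. What is needed is one distinguished infinite cluster, chosen without looking at the variables
  that restore edges; the other infinite clusters are then attached to it by fresh
  randomness.\<close>

context product_prob_space
begin

section \<open>Cylinder events and independence of coordinates\<close>

definition cylinder :: "('i \<Rightarrow> 'a) set \<Rightarrow> bool" where
  "cylinder C \<longleftrightarrow> (\<exists>J B. finite J \<and> J \<subseteq> I \<and> B \<in> sets (PiM J M) \<and> C = prod_emb I M J B)"

lemma cylinder_sets: "cylinder C \<Longrightarrow> C \<in> sets (PiM I M)"
  unfolding cylinder_def by (auto intro!: measurable_prod_emb)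

lemma cylinder_extend:
  assumes "B \<in> sets (PiM J M)" "J \<subseteq> L" "L \<subseteq> I"
  shows "prod_emb L M J B \<in> sets (PiM L M)"
    and "prod_emb I M J B = prod_emb I M L (prod_emb L M J B)"
  using assms by (auto intro!: measurable_prod_emb simp: prod_emb_trans)

lemma cylinder_Un:
  assumes "cylinder C" "cylinder D"
  shows "cylinder (C \<union> D)"
proof -
  obtain J B where J: "finite J" "J \<subseteq> I" "B \<in> sets (PiM J M)" "C = prod_emb I M J B"
    using assms(1) by (auto simp: cylinder_def)
  obtain K B' where K: "finite K" "K \<subseteq> I" "B' \<in> sets (PiM K M)" "D = prod_emb I M K B'"
    using assms(2) by (auto simp: cylinder_def)
  let ?L = "J \<union> K"
  have "C \<union> D = prod_emb I M ?L (prod_emb ?L M J B) \<union> prod_emb I M ?L (prod_emb ?L M K B')"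
    unfolding J(4) K(4)
    by (intro arg_cong2[where f = "(\<union>)"] cylinder_extend(2)) (use J K in auto)
  also have "\<dots> = prod_emb I M ?L (prod_emb ?L M J B \<union> prod_emb ?L M K B')"
    by (simp add: prod_emb_Un)
  finally have eq: "C \<union> D = prod_emb I M ?L (prod_emb ?L M J B \<union> prod_emb ?L M K B')" .
  moreover have "prod_emb ?L M J B \<union> prod_emb ?L M K B' \<in> sets (PiM ?L M)"
    using J K by (intro sets.Un cylinder_extend(1)) auto
  ultimately show ?thesis
    unfolding cylinder_def using J(1,2) K(1,2) by (intro exI[of _ ?L] exI conjI) auto
qed

lemma cylinder_Compl:
  assumes "cylinder C"
  shows "cylinder (space (PiM I M) - C)"
proof -
  obtain J B where J: "finite J" "J \<subseteq> I" "B \<in> sets (PiM J M)" "C = prod_emb I M J B"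
    using assms(1) by (auto simp: cylinder_def)
  have "restrict x J \<in> (\<Pi>\<^sub>E i\<in>J. space (M i))" if "x \<in> (\<Pi>\<^sub>E i\<in>I. space (M i))" for x
    using that J(2) by (auto simp: PiE_iff)
  then have "space (PiM I M) - C = prod_emb I M J (space (PiM J M) - B)"
    unfolding J(4) prod_emb_def space_PiM by blast
  with J show ?thesis
    unfolding cylinder_def by blast
qed

lemma cylinder_empty: "cylinder {}"
  unfolding cylinder_def by (intro exI[of _ "{}"]) auto

lemma cylinder_UN: "finite N \<Longrightarrow> (\<And>i. i \<in> N \<Longrightarrow> cylinder (C i)) \<Longrightarrow> cylinder (\<Union>i\<in>N. C i)"
  by (induction N rule: finite_induct) (auto intro: cylinder_Un cylinder_empty)

lemma prob_sym_diff_triangle: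
  assumes "A \<in> P.events" "B \<in> P.events" "C \<in> P.events"
  shows "P.prob (sym_diff A C) \<le> P.prob (sym_diff A B) + P.prob (sym_diff B C)"
proof -
  have "P.prob (sym_diff A C) \<le> P.prob (sym_diff A B \<union> sym_diff B C)"
    using assms by (intro P.finite_measure_mono) auto
  also have "\<dots> \<le> P.prob (sym_diff A B) + P.prob (sym_diff B C)"
    using assms by (intro measure_Un_le) auto
  finally show ?thesis .
qed

lemma prob_diff_le_sym_diff:
  assumes "A \<in> P.events" "B \<in> P.events"
  shows "\<bar>P.prob A - P.prob B\<bar> \<le> P.prob (sym_diff A B)"
proof -
  have "P.prob A \<le> P.prob (B \<union> sym_diff A B)" "P.prob B \<le> P.prob (A \<union> sym_diff A B)"
    using assms by (auto intro!: P.finite_measure_mono)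
  moreover have "P.prob (B \<union> sym_diff A B) \<le> P.prob B + P.prob (sym_diff A B)"
    "P.prob (A \<union> sym_diff A B) \<le> P.prob A + P.prob (sym_diff A B)"
    using assms by (auto intro!: measure_Un_le)
  ultimately show ?thesis by linarith
qed

text \<open>The events approximated by cylinders contain the rectangles and are closed under
  complements and countable unions, so they exhaust the generated sigma-algebra. For a union, the
  tail beyond the first n pieces takes one half of the error, and the approximations of these n
  pieces share the other half.\<close>

lemma cylinder_approximation:
  assumes "A \<in> sets (PiM I M)" "0 < e"
  obtains C where "cylinder C" "P.prob (sym_diff A C) < e"
proof -
  have "A \<in> sigma_sets (\<Pi>\<^sub>E i\<in>I. space (M i)) (prod_algebra I M)"
    using assms(1) by (simp add: sets_PiM)
  then have "\<forall>e>0. \<exists>C. cylinder C \<and> P.prob (sym_diff A C) < e"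
  proof (induction rule: sigma_sets.induct)
    case (Basic a)
    then obtain J E where J: "a = prod_emb I M J (PiE J E)" "finite J" "J \<subseteq> I"
        "\<And>i. i \<in> J \<Longrightarrow> E i \<in> sets (M i)"
      by (elim prod_algebraE) auto
    then have "cylinder a"
      unfolding cylinder_def by (intro exI[of _ J] exI[of _ "PiE J E"]) (auto intro!: sets_PiM_I_finite)
    then show ?case by (intro allI impI exI[of _ a]) auto
  next
    case Empty
    show ?case using cylinder_empty by (intro allI impI exI[of _ "{}"]) auto
  next
    case (Compl a)
    have a: "a \<in> sets (PiM I M)" using Compl.hyps by (simp add: sets_PiM)
    show ?case
    proof (intro allI impI)
      fix e :: real assume "0 < e"
      then obtain C where C: "cylinder C" "P.prob (sym_diff a C) < e" using Compl.IH by blast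
      have "sym_diff ((\<Pi>\<^sub>E i\<in>I. space (M i)) - a) (space (PiM I M) - C) = sym_diff a C"
        using sets.sets_into_space[OF a] sets.sets_into_space[OF cylinder_sets[OF C(1)]]
        by (auto simp: space_PiM)
      with C cylinder_Compl[OF C(1)]
      show "\<exists>C. cylinder C \<and> P.prob (sym_diff ((\<Pi>\<^sub>E i\<in>I. space (M i)) - a) C) < e" by metis
    qed
  next
    case (Union a)
    have a: "a i \<in> sets (PiM I M)" for i using Union.hyps by (simp add: sets_PiM)
    show ?case
    proof (intro allI impI)
      fix e :: real assume e: "0 < e"
      have "(\<lambda>n. P.prob (\<Union>i<n. a i)) \<longlonglongrightarrow> P.prob (\<Union>n. \<Union>i<n. a i)"
        using a by (intro P.finite_Lim_measure_incseq) (auto simp: incseq_def, fastforce)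
      moreover have U: "(\<Union>n. \<Union>i<n. a i) = (\<Union>i. a i)" by auto
      ultimately have "\<forall>\<^sub>F n in sequentially. dist (P.prob (\<Union>i<n. a i)) (P.prob (\<Union>i. a i)) < e / 2"
        using e by (intro tendstoD) auto
      then obtain n where "dist (P.prob (\<Union>i<n. a i)) (P.prob (\<Union>i. a i)) < e / 2"
        by (auto simp: eventually_sequentially)
      moreover have "P.prob ((\<Union>i. a i) - (\<Union>i<n. a i)) = P.prob (\<Union>i. a i) - P.prob (\<Union>i<n. a i)"
        using a by (intro P.finite_measure_Diff) auto
      ultimately have n: "P.prob ((\<Union>i. a i) - (\<Union>i<n. a i)) < e / 2"
        unfolding dist_real_def by linarith
      \<comment> \<open>Dividing by \<open>n + 1\<close> keeps the error positive when n is
        0.\<close>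
      define e' where "e' = e / (2 * (real n + 1))"
      have "e' > 0" using e by (simp add: e'_def)
      then have "\<forall>i. \<exists>C. cylinder C \<and> P.prob (sym_diff (a i) C) < e'" using Union.IH by blast
      then obtain C where C: "\<And>i. cylinder (C i)" "\<And>i. P.prob (sym_diff (a i) (C i)) < e'" by metis
      have "P.prob (sym_diff (\<Union>i. a i) (\<Union>i<n. C i)) \<le>
          P.prob (((\<Union>i. a i) - (\<Union>i<n. a i)) \<union> (\<Union>i<n. sym_diff (a i) (C i)))"
        using a C(1)[THEN cylinder_sets] by (intro P.finite_measure_mono) auto
      also have "\<dots> \<le> P.prob ((\<Union>i. a i) - (\<Union>i<n. a i)) + P.prob (\<Union>i<n. sym_diff (a i) (C i))"
        using a C(1)[THEN cylinder_sets] by (intro measure_Un_le) auto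
      also have "P.prob (\<Union>i<n. sym_diff (a i) (C i)) \<le> (\<Sum>i<n. P.prob (sym_diff (a i) (C i)))"
        using a C(1)[THEN cylinder_sets] by (intro P.finite_measure_subadditive_finite) auto
      also have "\<dots> \<le> (\<Sum>i<n. e')" using C(2) by (intro sum_mono) (auto intro: less_imp_le)
      also have "\<dots> \<le> e / 2" using e by (simp add: e'_def field_simps)
      finally have "P.prob (sym_diff (\<Union>i. a i) (\<Union>i<n. C i)) < e" using n by simp
      then show "\<exists>C. cylinder C \<and> P.prob (sym_diff (\<Union>i. a i) C) < e"
        using C(1) by (intro exI[of _ "\<Union>i<n. C i"]) (auto intro!: cylinder_UN)
    qed
  qed
  then show thesis using that assms(2) by blast
qed

lemma indep_vars_coordinates: "P.indep_vars M (\<lambda>i x. x i) I"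
proof (cases "I = {}")
  case True
  show ?thesis unfolding P.indep_vars_def P.indep_sets_def unfolding True by simp
next
  case False
  have "distr (PiM I M) (PiM I M) (\<lambda>x. \<lambda>i\<in>I. x i) = distr (PiM I M) (PiM I M) (\<lambda>x. x)"
    by (intro distr_cong) (auto simp: space_PiM PiE_iff extensional_def fun_eq_iff)
  also have "\<dots> = PiM I M" by (rule distr_id2) simp
  also have "\<dots> = (\<Pi>\<^sub>M i\<in>I. distr (PiM I M) (M i) (\<lambda>x. x i))"
    by (intro PiM_cong) (auto simp: PiM_component)
  finally show ?thesis
    by (subst P.indep_vars_iff_distr_eq_PiM'[OF False]) auto
qed

lemma distr_restrict_PiM:
  assumes "J \<subseteq> I"
  shows "distr (PiM I M) (PiM J M) (\<lambda>x. restrict x J) = PiM J M"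
  using distr_PiM_reindex[of I M "\<lambda>i. i" J] assms M.prob_space_axioms
  by (auto simp: restrict_def[abs_def])

lemma indep_restrict:
  assumes "J \<subseteq> I" "K \<subseteq> I" "J \<inter> K = {}"
  shows "P.indep_var (PiM J M) (\<lambda>x. restrict x J) (PiM K M) (\<lambda>x. restrict x K)"
  using P.indep_var_restrict[OF indep_vars_coordinates assms(3,1,2)] by simp

text \<open>Fubini for null events: restrictions to disjoint index sets are independent, so the
  measure is the product of its two parts. This serves to freeze some coordinates and to argue about
  the others as still random.\<close>

lemma AE_PiM_split:
  assumes "J \<union> K = I" "J \<inter> K = {}" and Q[measurable]: "Measurable.pred (PiM I M) Q"
    and AE: "AE x in PiM J M. AE y in PiM K M. Q (merge J K (x, y))"
  shows "AE z in PiM I M. Q z"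
proof -
  have JK: "J \<subseteq> I" "K \<subseteq> I" using assms by auto
  interpret J: prob_space "PiM J M" by (intro prob_space_PiM M.prob_space_axioms)
  interpret K: prob_space "PiM K M" by (intro prob_space_PiM M.prob_space_axioms)
  interpret JK: pair_prob_space "PiM J M" "PiM K M" ..
  have [measurable]: "merge J K \<in> measurable (PiM J M \<Otimes>\<^sub>M PiM K M) (PiM I M)"
    using measurable_merge[of J K M] assms(1) by simp
  have [measurable]: "(\<lambda>x. restrict x J) \<in> measurable (PiM I M) (PiM J M)"
    "(\<lambda>x. restrict x K) \<in> measurable (PiM I M) (PiM K M)"
    using JK by (auto intro: measurable_restrict_subset)
  have "AE z in PiM J M \<Otimes>\<^sub>M PiM K M. Q (merge J K z)"
    by (rule JK.AE_pair_measure) (use AE in auto)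
  moreover have eq: "PiM J M \<Otimes>\<^sub>M PiM K M =
      distr (PiM I M) (PiM J M \<Otimes>\<^sub>M PiM K M) (\<lambda>x. (restrict x J, restrict x K))"
    using indep_restrict[OF JK assms(2)] unfolding P.indep_var_distribution_eq
    by (simp add: distr_restrict_PiM JK)
  ultimately have "AE z in distr (PiM I M) (PiM J M \<Otimes>\<^sub>M PiM K M) (\<lambda>x. (restrict x J, restrict x K)). Q (merge J K z)"
    by (subst (asm) eq)
  then have "AE z in PiM I M. Q (merge J K (restrict z J, restrict z K))"
    by (subst (asm) AE_distr_iff) auto
  then show ?thesis
  proof (rule AE_mp, intro AE_I2 impI)
    fix z assume z: "z \<in> space (PiM I M)" and *: "Q (merge J K (restrict z J, restrict z K))"
    have "merge J K (restrict z J, restrict z K) = z"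
      using z assms(1) by (auto simp: merge_def space_PiM PiE_iff extensional_def fun_eq_iff)
    with * show "Q z" by simp
  qed
qed

text \<open>The map \<open>x * (1 - x)\<close> is 1-Lipschitz on the unit interval, since
  \<open>1 - a - c\<close> has modulus at most 1 there.\<close>

lemma prob_mult_compl_le:
  assumes "A \<in> P.events" "C \<in> P.events" "P.prob (sym_diff A C) \<le> e"
  shows "P.prob A * (1 - P.prob A) \<le> P.prob C * (1 - P.prob C) + e"
proof -
  define a c where ac: "a = P.prob A" "c = P.prob C"
  have "\<bar>a - c\<bar> \<le> e" using prob_diff_le_sym_diff[OF assms(1,2)] assms(3) by (simp add: ac)
  moreover have "0 \<le> a" "a \<le> 1" "0 \<le> c" "c \<le> 1" by (auto simp: ac)
  moreover have "a * (1 - a) - c * (1 - c) = (a - c) * (1 - a - c)" by (simp add: algebra_simps)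
  moreover have "(a - c) * (1 - a - c) \<le> \<bar>a - c\<bar> * \<bar>1 - a - c\<bar>"
    by (metis abs_ge_self abs_mult)
  moreover have "\<bar>a - c\<bar> * \<bar>1 - a - c\<bar> \<le> \<bar>a - c\<bar> * 1"
    using calculation by (intro mult_left_mono) auto
  ultimately show ?thesis by (simp add: ac)
qed

end

section \<open>Measure-preserving shifts and mixing\<close>

locale shift = product_prob_space M I for M :: "'i \<Rightarrow> 'a measure" and I +
  fixes t :: "'i \<Rightarrow> 'i"
  assumes inj_shift: "inj_on t I" and shift_mem: "i \<in> I \<Longrightarrow> t i \<in> I"
    and shift_measure: "i \<in> I \<Longrightarrow> M (t i) = M i"
begin

definition act :: "('i \<Rightarrow> 'a) \<Rightarrow> ('i \<Rightarrow> 'a)" where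
  "act \<omega> = (\<lambda>i\<in>I. \<omega> (t i))"

lemma distr_act: "distr (PiM I M) (PiM I M) act = PiM I M"
proof -
  have "PiM I (\<lambda>i. M (t i)) = PiM I M"
    by (intro PiM_cong) (auto simp: shift_measure)
  then show ?thesis
    using distr_PiM_reindex[of I M t I] M.prob_space_axioms inj_shift shift_mem
    by (simp add: act_def[abs_def] Pi_iff)
qed

lemma measurable_act[measurable]: "act \<in> measurable (PiM I M) (PiM I M)"
  unfolding act_def[abs_def]
proof (rule measurable_restrict)
  fix i assume "i \<in> I"
  then show "(\<lambda>x. x (t i)) \<in> measurable (PiM I M) (M i)"
    using shift_mem shift_measure measurable_component_singleton[of "t i" I M] by simp
qed

lemma prob_act:
  assumes "A \<in> P.events"
  shows "P.prob (act -` A \<inter> space (PiM I M)) = P.prob A"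
  using measure_distr[OF measurable_act assms] by (simp add: distr_act)

lemma prob_act_Collect:
  assumes "Measurable.pred (PiM I M) Q"
  shows "\<P>(x in PiM I M. Q (act x)) = \<P>(x in PiM I M. Q x)"
proof -
  have "act -` {x\<in>space (PiM I M). Q x} \<inter> space (PiM I M) = {x\<in>space (PiM I M). Q (act x)}"
    using measurable_space[OF measurable_act] by auto
  with prob_act[of "{x\<in>space (PiM I M). Q x}"] assms show ?thesis by simp
qed

text \<open>The approximation error counts twice: once for the event, and once for its translate,
  where it is the same because the shift preserves the measure.\<close>

lemma prob_sym_diff_act:
  assumes "A \<in> P.events" "C \<in> P.events"
  shows "P.prob (sym_diff C (act -` C \<inter> space (PiM I M))) \<le>
    P.prob (sym_diff A (act -` A \<inter> space (PiM I M))) + 2 * P.prob (sym_diff A C)"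
proof -
  let ?T = "\<lambda>A. act -` A \<inter> space (PiM I M)"
  have [measurable]: "A \<in> P.events" "C \<in> P.events" by fact+
  have "P.prob (sym_diff C (?T C)) \<le> P.prob (sym_diff C A) + P.prob (sym_diff A (?T C))"
    by (intro prob_sym_diff_triangle) measurable
  also have "P.prob (sym_diff A (?T C)) \<le> P.prob (sym_diff A (?T A)) + P.prob (sym_diff (?T A) (?T C))"
    by (intro prob_sym_diff_triangle) measurable
  also have "sym_diff (?T A) (?T C) = ?T (sym_diff A C)" by auto
  also have "P.prob (?T (sym_diff A C)) = P.prob (sym_diff A C)"
    by (intro prob_act) auto
  also have "sym_diff C A = sym_diff A C" by auto
  finally show ?thesis by simp
qed

text \<open>The cylinder depends on the coordinates in \<open>J\<close> and its translate on those
  in the disjoint image of \<open>J\<close>, so the two are independent with equal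
  probabilities.\<close>

lemma prob_cylinder_act_disjoint:
  assumes J: "J \<subseteq> I" "B \<in> sets (PiM J M)" "C = prod_emb I M J B" and disj: "t ` J \<inter> J = {}"
  shows "P.prob (C \<inter> (act -` C \<inter> space (PiM I M))) = P.prob C * P.prob C"
proof -
  let ?T = "\<lambda>A. act -` A \<inter> space (PiM I M)"
  have tJ: "t ` J \<subseteq> I" using J shift_mem by auto
  define B' where "B' = (\<lambda>x. \<lambda>i\<in>J. x (t i)) -` B \<inter> space (PiM (t ` J) M)"
  have "(\<lambda>x. \<lambda>i\<in>J. x (t i)) \<in> measurable (PiM (t ` J) M) (PiM J M)"
  proof (rule measurable_restrict)
    fix i assume "i \<in> J"
    then have "M (t i) = M i" using J(1) by (intro shift_measure) auto
    with \<open>i \<in> J\<close> show "(\<lambda>x. x (t i)) \<in> measurable (PiM (t ` J) M) (M i)"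
      using measurable_component_singleton[of "t i" "t ` J" M] by simp
  qed
  then have B': "B' \<in> sets (PiM (t ` J) M)" unfolding B'_def using J(2) by (rule measurable_sets)
  have C: "C = (\<lambda>x. restrict x J) -` B \<inter> space (PiM I M)"
    by (simp add: J(3) prod_emb_def space_PiM)
  have C': "?T C = (\<lambda>x. restrict x (t ` J)) -` B' \<inter> space (PiM I M)"
  proof -
    have "restrict (act x) J = (\<lambda>i\<in>J. restrict x (t ` J) (t i))" for x
      using J(1) by (auto simp: act_def fun_eq_iff)
    moreover have "restrict x (t ` J) \<in> space (PiM (t ` J) M)" "act x \<in> space (PiM I M)"
      if "x \<in> space (PiM I M)" for x
      using that tJ measurable_space[OF measurable_act that] by (auto simp: space_PiM PiE_iff)
    ultimately show ?thesis by (auto simp: C B'_def)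
  qed
  have "P.prob (C \<inter> ?T C) = P.prob ((\<lambda>x. (restrict x J, restrict x (t ` J))) -` (B \<times> B') \<inter> space (PiM I M))"
    unfolding C' by (intro arg_cong[where f = P.prob]) (auto simp: C)
  also have "\<dots> = P.prob C * P.prob (?T C)"
    unfolding C' unfolding C
    by (rule P.indep_varD[OF indep_restrict]) (use J(1,2) tJ disj B' in auto)
  also have "P.prob (?T C) = P.prob C"
    using J by (intro prob_act) (auto intro!: measurable_prod_emb)
  finally show ?thesis .
qed

end

text \<open>Some \<open>k\<close> moves the coordinates of an approximating cylinder off themselves.
  The cylinder, of probability c, is then independent of its translate, so it leaves the translate
  with probability \<open>c * (1 - c)\<close>, which near-invariance bounds. Of the three errors
  \<open>e / 3\<close>, two come from comparing translates and one from returning to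
  \<open>A\<close>.\<close>

lemma mixing_bound:
  fixes t :: "'k \<Rightarrow> 'i \<Rightarrow> 'i"
  assumes shift: "\<And>k. k \<in> K \<Longrightarrow> shift M I (t k)"
    and disj: "\<And>J. finite J \<Longrightarrow> J \<subseteq> I \<Longrightarrow> \<exists>k\<in>K. t k ` J \<inter> J = {}"
    and A: "A \<in> sets (PiM I M)"
    and le: "\<And>k. k \<in> K \<Longrightarrow> measure (PiM I M)
       (sym_diff A (shift.act I (t k) -` A \<inter> space (PiM I M))) \<le> \<delta>"
  shows "measure (PiM I M) A * (1 - measure (PiM I M) A) \<le> \<delta>"
proof (rule field_le_epsilon)
  fix e :: real assume "0 < e"
  have "K \<noteq> {}" using disj[of "{}"] by blast
  then obtain k0 where "k0 \<in> K" by auto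
  interpret k0: shift M I "t k0" by (rule shift) fact
  obtain C where C: "k0.cylinder C" "k0.P.prob (sym_diff A C) < e / 3"
    by (rule k0.cylinder_approximation[OF A, of "e / 3"]) (use \<open>0 < e\<close> in simp)
  from C(1) obtain J B where J: "finite J" "J \<subseteq> I" "B \<in> sets (PiM J M)" "C = prod_emb I M J B"
    by (auto simp: k0.cylinder_def)
  obtain k where k: "k \<in> K" "t k ` J \<inter> J = {}" using disj[OF J(1,2)] by auto
  interpret k: shift M I "t k" by (rule shift) fact
  note C_ev = k0.cylinder_sets[OF C(1)]
  let ?C' = "k.act -` C \<inter> space (PiM I M)"
  have C'_ev: "?C' \<in> sets (PiM I M)" using C_ev by measurable
  define c where "c = k0.P.prob C"
  have "k0.P.prob C = k0.P.prob (C - ?C') + k0.P.prob (C \<inter> ?C')"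
    using C_ev C'_ev
    by (subst k0.P.finite_measure_Union[symmetric]) (auto intro!: arg_cong[where f = k0.P.prob])
  moreover have "k0.P.prob (C \<inter> ?C') = c * c"
    unfolding c_def using k.prob_cylinder_act_disjoint[OF J(2-4) k(2)] .
  moreover have "k0.P.prob (C - ?C') \<le> k0.P.prob (sym_diff C ?C')"
    using C_ev C'_ev by (intro k0.P.finite_measure_mono) auto
  moreover have "k0.P.prob (sym_diff C ?C') \<le> \<delta> + 2 * k0.P.prob (sym_diff A C)"
    using k.prob_sym_diff_act[OF A C_ev] le[OF k(1)] by linarith
  ultimately have "c * (1 - c) \<le> \<delta> + 2 * k0.P.prob (sym_diff A C)"
    by (simp add: c_def algebra_simps)
  moreover have "k0.P.prob A * (1 - k0.P.prob A) \<le> c * (1 - c) + k0.P.prob (sym_diff A C)"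
    unfolding c_def by (intro k0.prob_mult_compl_le A C_ev order_refl)
  ultimately show "k0.P.prob A * (1 - k0.P.prob A) \<le> \<delta> + e" using C(2) by linarith
qed

section \<open>Fourier analysis of Bernoulli shifts\<close>

locale bernoulli =
  fixes p :: "'i \<Rightarrow> real" and I :: "'i set"
  assumes p_nonneg: "0 \<le> p i" and p_le_1: "p i \<le> 1"
begin

abbreviation Bern :: "'i \<Rightarrow> bool measure" where
  "Bern i \<equiv> measure_pmf (bernoulli_pmf (p i))"

sublocale product_prob_space Bern I
  by unfold_locales

text \<open>The characters are not normalised, so that \<open>p i = 0\<close> and \<open>p i = 1\<close> need no special treatment;
  \<open>vol S\<close> is the squared norm of \<open>chi S\<close>.\<close>

definition chi :: "'i set \<Rightarrow> ('i \<Rightarrow> bool) \<Rightarrow> real" where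
  "chi S \<omega> = (\<Prod>i\<in>S. of_bool (\<omega> i) - p i)"

definition vol :: "'i set \<Rightarrow> real" where
  "vol S = (\<Prod>i\<in>S. p i * (1 - p i))"

lemma vol_nonneg: "0 \<le> vol S"
  unfolding vol_def by (intro prod_nonneg) (auto simp: p_nonneg p_le_1)

text \<open>A function of one bit is its mean plus a multiple of the centred bit. Applied to
  coordinate \<open>j\<close>, this leaves two functions of the remaining coordinates for the
  induction.\<close>

lemma chi_expansion:
  fixes f :: "('i \<Rightarrow> bool) \<Rightarrow> real"
  assumes "finite J" "\<And>\<omega> \<omega>'. (\<And>i. i \<in> J \<Longrightarrow> \<omega> i = \<omega>' i) \<Longrightarrow> f \<omega> = f \<omega>'"
  shows "\<exists>a. \<forall>\<omega>. f \<omega> = (\<Sum>S\<in>Pow J. a S * chi S \<omega>)"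
  using assms
proof (induction J arbitrary: f rule: finite_induct)
  case empty
  then show ?case by (intro exI[of _ "\<lambda>_. f undefined"]) (auto simp: chi_def)
next
  case (insert j J)
  define f1 where "f1 \<omega> = f (fun_upd \<omega> j True)" for \<omega>
  define f0 where "f0 \<omega> = f (fun_upd \<omega> j False)" for \<omega>
  have "\<exists>a. \<forall>\<omega>. f1 \<omega> = (\<Sum>S\<in>Pow J. a S * chi S \<omega>)"
    by (rule insert.IH) (auto simp: f1_def intro!: insert.prems)
  then obtain a1 where a1: "\<And>\<omega>. f1 \<omega> = (\<Sum>S\<in>Pow J. a1 S * chi S \<omega>)" by blast
  have "\<exists>a. \<forall>\<omega>. f0 \<omega> = (\<Sum>S\<in>Pow J. a S * chi S \<omega>)"
    by (rule insert.IH) (auto simp: f0_def intro!: insert.prems)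
  then obtain a0 where a0: "\<And>\<omega>. f0 \<omega> = (\<Sum>S\<in>Pow J. a0 S * chi S \<omega>)" by blast
  \<comment> \<open>Averaging over coordinate \<open>j\<close> gives the coefficients of sets
    without \<open>j\<close>; the difference of the two values gives those of sets containing
    \<open>j\<close>.\<close>
  define a where "a S = (if j \<in> S then a1 (S - {j}) - a0 (S - {j})
      else p j * a1 S + (1 - p j) * a0 S)" for S
  have "f \<omega> = (\<Sum>S\<in>Pow (insert j J). a S * chi S \<omega>)" for \<omega>
  proof -
    have chi_j: "chi (insert j S) \<omega> = (of_bool (\<omega> j) - p j) * chi S \<omega>" if "S \<in> Pow J" for S
    proof -
      have "finite S" "j \<notin> S" using that insert.hyps finite_subset[of S J] by auto
      then show ?thesis by (simp add: chi_def)
    qed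
    have "f \<omega> = f1 \<omega> * of_bool (\<omega> j) + f0 \<omega> * (1 - of_bool (\<omega> j))"
      unfolding f1_def f0_def by (cases "\<omega> j") (auto intro!: insert.prems split: if_splits)
    also have "\<dots> = (p j * f1 \<omega> + (1 - p j) * f0 \<omega>) + (f1 \<omega> - f0 \<omega>) * (of_bool (\<omega> j) - p j)"
      by (simp add: algebra_simps)
    also have "p j * f1 \<omega> + (1 - p j) * f0 \<omega> = (\<Sum>S\<in>Pow J. a S * chi S \<omega>)"
      unfolding a1 a0 sum_distrib_left sum.distrib[symmetric] using insert.hyps
      by (intro sum.cong) (auto simp: a_def algebra_simps)
    also have "(f1 \<omega> - f0 \<omega>) * (of_bool (\<omega> j) - p j) = (\<Sum>S\<in>insert j ` Pow J. a S * chi S \<omega>)"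
    proof -
      have "inj_on (insert j) (Pow J)" using insert.hyps by (auto simp: inj_on_def)
      moreover have "insert j S - {j} = S" if "S \<in> Pow J" for S using that insert.hyps by auto
      ultimately show ?thesis
        unfolding a1 a0 sum_subtractf[symmetric] sum_distrib_right
        by (subst sum.reindex) (auto intro!: sum.cong simp: a_def chi_j algebra_simps)
    qed
    also have "(\<Sum>S\<in>Pow J. a S * chi S \<omega>) + (\<Sum>S\<in>insert j ` Pow J. a S * chi S \<omega>) =
        (\<Sum>S\<in>Pow (insert j J). a S * chi S \<omega>)"
      unfolding Pow_insert using insert.hyps by (subst sum.union_disjoint) auto
    finally show ?thesis .
  qed
  then show ?case by blast
qed

lemma integrable_coordinate_prod:
  fixes g :: "'i \<Rightarrow> bool \<Rightarrow> real"
  assumes "finite J" "J \<subseteq> I"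
  shows "integrable (PiM I Bern) (\<lambda>\<omega>. \<Prod>i\<in>J. g i (\<omega> i))"
    and "(\<integral>\<omega>. (\<Prod>i\<in>J. g i (\<omega> i)) \<partial>PiM I Bern) = (\<Prod>i\<in>J. g i True * p i + g i False * (1 - p i))"
proof -
  have ind: "P.indep_vars (\<lambda>_. borel) (\<lambda>i \<omega>. g i (\<omega> i)) J"
    using P.indep_vars_compose2[OF P.indep_vars_subset[OF indep_vars_coordinates assms(2)],
        of "\<lambda>i. g i" "\<lambda>_. borel"] by simp
  have meas: "(\<lambda>\<omega>. g i (\<omega> i)) \<in> borel_measurable (PiM I Bern)" if "i \<in> J" for i
    using that assms by (intro measurable_compose[OF measurable_component_singleton[of i I Bern]]) auto
  have int: "integrable (PiM I Bern) (\<lambda>\<omega>. g i (\<omega> i))" if "i \<in> J" for i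
  proof (rule P.integrable_const_bound[where B = "max \<bar>g i True\<bar> \<bar>g i False\<bar>"])
    show "AE \<omega> in PiM I Bern. norm (g i (\<omega> i)) \<le> max \<bar>g i True\<bar> \<bar>g i False\<bar>"
      by (intro AE_I2) (metis (full_types) max.cobounded1 max.cobounded2 real_norm_def)
  qed (rule meas[OF that])
  show "integrable (PiM I Bern) (\<lambda>\<omega>. \<Prod>i\<in>J. g i (\<omega> i))"
    by (rule P.indep_vars_integrable[OF assms(1) ind int])
  have "(\<integral>\<omega>. g i (\<omega> i) \<partial>PiM I Bern) = g i True * p i + g i False * (1 - p i)" if "i \<in> J" for i
  proof -
    have iI: "i \<in> I" using that assms by auto
    have "(\<integral>\<omega>. g i (\<omega> i) \<partial>PiM I Bern) = (\<integral>b. g i b \<partial>distr (PiM I Bern) (Bern i) (\<lambda>\<omega>. \<omega> i))"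
      using iI by (intro integral_distr[symmetric]) auto
    also have "\<dots> = (\<integral>b. g i b \<partial>Bern i)" by (simp only: PiM_component[OF iI])
    also have "\<dots> = g i True * p i + g i False * (1 - p i)"
      using p_nonneg p_le_1 by (simp add: mult.commute)
    finally show ?thesis .
  qed
  then show "(\<integral>\<omega>. (\<Prod>i\<in>J. g i (\<omega> i)) \<partial>PiM I Bern) = (\<Prod>i\<in>J. g i True * p i + g i False * (1 - p i))"
    using P.indep_vars_lebesgue_integral[OF assms(1) ind int] by simp
qed

text \<open>A coordinate in exactly one of the sets contributes the mean of a centred bit, which is
  0; a common coordinate contributes its variance.\<close>

lemma chi_orthogonal:
  assumes "finite S" "S \<subseteq> I" "finite T" "T \<subseteq> I"
  shows "integrable (PiM I Bern) (\<lambda>\<omega>. chi S \<omega> * chi T \<omega>)"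
    and "(\<integral>\<omega>. chi S \<omega> * chi T \<omega> \<partial>PiM I Bern) = (if S = T then vol S else 0)"
proof -
  define g where "g i b = (if i \<in> S then of_bool b - p i else 1) * (if i \<in> T then of_bool b - p i else 1)"
    for i b
  have chi_prod: "chi U \<omega> = (\<Prod>i\<in>S \<union> T. if i \<in> U then of_bool (\<omega> i) - p i else 1)"
    if "U \<subseteq> S \<union> T" for U \<omega>
    unfolding chi_def using that assms by (intro prod.mono_neutral_cong_left) auto
  have eq: "chi S \<omega> * chi T \<omega> = (\<Prod>i\<in>S \<union> T. g i (\<omega> i))" for \<omega>
    by (simp add: chi_prod[of S] chi_prod[of T] g_def prod.distrib)
  show "integrable (PiM I Bern) (\<lambda>\<omega>. chi S \<omega> * chi T \<omega>)"
    unfolding eq using assms by (intro integrable_coordinate_prod) auto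
  have "(\<integral>\<omega>. chi S \<omega> * chi T \<omega> \<partial>PiM I Bern) =
      (\<Prod>i\<in>S \<union> T. g i True * p i + g i False * (1 - p i))"
    unfolding eq using assms by (intro integrable_coordinate_prod) auto
  also have "\<dots> = (\<Prod>i\<in>S \<union> T. if i \<in> S \<and> i \<in> T then p i * (1 - p i) else 0)"
    by (intro prod.cong) (auto simp: g_def algebra_simps)
  also have "\<dots> = (if S = T then vol S else 0)"
    using assms by (auto simp: vol_def intro!: prod_zero)
  finally show "(\<integral>\<omega>. chi S \<omega> * chi T \<omega> \<partial>PiM I Bern) = (if S = T then vol S else 0)" .
qed

lemma parseval:
  assumes "finite F" "\<And>S. S \<in> F \<Longrightarrow> finite S \<and> S \<subseteq> I"
  shows "(\<integral>\<omega>. (\<Sum>S\<in>F. c S * chi S \<omega>)\<^sup>2 \<partial>PiM I Bern) = (\<Sum>S\<in>F. (c S)\<^sup>2 * vol S)"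
proof -
  have "(\<integral>\<omega>. (\<Sum>S\<in>F. c S * chi S \<omega>)\<^sup>2 \<partial>PiM I Bern) =
      (\<integral>\<omega>. (\<Sum>S\<in>F. \<Sum>T\<in>F. (c S * c T) * (chi S \<omega> * chi T \<omega>)) \<partial>PiM I Bern)"
    by (simp add: power2_eq_square sum_product ac_simps)
  also have "\<dots> = (\<Sum>S\<in>F. \<Sum>T\<in>F. (c S * c T) * (if S = T then vol S else 0))"
    using assms by (simp add: chi_orthogonal integral_sum)
  also have "\<dots> = (\<Sum>S\<in>F. (c S)\<^sup>2 * vol S)"
    using assms(1) by (simp add: power2_eq_square if_distrib cong: if_cong)
  finally show ?thesis .
qed

text \<open>By Parseval the variance \<open>V\<close> is the sum of \<open>(a S)^2 * vol S\<close>
  over nonempty \<open>S\<close>; dividing by \<open>V\<close> turns the summands into a probability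
  measure \<mu> on finite sets of coordinates. The constant term is left out because it is invariant
  under every shift. A shift carries each character to the character of the image set, so an event
  that is almost invariant in mean square makes \<mu> almost invariant.\<close>

lemma cylinder_almost_invariant_pmf:
  assumes "cylinder C" and V: "V = P.prob C * (1 - P.prob C)" "0 < V"
  obtains \<mu> :: "'i set pmf" where "finite (set_pmf \<mu>)" "set_pmf \<mu> \<subseteq> {S. finite S \<and> S \<noteq> {} \<and> S \<subseteq> I}"
    "\<And>t \<A>. shift Bern I t \<Longrightarrow> (\<And>i. i \<in> I \<Longrightarrow> p (t i) = p i) \<Longrightarrow>
       V * (measure_pmf.prob \<mu> {S. t ` S \<in> \<A>} - measure_pmf.prob \<mu> \<A>)\<^sup>2
         \<le> 4 * P.prob (sym_diff C (shift.act I t -` C \<inter> space (PiM I Bern)))"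
proof -
  obtain J B where J: "finite J" "J \<subseteq> I" "B \<in> sets (PiM J Bern)" "C = prod_emb I Bern J B"
    using assms(1) by (auto simp: cylinder_def)
  define f :: "('i \<Rightarrow> bool) \<Rightarrow> real" where "f \<omega> = of_bool (restrict \<omega> J \<in> B)" for \<omega>
  have "\<exists>a. \<forall>\<omega>. f \<omega> = (\<Sum>S\<in>Pow J. a S * chi S \<omega>)"
  proof (rule chi_expansion[OF J(1)])
    fix \<omega> \<omega>' :: "'i \<Rightarrow> bool" assume "\<And>i. i \<in> J \<Longrightarrow> \<omega> i = \<omega>' i"
    then have "restrict \<omega> J = restrict \<omega>' J" by (auto simp: fun_eq_iff)
    then show "f \<omega> = f \<omega>'" by (simp add: f_def)
  qed
  then obtain a where a: "\<And>\<omega>. f \<omega> = (\<Sum>S\<in>Pow J. a S * chi S \<omega>)" by blast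
  have C: "C \<in> P.events" using assms(1) by (rule cylinder_sets)
  have f_C: "f \<omega> = indicator C \<omega>" if "\<omega> \<in> space (PiM I Bern)" for \<omega>
    using that by (auto simp: f_def J(4) prod_emb_def space_PiM indicator_def)
  have fin: "finite S \<and> S \<subseteq> I" if "S \<in> Pow J" for S
    using that J finite_subset by auto
  have "a {} = P.prob C"
  proof -
    have "(\<integral>\<omega>. f \<omega> \<partial>PiM I Bern) = (\<integral>\<omega>. (\<Sum>S\<in>Pow J. a S * (chi S \<omega> * chi {} \<omega>)) \<partial>PiM I Bern)"
      by (simp add: a chi_def)
    also have "\<dots> = (\<Sum>S\<in>Pow J. a S * (if S = {} then vol S else 0))"
      using fin by (simp add: chi_orthogonal integral_sum)
    also have "\<dots> = (\<Sum>S\<in>Pow J. if S = {} then a S else 0)"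
      by (intro sum.cong) (auto simp: vol_def)
    also have "\<dots> = a {}" using J(1) by simp
    finally have "(\<integral>\<omega>. f \<omega> \<partial>PiM I Bern) = a {}" .
    moreover have "(\<integral>\<omega>. f \<omega> \<partial>PiM I Bern) = (\<integral>\<omega>. indicator C \<omega> \<partial>PiM I Bern)"
      by (intro Bochner_Integration.integral_cong) (auto simp: f_C)
    ultimately show ?thesis using C by simp
  qed
  have "P.prob C = (\<Sum>S\<in>Pow J. (a S)\<^sup>2 * vol S)"
  proof -
    have "(\<integral>\<omega>. (f \<omega>)\<^sup>2 \<partial>PiM I Bern) = (\<Sum>S\<in>Pow J. (a S)\<^sup>2 * vol S)"
      unfolding a using fin J(1) by (intro parseval) auto
    moreover have "(\<integral>\<omega>. (f \<omega>)\<^sup>2 \<partial>PiM I Bern) = (\<integral>\<omega>. indicator C \<omega> \<partial>PiM I Bern)"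
      by (intro Bochner_Integration.integral_cong) (auto simp: f_C indicator_def)
    ultimately show ?thesis using C by simp
  qed
  also have "\<dots> = (a {})\<^sup>2 * vol {} + (\<Sum>S\<in>Pow J - {{}}. (a S)\<^sup>2 * vol S)"
    using J(1) by (subst sum.remove[of _ "{}"]) auto
  finally have V_sum: "V = (\<Sum>S\<in>Pow J - {{}}. (a S)\<^sup>2 * vol S)"
    using \<open>a {} = P.prob C\<close> by (simp add: V(1) vol_def power2_eq_square algebra_simps)
  define w where "w S = (if S \<in> Pow J - {{}} then (a S)\<^sup>2 * vol S / V else 0)" for S
  define \<mu> where "\<mu> = embed_pmf w"
  have w_nonneg: "0 \<le> w S" for S using V(2) vol_nonneg by (simp add: w_def)
  have pmf_\<mu>: "pmf \<mu> S = w S" for S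
    unfolding \<mu>_def
  proof (rule pmf_embed_pmf[OF w_nonneg])
    have "(\<integral>\<^sup>+ S. ennreal (w S) \<partial>count_space UNIV) = (\<Sum>S\<in>Pow J - {{}}. ennreal (w S))"
      using J(1) by (intro nn_integral_count_space') (auto simp: w_def)
    also have "\<dots> = ennreal (\<Sum>S\<in>Pow J - {{}}. w S)" using w_nonneg by (intro sum_ennreal)
    also have "(\<Sum>S\<in>Pow J - {{}}. w S) = (\<Sum>S\<in>Pow J - {{}}. (a S)\<^sup>2 * vol S) / V"
      unfolding sum_divide_distrib by (intro sum.cong) (auto simp: w_def)
    also have "\<dots> = 1" using V_sum V(2) by simp
    finally show "(\<integral>\<^sup>+ S. ennreal (w S) \<partial>count_space UNIV) = 1" by simp
  qed
  have set_\<mu>: "set_pmf \<mu> \<subseteq> Pow J - {{}}"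
    by (auto simp: set_pmf_iff pmf_\<mu> w_def split: if_splits)
  have prob_\<mu>: "measure_pmf.prob \<mu> \<A> = (\<Sum>S\<in>Pow J. of_bool (S \<noteq> {} \<and> S \<in> \<A>) * ((a S)\<^sup>2 * vol S)) / V" for \<A>
  proof -
    have "measure_pmf.prob \<mu> \<A> = measure_pmf.prob \<mu> ((Pow J - {{}}) \<inter> \<A>)"
      using set_\<mu> by (intro measure_eq_AE) (auto simp: AE_measure_pmf_iff)
    also have "\<dots> = (\<Sum>S\<in>(Pow J - {{}}) \<inter> \<A>. w S)"
      using J(1) by (subst measure_measure_pmf_finite) (auto simp: pmf_\<mu>)
    also have "\<dots> = (\<Sum>S\<in>Pow J. of_bool (S \<noteq> {} \<and> S \<in> \<A>) * ((a S)\<^sup>2 * vol S) / V)"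
      using J(1) by (intro sum.mono_neutral_cong_left) (auto simp: w_def)
    finally show ?thesis by (simp add: sum_divide_distrib)
  qed
  show thesis
  proof (rule that)
    show "finite (set_pmf \<mu>)" using finite_subset[OF set_\<mu>] J(1) by simp
    show "set_pmf \<mu> \<subseteq> {S. finite S \<and> S \<noteq> {} \<and> S \<subseteq> I}" using set_\<mu> fin by auto
  next
    fix t \<A> assume "shift Bern I t" and p_t: "\<And>i. i \<in> I \<Longrightarrow> p (t i) = p i"
    then interpret t: shift Bern I t by simp
    define Ft where "Ft = image t ` Pow J"
    define F where "F = Pow J \<union> Ft"
    have F: "finite F" "\<And>S. S \<in> F \<Longrightarrow> finite S \<and> S \<subseteq> I"
      using J fin t.shift_mem by (auto simp: F_def Ft_def intro: finite_subset)
    have inj: "inj_on (image t) (Pow J)"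
      using t.inj_shift J(2) by (auto simp: inj_on_def inj_on_image_eq_iff[of t I])
    \<comment> \<open>\<open>a'\<close> and \<open>b\<close> are the coefficients of
      \<open>f\<close> and of its translate, extended by zero to the common index family
      \<open>F\<close>.\<close>
    define a' where "a' S = (if S \<in> Pow J then a S else 0)" for S
    define b where "b S = (if S \<in> Ft then a (the_inv_into (Pow J) (image t) S) else 0)" for S
    have b_image: "b (t ` S) = a S" if "S \<in> Pow J" for S
      using that inj by (simp add: b_def Ft_def the_inv_into_f_f)
    have sum_a': "(\<Sum>S\<in>F. h (a' S) S) = (\<Sum>S\<in>Pow J. h (a S) S)"
      if "\<And>S. h 0 S = 0" for h :: "real \<Rightarrow> 'i set \<Rightarrow> real"
      using F(1) that by (intro sum.mono_neutral_cong_right) (auto simp: F_def a'_def)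
    have sum_b: "(\<Sum>S\<in>F. h (b S) S) = (\<Sum>S\<in>Pow J. h (a S) (t ` S))"
      if "\<And>S. h 0 S = 0" for h :: "real \<Rightarrow> 'i set \<Rightarrow> real"
    proof -
      have "(\<Sum>S\<in>F. h (b S) S) = (\<Sum>S\<in>Ft. h (b S) S)"
        using F(1) that by (intro sum.mono_neutral_right) (auto simp: F_def b_def)
      also have "\<dots> = (\<Sum>S\<in>Pow J. h (a S) (t ` S))"
        unfolding Ft_def using inj by (subst sum.reindex) (auto simp: b_image)
      finally show ?thesis .
    qed
    have inj_S: "inj_on t S" if "S \<in> Pow J" for S
      using that J(2) t.inj_shift by (auto intro: inj_on_subset)
    have vol_image: "vol (t ` S) = vol S" if "S \<in> Pow J" for S
      unfolding vol_def using inj_S[OF that] that J(2) p_t by (subst prod.reindex) (auto intro!: prod.cong)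
    have chi_image: "chi S (t.act \<omega>) = chi (t ` S) \<omega>" if "S \<in> Pow J" for S and \<omega> :: "'i \<Rightarrow> bool"
      unfolding chi_def using inj_S[OF that] that J(2) p_t
      by (subst prod.reindex) (auto intro!: prod.cong simp: t.act_def)
    let ?D = "sym_diff C (t.act -` C \<inter> space (PiM I Bern))"
    have "f (t.act \<omega>) - f \<omega> = (\<Sum>S\<in>F. (b S - a' S) * chi S \<omega>)" for \<omega> :: "'i \<Rightarrow> bool"
    proof -
      have "f (t.act \<omega>) = (\<Sum>S\<in>F. b S * chi S \<omega>)"
        unfolding a using sum_b[of "\<lambda>x S. x * chi S \<omega>"] by (simp add: chi_image)
      moreover have "f \<omega> = (\<Sum>S\<in>F. a' S * chi S \<omega>)"
        unfolding a using sum_a'[of "\<lambda>x S. x * chi S \<omega>"] by simp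
      ultimately show ?thesis by (simp add: sum_subtractf left_diff_distrib)
    qed
    then have "(\<Sum>S\<in>F. (b S - a' S)\<^sup>2 * vol S) = (\<integral>\<omega>. (f (t.act \<omega>) - f \<omega>)\<^sup>2 \<partial>PiM I Bern)"
      using parseval[OF F] by simp
    also have "\<dots> = (\<integral>\<omega>. indicator ?D \<omega> \<partial>PiM I Bern)"
      using measurable_space[OF t.measurable_act]
      by (intro Bochner_Integration.integral_cong) (auto simp: f_C indicator_def)
    also have "\<dots> = P.prob ?D"
      using C measurable_sets[OF t.measurable_act C] by simp
    finally have D: "(\<Sum>S\<in>F. (b S - a' S)\<^sup>2 * vol S) = P.prob ?D" .
    let ?n = "\<lambda>S. of_bool (S \<noteq> {}) :: real"
    have sq_a': "(\<Sum>S\<in>F. ?n S * ((a' S)\<^sup>2 * vol S)) = V"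
      using sum_a'[of "\<lambda>x S. ?n S * (x\<^sup>2 * vol S)"] J(1)
      by (auto simp: V_sum intro!: sum.mono_neutral_cong_right)
    have sq_b: "(\<Sum>S\<in>F. ?n S * ((b S)\<^sup>2 * vol S)) = V"
      using sum_b[of "\<lambda>x S. ?n S * (x\<^sup>2 * vol S)"] J(1)
      by (auto simp: V_sum vol_image intro!: sum.mono_neutral_cong_right)
    \<comment> \<open>Factor \<open>b^2 - a'^2\<close> as \<open>(b - a') * (b + a')\<close> and
      apply Cauchy-Schwarz with weights \<open>vol S\<close>: the first factor has square sum at
      most the probability of \<open>?D\<close>, the second at most \<open>4 * V\<close>.\<close>
    let ?x = "\<lambda>S. of_bool (S \<noteq> {} \<and> S \<in> \<A>) * (b S - a' S) * sqrt (vol S)"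
    let ?y = "\<lambda>S. ?n S * (b S + a' S) * sqrt (vol S)"
    let ?d = "measure_pmf.prob \<mu> {S. t ` S \<in> \<A>} - measure_pmf.prob \<mu> \<A>"
    have "V * ?d = (\<Sum>S\<in>F. of_bool (S \<noteq> {} \<and> S \<in> \<A>) * ((b S)\<^sup>2 * vol S)) -
        (\<Sum>S\<in>F. of_bool (S \<noteq> {} \<and> S \<in> \<A>) * ((a' S)\<^sup>2 * vol S))"
      using sum_a'[of "\<lambda>x S. of_bool (S \<noteq> {} \<and> S \<in> \<A>) * (x\<^sup>2 * vol S)"]
        sum_b[of "\<lambda>x S. of_bool (S \<noteq> {} \<and> S \<in> \<A>) * (x\<^sup>2 * vol S)"] V(2)
      by (simp add: prob_\<mu> vol_image right_diff_distrib)
    also have "\<dots> = (\<Sum>S\<in>F. ?x S * ?y S)"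
      unfolding sum_subtractf[symmetric] using vol_nonneg
      by (intro sum.cong) (auto simp: algebra_simps power2_eq_square)
    finally have "(V * ?d)\<^sup>2 = (\<Sum>S\<in>F. ?x S * ?y S)\<^sup>2" by simp
    also have "\<dots> \<le> (\<Sum>S\<in>F. (?x S)\<^sup>2) * (\<Sum>S\<in>F. (?y S)\<^sup>2)" by (rule Cauchy_Schwarz_ineq_sum)
    also have "\<dots> \<le> P.prob ?D * (4 * V)"
    proof (intro mult_mono)
      show "(\<Sum>S\<in>F. (?x S)\<^sup>2) \<le> P.prob ?D"
        unfolding D[symmetric] using vol_nonneg by (intro sum_mono) (auto simp: power_mult_distrib)
      have "(\<Sum>S\<in>F. (?y S)\<^sup>2) \<le> (\<Sum>S\<in>F. 2 * (?n S * ((b S)\<^sup>2 * vol S)) + 2 * (?n S * ((a' S)\<^sup>2 * vol S)))"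
      proof (intro sum_mono)
        fix S
        have "(b S + a' S)\<^sup>2 \<le> 2 * (b S)\<^sup>2 + 2 * (a' S)\<^sup>2"
          using zero_le_power2[of "b S - a' S"] by (simp add: power2_eq_square algebra_simps)
        from mult_right_mono[OF this vol_nonneg[of S]]
        have *: "(b S + a' S)\<^sup>2 * vol S \<le> (2 * (b S)\<^sup>2 + 2 * (a' S)\<^sup>2) * vol S" .
        show "(?y S)\<^sup>2 \<le> 2 * (?n S * ((b S)\<^sup>2 * vol S)) + 2 * (?n S * ((a' S)\<^sup>2 * vol S))"
        proof -
          have "(?y S)\<^sup>2 = ?n S * ((b S + a' S)\<^sup>2 * vol S)"
            using vol_nonneg[of S] by (simp only: power_mult_distrib) simp
          with * show ?thesis by (simp only:) (simp add: algebra_simps)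
        qed
      qed
      also have "\<dots> = 4 * V"
        unfolding sum.distrib sum_distrib_left[symmetric] sq_a' sq_b by simp
      finally show "(\<Sum>S\<in>F. (?y S)\<^sup>2) \<le> 4 * V" .
    qed (auto intro!: sum_nonneg)
    finally have "V * (V * ?d\<^sup>2) \<le> V * (4 * P.prob ?D)" by (simp add: power2_eq_square algebra_simps)
    then show "V * ?d\<^sup>2 \<le> 4 * P.prob ?D" using V(2) by simp
  qed
qed

text \<open>By the gap hypothesis some \<open>h\<close> moves the Fourier measure of an
  approximating cylinder by more than \<epsilon>, so the defect of invariance under \<open>h\<close>
  is at least \<open>\<epsilon>^2 / 4\<close> times the variance. The constant involves only the
  action on finite sets of coordinates and not the parameters \<open>p\<close>; hence it survives a
  later choice of the thinning density.\<close>

lemma spectral_gap: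
  fixes t :: "'h \<Rightarrow> 'i \<Rightarrow> 'i"
  assumes F: "finite F" "\<And>h. h \<in> F \<Longrightarrow> shift Bern I (t h)"
      "\<And>h i. h \<in> F \<Longrightarrow> i \<in> I \<Longrightarrow> p (t h i) = p i"
    and gap: "0 < \<epsilon>" "\<And>\<mu>. finite (set_pmf \<mu>) \<Longrightarrow> set_pmf \<mu> \<subseteq> {S. finite S \<and> S \<noteq> {} \<and> S \<subseteq> I} \<Longrightarrow>
      \<exists>h\<in>F. \<exists>\<A>. \<epsilon> < \<bar>measure_pmf.prob \<mu> {S. t h ` S \<in> \<A>} - measure_pmf.prob \<mu> \<A>\<bar>"
    and A: "A \<in> P.events"
  shows "P.prob A * (1 - P.prob A) \<le>
    4 / \<epsilon>\<^sup>2 * (\<Sum>h\<in>F. P.prob (sym_diff A (shift.act I (t h) -` A \<inter> space (PiM I Bern))))"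
proof (rule field_le_epsilon)
  fix e :: real assume "0 < e"
  define D where "D h A = P.prob (sym_diff A (shift.act I (t h) -` A \<inter> space (PiM I Bern)))" for h A
  define K where "K = 4 / \<epsilon>\<^sup>2"
  have K: "0 \<le> K" by (simp add: K_def)
  \<comment> \<open>Approximation costs \<open>e'\<close> in the variance and
    \<open>2 * K * e'\<close> for each element of \<open>F\<close>; the total is
    \<open>e\<close>.\<close>
  define e' where "e' = e / (1 + 2 * K * card F)"
  have e': "0 < e'" using K \<open>0 < e\<close> by (simp add: e'_def divide_pos_pos add_pos_nonneg)
  obtain C where C: "cylinder C" "P.prob (sym_diff A C) < e'"
    using cylinder_approximation[OF A e'] by blast
  have C_ev: "C \<in> P.events" using cylinder_sets[OF C(1)] .
  define V where "V = P.prob C * (1 - P.prob C)"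
  have D_nonneg: "0 \<le> D h A" for h A by (simp add: D_def)
  have "V \<le> K * (\<Sum>h\<in>F. D h C)"
  proof (cases "0 < V")
    case False
    have "0 \<le> K * (\<Sum>h\<in>F. D h C)" using K D_nonneg by (intro mult_nonneg_nonneg sum_nonneg)
    with False show ?thesis by simp
  next
    case True
    from cylinder_almost_invariant_pmf[OF C(1) V_def True]
    obtain \<mu> :: "'i set pmf" where \<mu>: "finite (set_pmf \<mu>)" "set_pmf \<mu> \<subseteq> {S. finite S \<and> S \<noteq> {} \<and> S \<subseteq> I}"
      "\<And>t \<A>. shift Bern I t \<Longrightarrow> (\<And>i. i \<in> I \<Longrightarrow> p (t i) = p i) \<Longrightarrow>
       V * (measure_pmf.prob \<mu> {S. t ` S \<in> \<A>} - measure_pmf.prob \<mu> \<A>)\<^sup>2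
         \<le> 4 * P.prob (sym_diff C (shift.act I t -` C \<inter> space (PiM I Bern)))"
      by blast
    from gap(2)[OF \<mu>(1,2)] obtain h \<A> where h: "h \<in> F"
      "\<epsilon> < \<bar>measure_pmf.prob \<mu> {S. t h ` S \<in> \<A>} - measure_pmf.prob \<mu> \<A>\<bar>" (is "_ < \<bar>?d\<bar>")
      by blast
    have "\<epsilon>\<^sup>2 \<le> ?d\<^sup>2" using h(2) gap(1) by (metis abs_le_square_iff abs_of_pos less_imp_le)
    then have "V * \<epsilon>\<^sup>2 \<le> V * ?d\<^sup>2" using True by (intro mult_left_mono) auto
    also have "\<dots> \<le> 4 * D h C" unfolding D_def using F h(1) by (intro \<mu>(3)) auto
    finally have "V \<le> K * D h C" using gap(1) by (simp add: K_def field_simps)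
    also have "\<dots> \<le> K * (\<Sum>h\<in>F. D h C)"
      using F(1) h(1) K D_nonneg by (intro mult_left_mono member_le_sum) auto
    finally show ?thesis .
  qed
  also have "\<dots> \<le> K * (\<Sum>h\<in>F. D h A + 2 * e')"
  proof (intro mult_left_mono K sum_mono)
    fix h assume "h \<in> F"
    then interpret h: shift Bern I "t h" by (rule F(2))
    show "D h C \<le> D h A + 2 * e'"
      using h.prob_sym_diff_act[OF A C_ev] C(2) by (simp add: D_def)
  qed
  also have "\<dots> = K * (\<Sum>h\<in>F. D h A) + 2 * K * card F * e'"
    by (simp add: sum.distrib algebra_simps)
  finally have "V \<le> K * (\<Sum>h\<in>F. D h A) + 2 * K * card F * e'" .
  moreover have "P.prob A * (1 - P.prob A) \<le> V + e'"
    unfolding V_def using C(2) by (intro prob_mult_compl_le A C_ev) simp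
  moreover have "e' * (1 + 2 * K * card F) = e"
  proof -
    have "0 < 1 + 2 * K * card F" using K by (intro add_pos_nonneg) auto
    then show ?thesis by (simp add: e'_def)
  qed
  ultimately show "P.prob A * (1 - P.prob A) \<le>
      4 / \<epsilon>\<^sup>2 * (\<Sum>h\<in>F. P.prob (sym_diff A (shift.act I (t h) -` A \<inter> space (PiM I Bern)))) + e"
    unfolding D_def[symmetric] K_def[symmetric] by (simp add: algebra_simps)
qed

end

section \<open>Amenability and almost invariant probability measures\<close>

lemma prob_bind_pmf:
  "measure_pmf.prob (bind_pmf \<mu> f) X = (\<integral>x. measure_pmf.prob (f x) X \<partial>measure_pmf \<mu>)"
proof -
  have "ennreal (measure_pmf.prob (bind_pmf \<mu> f) X) = (\<integral>\<^sup>+x. ennreal (measure_pmf.prob (f x) X) \<partial>measure_pmf \<mu>)"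
    using emeasure_bind_pmf[of \<mu> f X] by (simp add: measure_pmf.emeasure_eq_measure)
  also have "\<dots> = ennreal (\<integral>x. measure_pmf.prob (f x) X \<partial>measure_pmf \<mu>)"
    by (intro nn_integral_eq_integral measure_pmf.integrable_const_bound[where B = 1]) auto
  finally show ?thesis by (simp add: Bochner_Integration.integral_nonneg)
qed

lemma prob_pair_pmf:
  "measure_pmf.prob (pair_pmf \<mu> \<nu>) {z. Q (fst z) (snd z)} =
    (\<integral>x. measure_pmf.prob \<nu> {y. Q x y} \<partial>measure_pmf \<mu>)"
  "measure_pmf.prob (pair_pmf \<mu> \<nu>) {z. Q (fst z) (snd z)} =
    (\<integral>y. measure_pmf.prob \<mu> {x. Q x y} \<partial>measure_pmf \<nu>)"
proof -
  have "pair_pmf \<mu> \<nu> = bind_pmf \<mu> (\<lambda>x. map_pmf (Pair x) \<nu>)"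
    by (simp add: pair_pmf_def map_pmf_def)
  then show "measure_pmf.prob (pair_pmf \<mu> \<nu>) {z. Q (fst z) (snd z)} =
      (\<integral>x. measure_pmf.prob \<nu> {y. Q x y} \<partial>measure_pmf \<mu>)"
    by (simp add: prob_bind_pmf vimage_def)
  have "pair_pmf \<mu> \<nu> = bind_pmf \<nu> (\<lambda>y. map_pmf (\<lambda>x. (x, y)) \<mu>)"
    unfolding pair_pmf_def map_pmf_def by (rule bind_commute_pmf)
  then show "measure_pmf.prob (pair_pmf \<mu> \<nu>) {z. Q (fst z) (snd z)} =
      (\<integral>y. measure_pmf.prob \<mu> {x. Q x y} \<partial>measure_pmf \<nu>)"
    by (simp add: prob_bind_pmf vimage_def)
qed

lemma abs_integral_pmf_diff_le:
  fixes f g :: "'x \<Rightarrow> real"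
  assumes "\<And>x. x \<in> set_pmf \<mu> \<Longrightarrow> \<bar>f x - g x\<bar> \<le> e"
    and f: "\<And>x. 0 \<le> f x \<and> f x \<le> 1" and g: "\<And>x. 0 \<le> g x \<and> g x \<le> 1"
  shows "\<bar>(\<integral>x. f x \<partial>measure_pmf \<mu>) - (\<integral>x. g x \<partial>measure_pmf \<mu>)\<bar> \<le> e"
proof -
  have int: "integrable (measure_pmf \<mu>) f" "integrable (measure_pmf \<mu>) g"
    using f g by (auto intro!: measure_pmf.integrable_const_bound[where B = 1])
  then have "\<bar>(\<integral>x. f x \<partial>measure_pmf \<mu>) - (\<integral>x. g x \<partial>measure_pmf \<mu>)\<bar> =
      \<bar>\<integral>x. f x - g x \<partial>measure_pmf \<mu>\<bar>" by simp
  also have "\<dots> \<le> (\<integral>x. \<bar>f x - g x\<bar> \<partial>measure_pmf \<mu>)" by (rule integral_abs_bound)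
  also have "\<dots> \<le> (\<integral>x. e \<partial>measure_pmf \<mu>)"
    using int assms(1) by (intro integral_mono_AE) (auto simp: AE_measure_pmf_iff)
  finally show ?thesis by simp
qed

text \<open>For values between 0 and 1 the difference of integrals is largest for the indicator of
  the Hahn set, where the first measure has at least the weight of the second.\<close>

lemma abs_integral_pmf_diff_le_variation:
  fixes f :: "'x \<Rightarrow> real"
  assumes fin: "finite (set_pmf \<mu>)" "finite (set_pmf \<nu>)"
    and var: "\<And>A. \<bar>measure_pmf.prob \<mu> A - measure_pmf.prob \<nu> A\<bar> \<le> e"
    and f: "\<And>x. 0 \<le> f x \<and> f x \<le> 1"
  shows "\<bar>(\<integral>x. f x \<partial>measure_pmf \<mu>) - (\<integral>x. f x \<partial>measure_pmf \<nu>)\<bar> \<le> e"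
proof -
  have le: "(\<integral>x. f x \<partial>measure_pmf \<mu>) - (\<integral>x. f x \<partial>measure_pmf \<nu>) \<le> e"
    if fin: "finite (set_pmf \<mu>)" "finite (set_pmf \<nu>)"
      and var: "\<And>A. \<bar>measure_pmf.prob \<mu> A - measure_pmf.prob \<nu> A\<bar> \<le> e" for \<mu> \<nu>
  proof -
    let ?X = "set_pmf \<mu> \<union> set_pmf \<nu>"
    let ?A = "{x\<in>?X. pmf \<nu> x \<le> pmf \<mu> x}"
    have X: "finite ?X" using fin by simp
    have "(\<integral>x. f x \<partial>measure_pmf \<mu>) - (\<integral>x. f x \<partial>measure_pmf \<nu>) =
        (\<Sum>x\<in>?X. f x * pmf \<mu> x) - (\<Sum>x\<in>?X. f x * pmf \<nu> x)"
      using X by (subst (1 2) integral_measure_pmf_real[where A = ?X]) auto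
    also have "\<dots> = (\<Sum>x\<in>?X. f x * (pmf \<mu> x - pmf \<nu> x))"
      by (simp add: sum_subtractf right_diff_distrib)
    also have "\<dots> \<le> (\<Sum>x\<in>?X. if pmf \<nu> x \<le> pmf \<mu> x then pmf \<mu> x - pmf \<nu> x else 0)"
      using f by (intro sum_mono) (auto intro: mult_left_le_one_le mult_nonneg_nonpos)
    also have "\<dots> = (\<Sum>x\<in>?A. pmf \<mu> x) - (\<Sum>x\<in>?A. pmf \<nu> x)"
      unfolding sum.inter_filter[OF X, symmetric] by (simp add: sum_subtractf)
    also have "\<dots> = measure_pmf.prob \<mu> ?A - measure_pmf.prob \<nu> ?A"
      using X by (simp add: measure_measure_pmf_finite)
    also have "\<dots> \<le> e" using var[of ?A] by linarith
    finally show ?thesis .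
  qed
  have "\<And>A. \<bar>measure_pmf.prob \<nu> A - measure_pmf.prob \<mu> A\<bar> \<le> e"
    using var by (simp add: abs_minus_commute)
  from le[OF fin var] le[OF fin(2,1) this] show ?thesis by linarith
qed

text \<open>Reiter's condition for left translation by \<open>H\<close>, with total variation taken
  as a supremum over events. The measures may live on all of \<open>G\<close>, which is the form in
  which finite sets of edges produce them.\<close>

definition almost_invariant_measures :: "('a, 'b) monoid_scheme \<Rightarrow> 'a set \<Rightarrow> bool" where
  "almost_invariant_measures G H \<longleftrightarrow>
     (\<forall>F e. finite F \<longrightarrow> F \<subseteq> H \<longrightarrow> (0::real) < e \<longrightarrow>
       (\<exists>\<mu>. set_pmf \<mu> \<subseteq> carrier G \<and>
         (\<forall>h\<in>F. \<forall>A. \<bar>measure_pmf.prob \<mu> {x. h \<otimes>\<^bsub>G\<^esub> x \<in> A} - measure_pmf.prob \<mu> A\<bar> \<le> e)))"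

section \<open>Reiter's condition and amenability\<close>

context group
begin

text \<open>By Tychonoff, set functions with values in the unit interval form a compact space. The
  conditions \<open>T F n\<close> are closed and become stronger as \<open>F\<close> and
  \<open>n\<close> grow, and an almost invariant measure satisfies any one of them; a common point
  of all of them is an invariant mean.\<close>

lemma amenable_if_almost_invariant:
  assumes "almost_invariant_measures G (carrier G)"
  shows "amenable G"
proof -
  let ?V = "carrier G"
  let ?X = "PiE UNIV (\<lambda>_. {0..1}) :: ('a set \<Rightarrow> real) set"
  define T where "T F n = {m :: 'a set \<Rightarrow> real. m ?V = 1 \<and>
      (\<forall>A B. A \<inter> B = {} \<longrightarrow> m (A \<union> B) = m A + m B) \<and>
      (\<forall>g A. g \<in> F \<longrightarrow> A \<subseteq> ?V \<longrightarrow> \<bar>m (g <# A) - m A\<bar> \<le> 1 / (real n + 1))}" for F n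
  define \<T> where "\<T> = {T F n | F n. finite F \<and> F \<subseteq> ?V}"
  have T_mono: "T F' n' \<subseteq> T F n" if "F \<subseteq> F'" "n \<le> n'" for F F' n n'
  proof -
    have "1 / (real n' + 1) \<le> 1 / (real n + 1)" using that by (simp add: frac_le)
    then show ?thesis unfolding T_def using that by (blast intro: order_trans)
  qed
  have "compact ?X"
    using compactin_PiE[of "\<lambda>_. euclidean" UNIV "\<lambda>_. {0..1::real}"]
    by (simp add: euclidean_product_topology)
  moreover have "closed C" if "C \<in> \<T>" for C
  proof -
    have cont: "continuous_on UNIV (\<lambda>m :: 'a set \<Rightarrow> real. m A)" for A
      by (rule continuous_on_product_coordinates)
    from that obtain F n where "C = T F n" by (auto simp: \<T>_def)
    then show ?thesis
      unfolding T_def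
      by (simp only:) (intro closed_Collect_conj closed_Collect_all closed_Collect_imp closed_Collect_eq
        closed_Collect_le continuous_intros cont open_Collect_const)
  qed
  moreover have "?X \<inter> \<Inter>\<F> \<noteq> {}" if \<F>: "finite \<F>" "\<F> \<subseteq> \<T>" for \<F>
  proof -
    have "\<exists>F n. finite F \<and> F \<subseteq> ?V \<and> T F n \<subseteq> \<Inter>\<F>"
      using \<F>
    proof (induction \<F> rule: finite_induct)
      case empty
      show ?case by (intro exI[of _ "{}"]) auto
    next
      case (insert C \<F>)
      then obtain F n where F: "finite F" "F \<subseteq> ?V" "T F n \<subseteq> \<Inter>\<F>" by auto
      obtain F' n' where F': "finite F'" "F' \<subseteq> ?V" "C = T F' n'"
        using insert.prems by (auto simp: \<T>_def)
      have "T (F \<union> F') (max n n') \<subseteq> T F n \<inter> T F' n'"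
        by (intro Int_greatest T_mono) auto
      with F F' show ?case by (intro exI[of _ "F \<union> F'"] exI[of _ "max n n'"]) auto
    qed
    then obtain F n where F: "finite F" "F \<subseteq> ?V" "T F n \<subseteq> \<Inter>\<F>" by blast
    have "0 < 1 / (real n + 1)" by simp
    with assms F(1,2) obtain \<mu> where \<mu>: "set_pmf \<mu> \<subseteq> ?V"
      "\<And>h A. h \<in> F \<Longrightarrow> \<bar>measure_pmf.prob \<mu> {x. h \<otimes> x \<in> A} - measure_pmf.prob \<mu> A\<bar> \<le> 1 / (real n + 1)"
      unfolding almost_invariant_measures_def by meson
    have "measure_pmf.prob \<mu> \<in> T F n"
      unfolding T_def
    proof (intro CollectI conjI allI impI)
      show "measure_pmf.prob \<mu> ?V = 1" using \<mu>(1) by (intro measure_pmf.prob_eq_1[THEN iffD2]) (auto simp: AE_measure_pmf_iff)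
      show "measure_pmf.prob \<mu> (A \<union> B) = measure_pmf.prob \<mu> A + measure_pmf.prob \<mu> B"
        if "A \<inter> B = {}" for A B using that by (intro measure_pmf.finite_measure_Union) auto
      fix g A assume g: "g \<in> F" "A \<subseteq> ?V"
      \<comment> \<open>Reiter's condition speaks of preimages; the coset \<open>g <# A\<close> is
        chosen because its preimage under left multiplication by \<open>g\<close> agrees with
        \<open>A\<close> on the support.\<close>
      have "measure_pmf.prob \<mu> {x. g \<otimes> x \<in> g <# A} = measure_pmf.prob \<mu> A"
      proof (intro measure_eq_AE; auto simp: AE_measure_pmf_iff)
        fix x assume "x \<in> set_pmf \<mu>" "g \<otimes> x \<in> g <# A"
        then obtain y where "y \<in> A" "g \<otimes> x = g \<otimes> y" by (auto simp: l_coset_def)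
        moreover have "g \<in> ?V" "x \<in> ?V" "y \<in> ?V"
          using g F(2) \<mu>(1) \<open>x \<in> set_pmf \<mu>\<close> \<open>y \<in> A\<close> by auto
        ultimately show "x \<in> A" by simp
      next
        fix x assume "x \<in> A" then show "g \<otimes> x \<in> g <# A" by (auto simp: l_coset_def)
      qed
      with \<mu>(2)[OF g(1), of "g <# A"]
      show "\<bar>measure_pmf.prob \<mu> (g <# A) - measure_pmf.prob \<mu> A\<bar> \<le> 1 / (real n + 1)"
        by (simp add: abs_minus_commute)
    qed
    moreover have "measure_pmf.prob \<mu> \<in> ?X" by auto
    ultimately show ?thesis using F(3) by blast
  qed
  ultimately have "?X \<inter> \<Inter>\<T> \<noteq> {}" by (rule compact_imp_fip)
  then have "\<exists>m. m \<in> ?X \<inter> \<Inter>\<T>" by (simp only: ex_in_conv) simp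
  then obtain m where m: "m \<in> ?X" "m \<in> \<Inter>\<T>" by (elim exE IntE)
  have mT: "m \<in> T F n" if "finite F" "F \<subseteq> ?V" for F n
  proof -
    have "T F n \<in> \<T>" unfolding \<T>_def using that by (intro CollectI exI[of _ F] exI[of _ n] conjI refl)
    then show ?thesis using m(2) by (rule InterD[rotated])
  qed
  have "m (g <# A) = m A" if "g \<in> ?V" "A \<subseteq> ?V" for g A
  proof -
    have "\<bar>m (g <# A) - m A\<bar> \<le> inverse (real (Suc n))" for n
      using mT[of "{g}" n] that by (simp add: T_def inverse_eq_divide add.commute)
    then have "\<bar>m (g <# A) - m A\<bar> \<le> 0"
      by (meson dual_order.trans linorder_not_le reals_Archimedean)
    then show ?thesis by simp
  qed
  with m(1) mT[of "{}" 0] show ?thesis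
    unfolding amenable_def T_def by (intro exI[of _ m]) (auto simp: PiE_iff)
qed

text \<open>Fix a representative y in each right coset of \<open>H\<close> and map an element h y to
  h. The representative depends only on the coset, so this map \<open>s\<close> commutes with left
  multiplication by \<open>H\<close>, and the image measure lives on \<open>H\<close> with the same
  invariance.\<close>

lemma almost_invariant_on_subgroup:
  assumes H: "subgroup H G" and "almost_invariant_measures G H"
    and F: "finite F" "F \<subseteq> H" "0 < e"
  obtains \<mu> where "set_pmf \<mu> \<subseteq> H"
    "\<And>h A. h \<in> F \<Longrightarrow> \<bar>measure_pmf.prob \<mu> {x. h \<otimes> x \<in> A} - measure_pmf.prob \<mu> A\<bar> \<le> e"
proof -
  obtain \<mu> where \<mu>: "set_pmf \<mu> \<subseteq> carrier G"
    "\<And>h A. h \<in> F \<Longrightarrow> \<bar>measure_pmf.prob \<mu> {x. h \<otimes> x \<in> A} - measure_pmf.prob \<mu> A\<bar> \<le> e"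
    using assms unfolding almost_invariant_measures_def by meson
  define s where "s x = x \<otimes> inv (SOME y. y \<in> H #> x)" for x
  have s_mem: "s x \<in> H" if "x \<in> carrier G" for x
  proof -
    have "x \<in> H #> x" using H that by (intro rcos_self)
    then have "(SOME y. y \<in> H #> x) \<in> H #> x" by (rule someI)
    then obtain h where h: "h \<in> H" "(SOME y. y \<in> H #> x) = h \<otimes> x" by (auto simp: r_coset_def)
    then have "s x = inv h"
      using that subgroup.mem_carrier[OF H h(1)] by (simp add: s_def inv_mult_group m_assoc[symmetric])
    then show ?thesis using h(1) H by (simp add: subgroup.m_inv_closed)
  qed
  have s_mult: "s (h \<otimes> x) = h \<otimes> s x" if "h \<in> H" "x \<in> carrier G" for h x
  proof -
    have hc: "h \<in> carrier G" using H that by (auto dest: subgroup.mem_carrier)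
    have "H #> (h \<otimes> x) = H #> x"
      using coset_mult_assoc[OF subgroup.subset[OF H] hc that(2)] coset_join2[OF hc H that(1)]
      by simp
    moreover have "(SOME y. y \<in> H #> x) \<in> carrier G"
    proof (rule someI2)
      show "x \<in> H #> x" using H that(2) by (intro rcos_self)
      show "y \<in> carrier G" if "y \<in> H #> x" for y
        using that \<open>x \<in> carrier G\<close> r_coset_subset_G[OF subgroup.subset[OF H]] by auto
    qed
    ultimately show ?thesis using hc that by (simp add: s_def m_assoc)
  qed
  show thesis
  proof (rule that)
    show "set_pmf (map_pmf s \<mu>) \<subseteq> H" using \<mu>(1) s_mem by auto
    fix h A assume h: "h \<in> F"
    have "measure_pmf.prob (map_pmf s \<mu>) {x. h \<otimes> x \<in> A} = measure_pmf.prob \<mu> {x. h \<otimes> x \<in> s -` A}"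
      unfolding measure_map_pmf using \<mu>(1) h F(2)
      by (intro measure_eq_AE) (auto simp: AE_measure_pmf_iff s_mult subset_iff)
    then show "\<bar>measure_pmf.prob (map_pmf s \<mu>) {x. h \<otimes> x \<in> A} - measure_pmf.prob (map_pmf s \<mu>) A\<bar> \<le> e"
      using \<mu>(2)[OF h, of "s -` A"] by simp
  qed
qed

lemma generate_commuting_subgroups:
  assumes H: "subgroup H G" and K: "subgroup K G" and comm: "commuting_subsets G H K"
    and "g \<in> generate G (H \<union> K)"
  obtains h k where "h \<in> H" "k \<in> K" "g = h \<otimes> k"
proof -
  have Hc: "x \<in> carrier G" if "x \<in> H" for x using that H by (auto dest: subgroup.mem_carrier)
  have Kc: "x \<in> carrier G" if "x \<in> K" for x using that K by (auto dest: subgroup.mem_carrier)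
  from assms(4) have "\<exists>h\<in>H. \<exists>k\<in>K. g = h \<otimes> k"
  proof (induction rule: generate.induct)
    case one
    then show ?case using H K by (intro bexI[of _ \<one>]) (auto simp: subgroup.one_closed)
  next
    case (incl x)
    then show ?case
    proof
      assume "x \<in> H" then show ?thesis using K Hc by (intro bexI[of _ x] bexI[of _ \<one>]) (auto simp: subgroup.one_closed)
    next
      assume "x \<in> K" then show ?thesis using H Kc by (intro bexI[of _ \<one>] bexI[of _ x]) (auto simp: subgroup.one_closed)
    qed
  next
    case (inv x)
    then show ?case
    proof
      assume "x \<in> H" then show ?thesis using K H Hc
        by (intro bexI[of _ "inv x"] bexI[of _ \<one>]) (auto simp: subgroup.one_closed subgroup.m_inv_closed)
    next
      assume "x \<in> K" then show ?thesis using H K Kc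
        by (intro bexI[of _ \<one>] bexI[of _ "inv x"]) (auto simp: subgroup.one_closed subgroup.m_inv_closed)
    qed
  next
    case (eng x y)
    then obtain h k h' k' where *: "h \<in> H" "k \<in> K" "x = h \<otimes> k" "h' \<in> H" "k' \<in> K" "y = h' \<otimes> k'" by blast
    have "x \<otimes> y = h \<otimes> (k \<otimes> h') \<otimes> k'" using * Hc Kc by (simp add: m_assoc)
    also have "k \<otimes> h' = h' \<otimes> k" using * comm by (auto simp: commuting_subsets_def)
    finally have "x \<otimes> y = (h \<otimes> h') \<otimes> (k \<otimes> k')" using * Hc Kc by (simp add: m_assoc)
    then show ?case using * H K by (meson subgroup.m_closed)
  qed
  then show thesis using that by blast
qed

text \<open>If both factors had almost invariant measures, then so would \<open>G\<close>: multiply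
  independent elements h and k drawn from them. For g = a b, commuting b past h turns g h k into (a
  h)(b k), and each of the two translations costs \<open>e / 2\<close>.\<close>

lemma nonamenable_commuting_factor:
  assumes H: "subgroup H G" and K: "subgroup K G" and comm: "commuting_subsets G H K"
    and gen: "generate G (H \<union> K) = carrier G" and "\<not> amenable G"
  shows "\<not> almost_invariant_measures G H \<or> \<not> almost_invariant_measures G K"
proof (rule ccontr)
  assume "\<not> ?thesis"
  then have ai: "almost_invariant_measures G H" "almost_invariant_measures G K" by auto
  have Hc: "x \<in> carrier G" if "x \<in> H" for x using that H by (auto dest: subgroup.mem_carrier)
  have Kc: "x \<in> carrier G" if "x \<in> K" for x using that K by (auto dest: subgroup.mem_carrier)
  have "almost_invariant_measures G (carrier G)"
    unfolding almost_invariant_measures_def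
  proof (intro allI impI)
    fix F and e :: real assume F: "finite F" "F \<subseteq> carrier G" "0 < e"
    have "\<forall>g\<in>F. \<exists>h k. h \<in> H \<and> k \<in> K \<and> g = h \<otimes> k"
      using F(2) gen generate_commuting_subgroups[OF H K comm] by (metis subsetD)
    then obtain a b where ab: "\<And>g. g \<in> F \<Longrightarrow> a g \<in> H \<and> b g \<in> K \<and> g = a g \<otimes> b g" by metis
    have "finite (a ` F)" "a ` F \<subseteq> H" "finite (b ` F)" "b ` F \<subseteq> K" "0 < e / 2" using F ab by auto
    note fins = this
    obtain \<mu> where \<mu>: "set_pmf \<mu> \<subseteq> H"
      "\<And>h A. h \<in> a ` F \<Longrightarrow> \<bar>measure_pmf.prob \<mu> {x. h \<otimes> x \<in> A} - measure_pmf.prob \<mu> A\<bar> \<le> e / 2"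
      by (rule almost_invariant_on_subgroup[OF H ai(1) fins(1,2,5)]) blast
    obtain \<nu> where \<nu>: "set_pmf \<nu> \<subseteq> K"
      "\<And>h A. h \<in> b ` F \<Longrightarrow> \<bar>measure_pmf.prob \<nu> {x. h \<otimes> x \<in> A} - measure_pmf.prob \<nu> A\<bar> \<le> e / 2"
      by (rule almost_invariant_on_subgroup[OF K ai(2) fins(3,4,5)]) blast
    define \<rho> where "\<rho> = map_pmf (\<lambda>z. fst z \<otimes> snd z) (pair_pmf \<mu> \<nu>)"
    show "\<exists>\<rho>. set_pmf \<rho> \<subseteq> carrier G \<and>
        (\<forall>g\<in>F. \<forall>A. \<bar>measure_pmf.prob \<rho> {x. g \<otimes> x \<in> A} - measure_pmf.prob \<rho> A\<bar> \<le> e)"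
    proof (intro exI conjI ballI allI)
      show "set_pmf \<rho> \<subseteq> carrier G" using \<mu>(1) \<nu>(1) Hc Kc by (auto simp: \<rho>_def subset_iff)
      fix g A assume g: "g \<in> F"
      note abg = ab[OF g]
      let ?P = "measure_pmf.prob (pair_pmf \<mu> \<nu>)"
      have "measure_pmf.prob \<rho> {x. g \<otimes> x \<in> A} = ?P {z. a g \<otimes> fst z \<in> {x. x \<otimes> (b g \<otimes> snd z) \<in> A}}"
        unfolding \<rho>_def measure_map_pmf
      proof (intro measure_eq_AE AE_pmfI)
        fix z assume "z \<in> set_pmf (pair_pmf \<mu> \<nu>)"
        then obtain h k where z: "z = (h, k)" and hk: "h \<in> H" "k \<in> K" using \<mu>(1) \<nu>(1) by auto
        have "g \<otimes> (h \<otimes> k) = a g \<otimes> (b g \<otimes> h) \<otimes> k" using abg hk Hc Kc by (metis m_assoc m_closed)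
        also have "b g \<otimes> h = h \<otimes> b g" using abg hk comm by (auto simp: commuting_subsets_def)
        finally have "g \<otimes> (h \<otimes> k) = a g \<otimes> h \<otimes> (b g \<otimes> k)" using abg hk Hc Kc by (simp add: m_assoc)
        then show "z \<in> (\<lambda>z. fst z \<otimes> snd z) -` {x. g \<otimes> x \<in> A} \<longleftrightarrow>
            z \<in> {z. a g \<otimes> fst z \<in> {x. x \<otimes> (b g \<otimes> snd z) \<in> A}}" by (simp add: z)
      qed auto
      moreover have "\<bar>?P {z. a g \<otimes> fst z \<in> {x. x \<otimes> (b g \<otimes> snd z) \<in> A}} -
          ?P {z. fst z \<in> {x. x \<otimes> (b g \<otimes> snd z) \<in> A}}\<bar> \<le> e / 2"
        unfolding prob_pair_pmf(2)[where Q = "\<lambda>x y. a g \<otimes> x \<in> {x. x \<otimes> (b g \<otimes> y) \<in> A}"]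
          prob_pair_pmf(2)[where Q = "\<lambda>x y. x \<in> {x. x \<otimes> (b g \<otimes> y) \<in> A}"] Collect_mem_eq
        using g by (intro abs_integral_pmf_diff_le \<mu>(2)) auto
      moreover have "?P {z. fst z \<in> {x. x \<otimes> (b g \<otimes> snd z) \<in> A}} = ?P {z. b g \<otimes> snd z \<in> {y. fst z \<otimes> y \<in> A}}"
        by simp
      moreover have "\<bar>?P {z. b g \<otimes> snd z \<in> {y. fst z \<otimes> y \<in> A}} - ?P {z. snd z \<in> {y. fst z \<otimes> y \<in> A}}\<bar> \<le> e / 2"
        unfolding prob_pair_pmf(1)[where Q = "\<lambda>x y. b g \<otimes> y \<in> {y. x \<otimes> y \<in> A}"]
          prob_pair_pmf(1)[where Q = "\<lambda>x y. y \<in> {y. x \<otimes> y \<in> A}"] Collect_mem_eq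
        using g by (intro abs_integral_pmf_diff_le \<nu>(2)) auto
      moreover have "?P {z. snd z \<in> {y. fst z \<otimes> y \<in> A}} = measure_pmf.prob \<rho> A"
        by (simp add: \<rho>_def vimage_def)
      ultimately show "\<bar>measure_pmf.prob \<rho> {x. g \<otimes> x \<in> A} - measure_pmf.prob \<rho> A\<bar> \<le> e"
        by linarith
    qed
  qed
  then show False using amenable_if_almost_invariant assms(5) by blast
qed

end

section \<open>Subgraphs of a Cayley graph\<close>

definition adj :: "'v set set \<Rightarrow> ('v \<times> 'v) set" where
  "adj X = {(x, y). {x, y} \<in> X}"

abbreviation conn :: "'v set set \<Rightarrow> 'v \<Rightarrow> 'v \<Rightarrow> bool" where
  "conn X x y \<equiv> (x, y) \<in> (adj X)\<^sup>*"

lemma sym_adj: "sym (adj X)"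
  by (auto simp: adj_def sym_def insert_commute)

lemma conn_sym: "conn X x y \<Longrightarrow> conn X y x"
  by (metis symD sym_rtrancl sym_adj)

lemma conn_trans: "conn X x y \<Longrightarrow> conn X y z \<Longrightarrow> conn X x z"
  by (rule rtrancl_trans)

lemma adj_mono: "X \<subseteq> Y \<Longrightarrow> adj X \<subseteq> adj Y"
  by (auto simp: adj_def)

lemma conn_mono: "conn X x y \<Longrightarrow> X \<subseteq> Y \<Longrightarrow> conn Y x y"
  using rtrancl_mono[OF adj_mono] by blast

lemma relpow_adj_sym: "(x, y) \<in> adj X ^^ n \<Longrightarrow> (y, x) \<in> adj X ^^ n"
proof (induction n arbitrary: y)
  case (Suc n)
  then obtain z where "(x, z) \<in> adj X ^^ n" "(z, y) \<in> adj X" by auto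
  then show ?case using Suc.IH[of z] sym_adj[of X] by (metis relpow_Suc_I2 symD)
qed simp

lemma relpow_adj_mono: "(x, y) \<in> adj X ^^ n \<Longrightarrow> X \<subseteq> Y \<Longrightarrow> (x, y) \<in> adj Y ^^ n"
proof (induction n arbitrary: y)
  case (Suc n)
  then obtain z where "(x, z) \<in> adj X ^^ n" "(z, y) \<in> adj X" by auto
  then have "(x, z) \<in> adj Y ^^ n" "(z, y) \<in> adj Y"
    using Suc.IH Suc.prems(2) adj_mono by blast+
  then show ?case by (rule relpow_Suc_I)
qed simp

section \<open>Translations, infinite clusters and representatives\<close>

locale cayley_graph = group G for G (structure) +
  fixes S :: "'a set"
  assumes finite_generating: "finite_generating_set G S" and infinite_carrier: "infinite (carrier G)"
begin

abbreviation V :: "'a set" where "V \<equiv> carrier G"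
abbreviation E :: "'a set set" where "E \<equiv> cayley_edges G S"

lemma finite_S: "finite S" and S_sub: "S \<subseteq> V" and generate_S: "generate G S = V"
  using finite_generating by (auto simp: finite_generating_set_def)

lemma countable_V: "countable V"
proof -
  let ?S = "S \<union> (\<lambda>s. inv s) ` S"
  let ?f = "\<lambda>xs. foldr (\<otimes>) xs \<one>"
  have S': "?S \<subseteq> V" using S_sub by auto
  have closed: "?f xs \<in> V" if "xs \<in> lists ?S" for xs
    using that S' by (induction xs) auto
  have app: "?f (xs @ ys) = ?f xs \<otimes> ?f ys" if "xs \<in> lists ?S" "ys \<in> lists ?S" for xs ys
    using that(1)
  proof (induction xs)
    case (Cons x xs)
    then have "x \<in> V" "xs \<in> lists ?S" using S' by auto
    then show ?case using Cons.IH closed[of xs] closed[OF that(2)] by (simp add: m_assoc)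
  qed (simp add: closed[OF that(2)])
  have "g \<in> ?f ` lists ?S" if "g \<in> generate G S" for g
    using that
  proof (induction rule: generate.induct)
    case one
    show ?case by (rule image_eqI[of _ _ "[]"]) auto
  next
    case (incl h)
    then show ?case using S_sub by (intro image_eqI[of _ _ "[h]"]) auto
  next
    case (inv h)
    then show ?case using S_sub by (intro image_eqI[of _ _ "[inv h]"]) auto
  next
    case (eng h k)
    then obtain xs ys where "xs \<in> lists ?S" "h = ?f xs" "ys \<in> lists ?S" "k = ?f ys" by auto
    then show ?case by (intro image_eqI[of _ _ "xs @ ys"]) (auto simp: app simp del: foldr_append)
  qed
  then have "V \<subseteq> ?f ` lists ?S" using generate_S by auto
  moreover have "countable (lists ?S)" using finite_S by (intro countable_lists countable_finite) auto
  ultimately show ?thesis by (meson countable_subset countable_image)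
qed

lemma edge_cases:
  assumes "e \<in> E"
  obtains x y where "e = {x, y}" "x \<in> V" "y \<in> V" "x \<noteq> y" "\<exists>s\<in>S. y = x \<otimes> s"
  using assms S_sub unfolding cayley_edges_def by blast

lemma edge_sub: "e \<in> E \<Longrightarrow> e \<subseteq> V"
  by (auto elim!: edge_cases)

lemma edge_finite: "e \<in> E \<Longrightarrow> finite e"
  by (auto elim!: edge_cases)

lemma edge_nonempty: "e \<in> E \<Longrightarrow> e \<noteq> {}"
  by (auto elim!: edge_cases)

lemma countable_E: "countable E"
  by (rule countable_subset[OF _ countable_Collect_finite_subset[OF countable_V]])
    (auto simp: edge_finite dest: edge_sub)

lemma adj_E: "(x, y) \<in> adj X \<Longrightarrow> X \<subseteq> E \<Longrightarrow> x \<in> V \<and> y \<in> V"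
  using edge_sub by (force simp: adj_def)

lemma conn_V: "conn X x y \<Longrightarrow> X \<subseteq> E \<Longrightarrow> x \<in> V \<Longrightarrow> y \<in> V"
  by (induction rule: rtrancl_induct) (auto dest: adj_E)

definition tr :: "'a \<Rightarrow> 'a set \<Rightarrow> 'a set" where
  "tr g e = (\<lambda>x. g \<otimes> x) ` e"

lemma tr_edge: "e \<in> E \<Longrightarrow> g \<in> V \<Longrightarrow> tr g e \<in> E"
proof -
  assume "e \<in> E" and g: "g \<in> V"
  then obtain x s where e: "e = {x, x \<otimes> s}" "x \<in> V" "s \<in> S" "x \<noteq> x \<otimes> s"
    by (auto simp: cayley_edges_def)
  have s: "s \<in> V" using e S_sub by auto
  have "tr g e = {g \<otimes> x, g \<otimes> x \<otimes> s}" using e g s by (auto simp: tr_def m_assoc)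
  moreover have "g \<otimes> x \<noteq> g \<otimes> x \<otimes> s" using e g s by (simp add: m_assoc)
  ultimately show ?thesis using e g unfolding cayley_edges_def by blast
qed

lemma tr_tr: "e \<subseteq> V \<Longrightarrow> g \<in> V \<Longrightarrow> h \<in> V \<Longrightarrow> tr g (tr h e) = tr (g \<otimes> h) e"
  unfolding tr_def image_image by (intro image_cong) (auto simp: m_assoc)

lemma tr_one: "e \<subseteq> V \<Longrightarrow> tr \<one> e = e"
  unfolding tr_def by (auto simp: image_iff subset_iff)

lemma tr_inv: "e \<subseteq> V \<Longrightarrow> g \<in> V \<Longrightarrow> tr (inv g) (tr g e) = e"
  by (simp add: tr_tr tr_one)

lemma inj_tr: "g \<in> V \<Longrightarrow> inj_on (tr g) E"
  by (rule inj_on_inverseI[where g = "tr (inv g)"]) (auto simp: tr_inv edge_sub)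

lemma inv_mult_cancel: "g \<in> V \<Longrightarrow> x \<in> V \<Longrightarrow> inv g \<otimes> (g \<otimes> x) = x"
  "g \<in> V \<Longrightarrow> x \<in> V \<Longrightarrow> g \<otimes> (inv g \<otimes> x) = x"
  by (simp_all add: m_assoc[symmetric])

lemma relpow_tr_imp:
  assumes "X \<subseteq> E" "g \<in> V" "\<And>e. e \<in> X \<Longrightarrow> tr g e \<in> Y" "(x, y) \<in> adj X ^^ n"
  shows "(g \<otimes> x, g \<otimes> y) \<in> adj Y ^^ n"
  using assms(4)
proof (induction n arbitrary: y)
  case (Suc n)
  then obtain z where "(x, z) \<in> adj X ^^ n" "(z, y) \<in> adj X" by auto
  then have "tr g {z, y} \<in> Y" using assms(3) by (auto simp: adj_def)
  then have "(g \<otimes> z, g \<otimes> y) \<in> adj Y" by (auto simp: adj_def tr_def)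
  with Suc.IH[OF \<open>(x, z) \<in> adj X ^^ n\<close>] show ?case by auto
qed simp

lemma relpow_tr:
  assumes "X \<subseteq> E" "Y \<subseteq> E" "g \<in> V" "\<And>e. e \<in> E \<Longrightarrow> e \<in> X \<longleftrightarrow> tr g e \<in> Y" "x \<in> V" "y \<in> V"
  shows "(x, y) \<in> adj X ^^ n \<longleftrightarrow> (g \<otimes> x, g \<otimes> y) \<in> adj Y ^^ n"
proof
  assume "(g \<otimes> x, g \<otimes> y) \<in> adj Y ^^ n"
  moreover have "tr (inv g) e \<in> X" if "e \<in> Y" for e
  proof -
    have "e \<in> E" using that assms(2) by auto
    then have "tr (inv g) e \<in> E" "tr g (tr (inv g) e) = e"
      using assms(3) tr_inv[of e "inv g"] tr_edge[of e "inv g"] edge_sub[of e] by auto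
    then show ?thesis using assms(4)[of "tr (inv g) e"] that by simp
  qed
  ultimately have "(inv g \<otimes> (g \<otimes> x), inv g \<otimes> (g \<otimes> y)) \<in> adj X ^^ n"
    using assms by (intro relpow_tr_imp[of Y "inv g"]) auto
  then show "(x, y) \<in> adj X ^^ n" using assms by (simp add: inv_mult_cancel)
next
  assume "(x, y) \<in> adj X ^^ n"
  then show "(g \<otimes> x, g \<otimes> y) \<in> adj Y ^^ n"
    using assms by (intro relpow_tr_imp[of X]) auto
qed

lemma conn_tr:
  assumes "X \<subseteq> E" "Y \<subseteq> E" "g \<in> V" "\<And>e. e \<in> E \<Longrightarrow> e \<in> X \<longleftrightarrow> tr g e \<in> Y" "x \<in> V" "y \<in> V"
  shows "conn X x y \<longleftrightarrow> conn Y (g \<otimes> x) (g \<otimes> y)"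
  unfolding rtrancl_power using relpow_tr[OF assms] by blast

definition U :: "'a set set \<Rightarrow> 'a set" where
  "U X = {x\<in>V. infinite {y. conn X x y}}"

definition enum :: "nat \<Rightarrow> 'a" where
  "enum = from_nat_into V"

lemma V_nonempty: "V \<noteq> {}" by auto

lemma enum_V[simp]: "enum i \<in> V"
  unfolding enum_def by (rule from_nat_into) (rule V_nonempty)

lemma bij_enum: "bij_betw enum UNIV V"
  unfolding enum_def by (rule bij_betw_from_nat_into[OF countable_V infinite_carrier])

lemma enum_surj: "x \<in> V \<Longrightarrow> \<exists>i. x = enum i"
  using bij_enum by (auto simp: bij_betw_def image_iff)

text \<open>The vertex of an infinite cluster that comes first when the vertices are listed as
  \<open>x \<otimes> enum 0\<close>, \<open>x \<otimes> enum 1\<close>, \<dots>; listing them relative to \<open>x\<close> makes the choice equivariant.\<close>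

definition \<pi> :: "'a set set \<Rightarrow> 'a \<Rightarrow> 'a" where
  "\<pi> X x = x \<otimes> enum (LEAST i. x \<otimes> enum i \<in> U X)"

lemma \<pi>_V: "x \<in> V \<Longrightarrow> \<pi> X x \<in> V"
  by (simp add: \<pi>_def)

lemma \<pi>_U: "x \<in> V \<Longrightarrow> U X \<noteq> {} \<Longrightarrow> \<pi> X x \<in> U X"
proof -
  assume x: "x \<in> V" and "U X \<noteq> {}"
  then obtain u where u: "u \<in> U X" "u \<in> V" by (auto simp: U_def)
  obtain i where "inv x \<otimes> u = enum i" using enum_surj[of "inv x \<otimes> u"] x u by auto
  then have "x \<otimes> enum i \<in> U X" using x u by (metis inv_mult_cancel(2))
  then show ?thesis unfolding \<pi>_def by (rule LeastI)
qed

lemma U_tr: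
  assumes "X \<subseteq> E" "Y \<subseteq> E" "g \<in> V" "\<And>e. e \<in> E \<Longrightarrow> e \<in> X \<longleftrightarrow> tr g e \<in> Y" "x \<in> V"
  shows "x \<in> U X \<longleftrightarrow> g \<otimes> x \<in> U Y"
proof -
  have "bij_betw (\<lambda>y. g \<otimes> y) {y. conn X x y} {y. conn Y (g \<otimes> x) y}"
  proof (rule bij_betwI[where g = "\<lambda>y. inv g \<otimes> y"])
    show "(\<lambda>y. g \<otimes> y) \<in> {y. conn X x y} \<rightarrow> {y. conn Y (g \<otimes> x) y}"
      using conn_tr[OF assms(1-5)] conn_V assms by blast
    show "(\<lambda>y. inv g \<otimes> y) \<in> {y. conn Y (g \<otimes> x) y} \<rightarrow> {y. conn X x y}"
    proof
      fix y assume y: "y \<in> {y. conn Y (g \<otimes> x) y}"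
      then have "y \<in> V" using conn_V[of "g \<otimes> x" y Y] assms by auto
      then show "inv g \<otimes> y \<in> {y. conn X x y}"
        using conn_tr[OF assms, of "inv g \<otimes> y"] y assms(3) by (simp add: inv_mult_cancel)
    qed
  qed (use conn_V assms in \<open>auto simp: inv_mult_cancel\<close>)
  from bij_betw_finite[OF this] show ?thesis using assms by (simp add: U_def)
qed

lemma \<pi>_tr:
  assumes "X \<subseteq> E" "Y \<subseteq> E" "g \<in> V" "\<And>e. e \<in> E \<Longrightarrow> e \<in> X \<longleftrightarrow> tr g e \<in> Y" "x \<in> V"
  shows "g \<otimes> \<pi> X x = \<pi> Y (g \<otimes> x)"
proof -
  have "x \<otimes> enum i \<in> U X \<longleftrightarrow> g \<otimes> x \<otimes> enum i \<in> U Y" for i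
    using U_tr[OF assms(1-4), of "x \<otimes> enum i"] assms by (simp add: m_assoc)
  then show ?thesis using assms by (simp add: \<pi>_def m_assoc)
qed

text \<open>An element that maps an edge of \<open>J\<close> to an edge of \<open>J\<close> is a
  quotient of two of the finitely many endpoints. Hence every infinite subset of \<open>G\<close>
  contains an element that moves \<open>J\<close> off itself, as mixing requires.\<close>

lemma finite_tr_meets:
  assumes "finite J" "J \<subseteq> E"
  shows "finite {g\<in>V. tr g ` J \<inter> J \<noteq> {}}"
proof -
  have "finite (\<Union>J)" using assms edge_finite by auto
  then have "finite ((\<lambda>(x, y). y \<otimes> inv x) ` (\<Union>J \<times> \<Union>J))"
    by (intro finite_imageI finite_cartesian_product)
  moreover have "{g\<in>V. tr g ` J \<inter> J \<noteq> {}} \<subseteq> (\<lambda>(x, y). y \<otimes> inv x) ` (\<Union>J \<times> \<Union>J)"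
  proof
    fix g assume "g \<in> {g\<in>V. tr g ` J \<inter> J \<noteq> {}}"
    then obtain e where e: "g \<in> V" "e \<in> J" "tr g e \<in> J" by auto
    then obtain x where x: "x \<in> e" using edge_nonempty assms by blast
    then have "x \<in> V" using e assms edge_sub by blast
    have "g \<otimes> x \<in> tr g e" using x by (simp add: tr_def)
    have "g = (g \<otimes> x) \<otimes> inv x" using e \<open>x \<in> V\<close> by (simp add: m_assoc)
    moreover have "(x, g \<otimes> x) \<in> \<Union>J \<times> \<Union>J" using e x \<open>g \<otimes> x \<in> tr g e\<close> by blast
    ultimately show "g \<in> (\<lambda>(x, y). y \<otimes> inv x) ` (\<Union>J \<times> \<Union>J)" by (metis (no_types, lifting) case_prod_conv image_eqI)
  qed
  ultimately show ?thesis by (rule finite_subset[rotated])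
qed

lemma finite_ball: "finite {y. (x, y) \<in> adj E ^^ n}"
proof (induction n)
  case 0
  have "{y. (x, y) \<in> adj E ^^ 0} = {x}" by auto
  then show ?case by (simp only: finite.emptyI finite_insert)
next
  case (Suc n)
  have "{y. (x, y) \<in> adj E ^^ Suc n} \<subseteq>
      (\<Union>z\<in>{z. (x, z) \<in> adj E ^^ n}. (\<lambda>s. z \<otimes> s) ` S \<union> (\<lambda>s. z \<otimes> inv s) ` S)"
  proof
    fix y assume "y \<in> {y. (x, y) \<in> adj E ^^ Suc n}"
    then obtain z where z: "(x, z) \<in> adj E ^^ n" "{z, y} \<in> E" by (auto simp: adj_def)
    from z(2) obtain u s where us: "{z, y} = {u, u \<otimes> s}" "u \<in> V" "s \<in> S"
      unfolding cayley_edges_def by blast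
    have s: "s \<in> V" using us S_sub by auto
    from us(1) have "y = z \<otimes> s \<or> (y = u \<and> z = u \<otimes> s)" unfolding doubleton_eq_iff by blast
    then have "y = z \<otimes> s \<or> y = z \<otimes> inv s" using us s by (auto simp: m_assoc)
    with z us show "y \<in> (\<Union>z\<in>{z. (x, z) \<in> adj E ^^ n}. (\<lambda>s. z \<otimes> s) ` S \<union> (\<lambda>s. z \<otimes> inv s) ` S)" by blast
  qed
  moreover have "finite \<dots>" using Suc finite_S by auto
  ultimately show ?case by (rule finite_subset)
qed

end

section \<open>Measurability of connection events\<close>

lemma pred_Bex_countable:
  assumes "countable X" "\<And>i. i \<in> X \<Longrightarrow> Measurable.pred M (P i)"
  shows "Measurable.pred M (\<lambda>x. \<exists>i\<in>X. P i x)"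
proof -
  have "{x\<in>space M. \<exists>i\<in>X. P i x} = (\<Union>i\<in>X. {x\<in>space M. P i x})" by auto
  also have "\<dots> \<in> sets M"
    using assms by (intro sets.countable_UN') (auto simp: pred_def)
  finally show ?thesis by (simp only: pred_def)
qed

lemma pred_Ball_countable:
  assumes "countable X" "\<And>i. i \<in> X \<Longrightarrow> Measurable.pred M (P i)"
  shows "Measurable.pred M (\<lambda>x. \<forall>i\<in>X. P i x)"
proof -
  have "Measurable.pred M (\<lambda>x. \<exists>i\<in>X. \<not> P i x)"
    by (rule pred_Bex_countable[OF assms(1)]) (intro pred_intros_logic assms(2))
  then have "Measurable.pred M (\<lambda>x. \<not> (\<exists>i\<in>X. \<not> P i x))" by (rule pred_intros_logic)
  then show ?thesis by simp
qed

context cayley_graph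
begin

lemma open_adjacency_eq: "open_adjacency G S \<omega> = adj {e\<in>E. \<omega> e}"
  by (auto simp: open_adjacency_def adj_def)

text \<open>This replaces the quotient by conditions on vertices and pairs of vertices. There are
  only countably many of these, which makes measurability accessible.\<close>

lemma unique_infinite_cluster_iff:
  "(\<exists>!C. C \<in> clusters G S \<omega> \<and> infinite C) \<longleftrightarrow>
     U {e\<in>E. \<omega> e} \<noteq> {} \<and> (\<forall>x\<in>U {e\<in>E. \<omega> e}. \<forall>y\<in>U {e\<in>E. \<omega> e}. conn {e\<in>E. \<omega> e} x y)"
proof -
  let ?X = "{e\<in>E. \<omega> e}"
  let ?c = "\<lambda>x. {y. conn ?X x y}"
  have cl: "C \<in> clusters G S \<omega> \<and> infinite C \<longleftrightarrow> (\<exists>x\<in>U ?X. C = ?c x)" for C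
    unfolding clusters_def open_adjacency_eq quotient_def U_def by (auto simp: Image_def)
  have eq: "?c x = ?c y \<longleftrightarrow> conn ?X x y" for x y
  proof
    assume "?c x = ?c y"
    then have "y \<in> ?c x" by simp
    then show "conn ?X x y" by simp
  next
    assume "conn ?X x y"
    then have "conn ?X x z \<longleftrightarrow> conn ?X y z" for z
      by (meson conn_trans conn_sym)
    then show "?c x = ?c y" by simp
  qed
  show ?thesis
  proof (intro iffI conjI ballI)
    assume *: "\<exists>!C. C \<in> clusters G S \<omega> \<and> infinite C"
    then obtain C where "C \<in> clusters G S \<omega> \<and> infinite C" by (rule ex1E)
    then show "U ?X \<noteq> {}" unfolding cl by (elim bexE) (rule ex_in_conv[THEN iffD1], rule exI)
    have mem: "?c x \<in> clusters G S \<omega> \<and> infinite (?c x)" if "x \<in> U ?X" for x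
      using that by (intro cl[THEN iffD2] bexI[of _ x] refl)
    fix x y assume "x \<in> U ?X" "y \<in> U ?X"
    note xy = mem[OF this(1)] mem[OF this(2)]
    from * have "?c x = ?c y"
    proof (rule ex1E)
      fix C assume C: "\<forall>D. D \<in> clusters G S \<omega> \<and> infinite D \<longrightarrow> D = C"
      show ?thesis
        using mp[OF spec[OF C, of "?c x"] xy(1)] mp[OF spec[OF C, of "?c y"] xy(2)] by (simp only:)
    qed
    then show "conn ?X x y" unfolding eq .
  next
    assume *: "U ?X \<noteq> {} \<and> (\<forall>x\<in>U ?X. \<forall>y\<in>U ?X. conn ?X x y)"
    then obtain x where x: "x \<in> U ?X" by (metis ex_in_conv)
    show "\<exists>!C. C \<in> clusters G S \<omega> \<and> infinite C"
      unfolding cl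
    proof (rule ex1I[of _ "?c x"])
      show "\<exists>x'\<in>U ?X. ?c x = ?c x'" by (rule bexI[OF refl x])
      fix C assume "\<exists>x\<in>U ?X. C = ?c x"
      then obtain y where y: "y \<in> U ?X" "C = ?c y" by (elim bexE)
      have "conn ?X y x" using * x y(1) by simp
      then show "C = ?c x" unfolding y(2) eq .
    qed
  qed
qed

lemma pred_relpow:
  assumes X: "\<And>e. e \<in> E \<Longrightarrow> Measurable.pred M (\<lambda>c. e \<in> X c)" "\<And>c. X c \<subseteq> E"
  shows "Measurable.pred M (\<lambda>c. (x, y) \<in> adj (X c) ^^ n)"
proof (induction n arbitrary: y)
  case 0
  then show ?case by simp
next
  case (Suc n)
  have "(x, y) \<in> adj (X c) ^^ Suc n \<longleftrightarrow> (\<exists>z\<in>V. (x, z) \<in> adj (X c) ^^ n \<and> {z, y} \<in> X c)" for c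
  proof
    assume "(x, y) \<in> adj (X c) ^^ Suc n"
    then obtain z where z: "(x, z) \<in> adj (X c) ^^ n" "(z, y) \<in> adj (X c)" by auto
    then have "z \<in> V" using adj_E[OF z(2) X(2)] by simp
    with z show "\<exists>z\<in>V. (x, z) \<in> adj (X c) ^^ n \<and> {z, y} \<in> X c" by (auto simp: adj_def)
  next
    assume "\<exists>z\<in>V. (x, z) \<in> adj (X c) ^^ n \<and> {z, y} \<in> X c"
    then show "(x, y) \<in> adj (X c) ^^ Suc n" by (auto simp: adj_def)
  qed
  note eq = this
  have P: "Measurable.pred M (\<lambda>c. {z, y} \<in> X c)" for z
  proof (cases "{z, y} \<in> E")
    case False
    then have "{z, y} \<notin> X c" for c using X(2) by auto
    then show ?thesis by simp
  qed (rule X(1))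
  show ?case
    unfolding eq by (intro pred_Bex_countable pred_intros_logic Suc.IH P countable_V)
qed

lemma pred_conn:
  assumes "\<And>e. e \<in> E \<Longrightarrow> Measurable.pred M (\<lambda>c. e \<in> X c)" "\<And>c. X c \<subseteq> E"
  shows "Measurable.pred M (\<lambda>c. conn (X c) x y)"
  unfolding rtrancl_power by (intro pred_intros_countable pred_relpow assms)

text \<open>\<open>V\<close> has only countably many finite subsets, and a set is infinite when none
  of them contains it; this is a countable combination of the membership events.\<close>

lemma pred_infinite:
  assumes "\<And>y. y \<in> V \<Longrightarrow> Measurable.pred M (\<lambda>c. y \<in> Y c)" "\<And>c. Y c \<subseteq> V"
  shows "Measurable.pred M (\<lambda>c. infinite (Y c))"
proof -
  let ?F = "{F. finite F \<and> F \<subseteq> V}"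
  have "infinite (Y c) \<longleftrightarrow> (\<forall>F\<in>?F. \<exists>y\<in>V. y \<notin> F \<and> y \<in> Y c)" for c
  proof
    assume inf: "infinite (Y c)"
    show "\<forall>F\<in>?F. \<exists>y\<in>V. y \<notin> F \<and> y \<in> Y c"
    proof
      fix F assume "F \<in> ?F"
      then have "\<not> Y c \<subseteq> F" using inf by (metis finite_subset mem_Collect_eq)
      then show "\<exists>y\<in>V. y \<notin> F \<and> y \<in> Y c" using assms(2) by blast
    qed
  next
    assume *: "\<forall>F\<in>?F. \<exists>y\<in>V. y \<notin> F \<and> y \<in> Y c"
    show "infinite (Y c)"
    proof
      assume "finite (Y c)"
      then have "Y c \<in> ?F" using assms(2) by simp
      with * show False by blast
    qed
  qed
  note eq = this
  have "countable ?F" by (rule countable_Collect_finite_subset[OF countable_V])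
  moreover have const: "Measurable.pred M (\<lambda>_. b)" for b by simp
  ultimately show ?thesis
    unfolding eq by (intro const pred_Ball_countable pred_Bex_countable pred_intros_logic assms(1) countable_V)
qed

lemma pred_U:
  assumes "\<And>e. e \<in> E \<Longrightarrow> Measurable.pred M (\<lambda>c. e \<in> X c)" "\<And>c. X c \<subseteq> E"
  shows "Measurable.pred M (\<lambda>c. x \<in> U (X c))"
proof (cases "x \<in> V")
  case True
  have "Measurable.pred M (\<lambda>c. infinite {y. conn (X c) x y})"
    by (rule pred_infinite) (auto intro: pred_conn[OF assms] conn_V[OF _ assms(2) True])
  with True show ?thesis by (simp add: U_def)
qed (simp add: U_def)

lemma measurable_\<pi>:
  assumes "\<And>e. e \<in> E \<Longrightarrow> Measurable.pred M (\<lambda>c. e \<in> X c)" "\<And>c. X c \<subseteq> E"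
  shows "(\<lambda>c. \<pi> (X c) x) \<in> measurable M (count_space UNIV)"
proof -
  have "(\<lambda>c. LEAST i. x \<otimes> enum i \<in> U (X c)) \<in> measurable M (count_space UNIV)"
    by (rule measurable_Least) (rule pred_U[OF assms])
  then show ?thesis unfolding \<pi>_def by (rule measurable_compose) simp
qed

lemma pred_conn_\<pi>:
  assumes X: "\<And>e. e \<in> E \<Longrightarrow> Measurable.pred M (\<lambda>c. e \<in> X c)" "\<And>c. X c \<subseteq> E"
    and Y: "\<And>e. e \<in> E \<Longrightarrow> Measurable.pred M (\<lambda>c. e \<in> Y c)" "\<And>c. Y c \<subseteq> E"
    and "x \<in> V" "y \<in> V"
  shows "Measurable.pred M (\<lambda>c. conn (Y c) (\<pi> (X c) x) (\<pi> (X c) y))"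
proof -
  have "conn (Y c) (\<pi> (X c) x) (\<pi> (X c) y) \<longleftrightarrow>
      (\<exists>u\<in>V. \<exists>v\<in>V. \<pi> (X c) x = u \<and> \<pi> (X c) y = v \<and> conn (Y c) u v)" for c
    using \<pi>_V assms(5,6) by blast
  note eq = this
  have P: "Measurable.pred M (\<lambda>c. \<pi> (X c) x = u)" for x u
    by (rule measurable_compose[OF measurable_\<pi>[OF X]]) (assumption | rule measurable_count_space)+
  show ?thesis
    unfolding eq by (intro pred_Bex_countable pred_intros_logic P pred_conn[OF Y] countable_V)
qed

end

section \<open>The random equivalence relation\<close>

locale percolation = cayley_graph G S for G (structure) and S +
  fixes q r s :: real
  assumes params: "0 \<le> q" "q \<le> 1" "0 \<le> r" "r \<le> 1" "0 \<le> s" "s \<le> 1"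
begin

text \<open>Three independent layers of edge variables: \<open>O\<^sub>0\<close> is percolation at \<open>q\<close>, \<open>O\<^sub>1\<close> thins it
  with density \<open>r\<close>, and \<open>O\<^sub>2\<close> lies between the two, the thinned edges being restored with
  density \<open>s\<close>.\<close>

definition par :: "'a set \<times> nat \<Rightarrow> real" where
  "par i = (if snd i = 0 then q else if snd i = 1 then r else s)"

abbreviation ind :: "('a set \<times> nat) set" where "ind \<equiv> E \<times> {..2}"

sublocale bernoulli par ind
  by unfold_locales (auto simp: par_def params)

abbreviation \<Omega> :: "('a set \<times> nat \<Rightarrow> bool) measure" where "\<Omega> \<equiv> PiM ind Bern"

definition t :: "'a \<Rightarrow> 'a set \<times> nat \<Rightarrow> 'a set \<times> nat" where
  "t g i = (tr g (fst i), snd i)"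

lemma par_t: "par (t g i) = par i"
  by (simp add: par_def t_def)

lemma shift_t: "g \<in> V \<Longrightarrow> shift Bern ind (t g)"
proof -
  assume g: "g \<in> V"
  interpret product_prob_space Bern ind by unfold_locales
  show ?thesis
  proof
    show "inj_on (t g) ind"
      using inj_tr[OF g] by (auto simp: inj_on_def t_def)
  qed (auto simp: t_def par_def intro: tr_edge g)
qed

abbreviation act :: "'a \<Rightarrow> ('a set \<times> nat \<Rightarrow> bool) \<Rightarrow> 'a set \<times> nat \<Rightarrow> bool" where
  "act g \<equiv> shift.act ind (t g)"

lemma act_eq: "g \<in> V \<Longrightarrow> e \<in> E \<Longrightarrow> l \<le> 2 \<Longrightarrow> act g c (e, l) = c (tr g e, l)"
  using shift.act_def[OF shift_t] by (simp add: t_def)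

definition O\<^sub>0 :: "('a set \<times> nat \<Rightarrow> bool) \<Rightarrow> 'a set set" where
  "O\<^sub>0 c = {e\<in>E. c (e, 0)}"

definition O\<^sub>1 :: "('a set \<times> nat \<Rightarrow> bool) \<Rightarrow> 'a set set" where
  "O\<^sub>1 c = {e\<in>E. c (e, 0) \<and> c (e, 1)}"

definition O\<^sub>2 :: "('a set \<times> nat \<Rightarrow> bool) \<Rightarrow> 'a set set" where
  "O\<^sub>2 c = {e\<in>E. c (e, 0) \<and> (c (e, 1) \<or> c (e, 2))}"

lemma O_sub: "O\<^sub>0 c \<subseteq> E" "O\<^sub>1 c \<subseteq> E" "O\<^sub>2 c \<subseteq> E" "O\<^sub>1 c \<subseteq> O\<^sub>0 c" "O\<^sub>1 c \<subseteq> O\<^sub>2 c" "O\<^sub>2 c \<subseteq> O\<^sub>0 c"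
  by (auto simp: O\<^sub>0_def O\<^sub>1_def O\<^sub>2_def)

lemma O_act:
  assumes "g \<in> V" "e \<in> E"
  shows "e \<in> O\<^sub>0 (act g c) \<longleftrightarrow> tr g e \<in> O\<^sub>0 c" "e \<in> O\<^sub>1 (act g c) \<longleftrightarrow> tr g e \<in> O\<^sub>1 c"
    "e \<in> O\<^sub>2 (act g c) \<longleftrightarrow> tr g e \<in> O\<^sub>2 c"
  using assms by (simp_all add: O\<^sub>0_def O\<^sub>1_def O\<^sub>2_def act_eq tr_edge)

lemma pred_coordinate: "i \<in> ind \<Longrightarrow> Measurable.pred \<Omega> (\<lambda>c. c i)"
  using measurable_component_singleton[of i ind Bern] by (simp add: measurable_pmf_measure2)

lemma pred_O:
  assumes "e \<in> E"
  shows "Measurable.pred \<Omega> (\<lambda>c. e \<in> O\<^sub>0 c)" "Measurable.pred \<Omega> (\<lambda>c. e \<in> O\<^sub>1 c)" "Measurable.pred \<Omega> (\<lambda>c. e \<in> O\<^sub>2 c)"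
  using assms pred_coordinate[of "(e, 0)"] pred_coordinate[of "(e, 1)"] pred_coordinate[of "(e, 2)"]
  by (simp_all add: O\<^sub>0_def O\<^sub>1_def O\<^sub>2_def)

text \<open>Representatives are compared in place of the vertices themselves because a vertex may
  lie in a finite cluster with positive probability, whatever \<open>r\<close> is. Both
  representatives belong to the infinite cluster of \<open>O\<^sub>0\<close>, so only thinning can
  separate them.\<close>

definition rel :: "('a set \<times> nat \<Rightarrow> bool) \<Rightarrow> 'a \<Rightarrow> 'a \<Rightarrow> bool" where
  "rel c x y \<longleftrightarrow> conn (O\<^sub>1 c) (\<pi> (O\<^sub>0 c) x) (\<pi> (O\<^sub>0 c) y)"

lemma rel_refl: "rel c x x" and rel_sym: "rel c x y \<Longrightarrow> rel c y x"
  and rel_trans: "rel c x y \<Longrightarrow> rel c y z \<Longrightarrow> rel c x z"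
  unfolding rel_def by (auto intro: conn_sym rtrancl_trans)

lemma pred_rel[measurable]: "x \<in> V \<Longrightarrow> y \<in> V \<Longrightarrow> Measurable.pred \<Omega> (\<lambda>c. rel c x y)"
  unfolding rel_def by (intro pred_conn_\<pi> pred_O O_sub)

lemma rel_act: "g \<in> V \<Longrightarrow> x \<in> V \<Longrightarrow> y \<in> V \<Longrightarrow> rel (act g c) x y \<longleftrightarrow> rel c (g \<otimes> x) (g \<otimes> y)"
proof -
  assume *: "g \<in> V" "x \<in> V" "y \<in> V"
  have "g \<otimes> \<pi> (O\<^sub>0 (act g c)) z = \<pi> (O\<^sub>0 c) (g \<otimes> z)" if "z \<in> V" for z
    using that * by (intro \<pi>_tr O_sub O_act)
  moreover have "rel (act g c) x y \<longleftrightarrow>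
      conn (O\<^sub>1 c) (g \<otimes> \<pi> (O\<^sub>0 (act g c)) x) (g \<otimes> \<pi> (O\<^sub>0 (act g c)) y)"
    unfolding rel_def using * by (intro conn_tr O_sub O_act \<pi>_V)
  ultimately show ?thesis using * by (simp add: rel_def)
qed

section \<open>The separation probability as an invariant pseudometric\<close>

definition d :: "'a \<Rightarrow> 'a \<Rightarrow> real" where
  "d x y = \<P>(c in \<Omega>. \<not> rel c x y)"

lemma d_nonneg: "0 \<le> d x y" and d_refl: "d x x = 0"
  by (simp_all add: d_def rel_refl)

lemma d_sym: "d x y = d y x"
  unfolding d_def by (metis rel_sym)

lemma d_act: "g \<in> V \<Longrightarrow> x \<in> V \<Longrightarrow> y \<in> V \<Longrightarrow> d (g \<otimes> x) (g \<otimes> y) = d x y"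
  using shift.prob_act_Collect[OF shift_t, of g "\<lambda>c. \<not> rel c x y"]
  by (simp add: d_def rel_act)

lemma d_triangle:
  assumes "x \<in> V" "y \<in> V" "z \<in> V"
  shows "d x z \<le> d x y + d y z"
proof -
  have "d x z \<le> P.prob ({c\<in>space \<Omega>. \<not> rel c x y} \<union> {c\<in>space \<Omega>. \<not> rel c y z})"
    unfolding d_def using assms by (intro P.finite_measure_mono) (auto dest: rel_trans)
  also have "\<dots> \<le> d x y + d y z"
    unfolding d_def using assms by (intro measure_Un_le) auto
  finally show ?thesis .
qed

lemma d_one_mult: "x \<in> V \<Longrightarrow> y \<in> V \<Longrightarrow> d \<one> (x \<otimes> y) \<le> d \<one> x + d \<one> y"
  using d_triangle[of \<one> x "x \<otimes> y"] d_act[of x \<one> y] by simp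

lemma d_one_inv: "x \<in> V \<Longrightarrow> d \<one> (inv x) = d \<one> x"
  using d_act[of x \<one> "inv x"] d_sym[of x \<one>] by simp

lemma prob_rel: "x \<in> V \<Longrightarrow> y \<in> V \<Longrightarrow> \<P>(c in \<Omega>. rel c x y) = 1 - d x y"
  unfolding d_def by (subst P.prob_neg) auto

text \<open>If \<open>h\<close> commutes with \<open>x\<close>, then \<open>rel c \<one> x\<close> and \<open>rel c h (h \<otimes> x)\<close> differ only where
  \<open>\<one>\<close>, \<open>h\<close> or \<open>x\<close>, \<open>x \<otimes> h\<close> are separated.\<close>

lemma prob_sym_diff_rel:
  assumes "h \<in> V" "x \<in> V" "h \<otimes> x = x \<otimes> h"
  shows "P.prob (sym_diff {c\<in>space \<Omega>. rel c \<one> x} (act h -` {c\<in>space \<Omega>. rel c \<one> x} \<inter> space \<Omega>)) \<le> 2 * d \<one> h"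
proof -
  have "act h -` {c\<in>space \<Omega>. rel c \<one> x} \<inter> space \<Omega> = {c\<in>space \<Omega>. rel c h (x \<otimes> h)}"
    using measurable_space[OF shift.measurable_act[OF shift_t[OF assms(1)]]] assms
    by (auto simp: rel_act)
  then have "P.prob (sym_diff {c\<in>space \<Omega>. rel c \<one> x} (act h -` {c\<in>space \<Omega>. rel c \<one> x} \<inter> space \<Omega>)) \<le>
      P.prob ({c\<in>space \<Omega>. \<not> rel c \<one> h} \<union> {c\<in>space \<Omega>. \<not> rel c x (x \<otimes> h)})"
  proof (simp only:, intro P.finite_measure_mono)
    have "rel c \<one> x \<longleftrightarrow> rel c h (x \<otimes> h)" if "rel c \<one> h" "rel c x (x \<otimes> h)" for c
      using that by (meson rel_trans rel_sym)
    then show "sym_diff {c\<in>space \<Omega>. rel c \<one> x} {c\<in>space \<Omega>. rel c h (x \<otimes> h)} \<subseteq>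
        {c\<in>space \<Omega>. \<not> rel c \<one> h} \<union> {c\<in>space \<Omega>. \<not> rel c x (x \<otimes> h)}" by auto
  qed (use assms in auto)
  also have "\<dots> \<le> d \<one> h + d x (x \<otimes> h)"
    unfolding d_def using assms by (intro measure_Un_le) auto
  also have "d x (x \<otimes> h) = d \<one> h"
    using d_act[of x \<one> h] assms by simp
  finally show ?thesis by simp
qed

text \<open>A subadditive function taking values near \<open>0\<close> or \<open>1\<close> only, and small on the generators,
  cannot leave the neighbourhood of \<open>0\<close>.\<close>

lemma d_small_on_generated:
  assumes "subgroup L G" "generate G A = L"
    and dich: "\<And>x. x \<in> L \<Longrightarrow> d \<one> x * (1 - d \<one> x) \<le> \<delta>"
    and small: "\<And>a. a \<in> A \<Longrightarrow> d \<one> a \<le> \<eta>" "2 * \<delta> + \<eta> < 1 / 2" "0 \<le> \<delta>"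
    and "x \<in> L"
  shows "d \<one> x \<le> 2 * \<delta>"
proof -
  have LV: "L \<subseteq> V" using assms(1) by (rule subgroup.subset)
  have AL: "A \<subseteq> L" unfolding assms(2)[symmetric] by (intro subsetI generate.incl)
  have low: "d \<one> y \<le> 2 * \<delta>" if "y \<in> L" "d \<one> y < 1 / 2" for y
  proof -
    have "d \<one> y * (1 / 2) \<le> d \<one> y * (1 - d \<one> y)" using that d_nonneg by (intro mult_left_mono) auto
    with dich[OF that(1)] show ?thesis by simp
  qed
  \<comment> \<open>The claim is about multiplying an arbitrary element \<open>y\<close> close to
    \<one> by \<open>x\<close> on the right; in this form it composes along products, and
    \<open>y = \<one>\<close> gives the result.\<close>
  have "\<forall>y\<in>L. d \<one> y \<le> 2 * \<delta> \<longrightarrow> d \<one> (y \<otimes> x) \<le> 2 * \<delta>"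
    using \<open>x \<in> L\<close>[folded assms(2)]
  proof (induction rule: generate.induct)
    case one
    then show ?case using LV by auto
  next
    case (incl h)
    show ?case
    proof (intro ballI impI low)
      fix y assume y: "y \<in> L" "d \<one> y \<le> 2 * \<delta>"
      show "y \<otimes> h \<in> L" using assms(1) y incl AL by (auto intro: subgroup.m_closed)
      have "d \<one> (y \<otimes> h) \<le> d \<one> y + d \<one> h" using y incl AL LV by (intro d_one_mult) auto
      then show "d \<one> (y \<otimes> h) < 1 / 2" using y small(1)[OF incl] small(2) by linarith
    qed
  next
    case (inv h)
    have h: "h \<in> L" "h \<in> V" using inv AL LV by auto
    show ?case
    proof (intro ballI impI low)
      fix y assume y: "y \<in> L" "d \<one> y \<le> 2 * \<delta>"
      show "y \<otimes> inv h \<in> L" using assms(1) y h by (auto intro: subgroup.m_closed subgroup.m_inv_closed)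
      have "d \<one> (y \<otimes> inv h) \<le> d \<one> y + d \<one> (inv h)" using y h LV by (intro d_one_mult) auto
      then show "d \<one> (y \<otimes> inv h) < 1 / 2"
        using y small(1)[OF inv] small(2) h by (simp add: d_one_inv)
    qed
  next
    case (eng h k)
    show ?case
    proof (intro ballI impI)
      fix y assume y: "y \<in> L" "d \<one> y \<le> 2 * \<delta>"
      have hk: "h \<in> L" "k \<in> L" using eng.hyps assms(2) by auto
      then have "y \<otimes> h \<in> L" using assms(1) y by (auto intro: subgroup.m_closed)
      with eng.IH y have "d \<one> (y \<otimes> h \<otimes> k) \<le> 2 * \<delta>" by blast
      then show "d \<one> (y \<otimes> (h \<otimes> k)) \<le> 2 * \<delta>" using y hk LV by (simp add: m_assoc subset_iff)
    qed
  qed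
  moreover have "\<one> \<in> L" using assms(1) by (rule subgroup.one_closed)
  ultimately show ?thesis using d_refl[of \<one>] \<open>0 \<le> \<delta>\<close> \<open>x \<in> L\<close> LV by fastforce
qed

text \<open>For \<open>k\<close> in \<open>K\<close> the event that \<one> and \<open>k\<close> are
  related changes by at most \<open>2 * \<eta>\<close> under each element of \<open>F\<close>, so
  the spectral gap bounds its variance by \<delta> and \<open>d \<one> k\<close> by
  \<open>2 * \<delta>\<close>. Now \<open>K\<close> moves the event for \<open>h\<close> in
  \<open>H\<close> by at most \<open>4 * \<delta>\<close>; mixing gives that bound for its variance,
  and \<open>d \<one> h\<close> is at most \<open>8 * \<delta>\<close>. The sum
  \<open>10 * \<delta>\<close> is the term with factor 20 in the hypothesis on \<eta>.\<close>

lemma uniform_connectivity: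
  assumes H: "subgroup H G" "generate G A = H" and K: "subgroup K G" "generate G B = K"
    and comm: "commuting_subsets G H K" and gen: "generate G (H \<union> K) = V" and "infinite K"
    and F: "finite F" "F \<subseteq> H" and "0 \<le> C"
    and gap: "\<And>D. D \<in> P.events \<Longrightarrow>
      P.prob D * (1 - P.prob D) \<le> C * (\<Sum>h\<in>F. P.prob (sym_diff D (act h -` D \<inter> space \<Omega>)))"
    and small: "\<And>x. x \<in> F \<union> A \<union> B \<Longrightarrow> d \<one> x \<le> \<eta>" and "0 \<le> \<eta>"
    and \<eta>: "20 * (C * card F * \<eta>) + \<eta> < 1 / 4" and "g \<in> V"
  shows "d \<one> g < 1 / 4"
proof -
  have HV: "H \<subseteq> V" and KV: "K \<subseteq> V" using H(1) K(1) by (auto dest: subgroup.subset)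
  define \<delta> where "\<delta> = 2 * (C * card F * \<eta>)"
  have \<delta>: "0 \<le> \<delta>" "10 * \<delta> + \<eta> < 1 / 4"
    using \<open>0 \<le> C\<close> \<open>0 \<le> \<eta>\<close> \<eta> by (auto simp: \<delta>_def)
  have hk: "h \<otimes> k = k \<otimes> h" if "h \<in> H" "k \<in> K" for h k
    using that comm by (auto simp: commuting_subsets_def)
  have dK: "d \<one> k \<le> 2 * \<delta>" if "k \<in> K" for k
  proof (rule d_small_on_generated[OF K])
    fix k assume k: "k \<in> K"
    let ?D = "{c\<in>space \<Omega>. rel c \<one> k}"
    have kV: "k \<in> V" using k KV by auto
    have "P.prob ?D * (1 - P.prob ?D) \<le> C * (\<Sum>h\<in>F. P.prob (sym_diff ?D (act h -` ?D \<inter> space \<Omega>)))"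
      by (rule gap) (use kV in measurable)
    also have "\<dots> \<le> C * (\<Sum>h\<in>F. 2 * \<eta>)"
    proof (intro mult_left_mono sum_mono \<open>0 \<le> C\<close>)
      fix h assume h: "h \<in> F"
      have "P.prob (sym_diff ?D (act h -` ?D \<inter> space \<Omega>)) \<le> 2 * d \<one> h"
        using h F HV kV k hk by (intro prob_sym_diff_rel) auto
      also have "\<dots> \<le> 2 * \<eta>" using small[of h] h by simp
      finally show "P.prob (sym_diff ?D (act h -` ?D \<inter> space \<Omega>)) \<le> 2 * \<eta>" .
    qed
    also have "\<dots> = \<delta>" by (simp add: \<delta>_def)
    finally show "d \<one> k * (1 - d \<one> k) \<le> \<delta>" using kV by (simp add: prob_rel mult.commute)
  next
    show "\<And>a. a \<in> B \<Longrightarrow> d \<one> a \<le> \<eta>" using small by auto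
    show "2 * \<delta> + \<eta> < 1 / 2" using \<delta> by linarith
  qed fact+
  have dH: "d \<one> h \<le> 2 * (4 * \<delta>)" if "h \<in> H" for h
  proof (rule d_small_on_generated[OF H])
    fix h assume h: "h \<in> H"
    let ?D = "{c\<in>space \<Omega>. rel c \<one> h}"
    have hV: "h \<in> V" using h HV by auto
    have "P.prob ?D * (1 - P.prob ?D) \<le> 4 * \<delta>"
    proof (rule mixing_bound[of K Bern ind t])
      show "shift Bern ind (t k)" if "k \<in> K" for k using that KV by (intro shift_t) auto
      show "?D \<in> P.events" using hV by measurable
      fix k assume k: "k \<in> K"
      have "P.prob (sym_diff ?D (act k -` ?D \<inter> space \<Omega>)) \<le> 2 * d \<one> k"
        using k KV hV hk[OF h k, symmetric] by (intro prob_sym_diff_rel) auto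
      also have "\<dots> \<le> 4 * \<delta>" using dK[OF k] by simp
      finally show "P.prob (sym_diff ?D (act k -` ?D \<inter> space \<Omega>)) \<le> 4 * \<delta>" .
    next
      fix J assume J: "finite J" "J \<subseteq> ind"
      define Z where "Z = {g\<in>V. tr g ` (fst ` J) \<inter> fst ` J \<noteq> {}}"
      have "finite Z" unfolding Z_def using J by (intro finite_tr_meets) auto
      then have "\<not> K \<subseteq> Z" using \<open>infinite K\<close> by (intro notI) (drule finite_subset, assumption, simp)
      then obtain k where k: "k \<in> K" "k \<notin> Z" by blast
      moreover from k(1) have "k \<in> V" using KV by blast
      ultimately have "tr k ` (fst ` J) \<inter> fst ` J = {}" unfolding Z_def by simp
      note k = k(1) this
      have "t k ` J \<inter> J = {}"
      proof (rule ccontr)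
        assume "t k ` J \<inter> J \<noteq> {}"
        then obtain i where i: "i \<in> J" "t k i \<in> J" by auto
        then have "tr k (fst i) \<in> fst ` J" by (metis fst_conv imageI t_def)
        moreover have "tr k (fst i) \<in> tr k ` (fst ` J)" using i(1) by (intro imageI)
        ultimately show False using k(2) by (metis IntI empty_iff)
      qed
      with k show "\<exists>k\<in>K. t k ` J \<inter> J = {}" by blast
    qed
    then show "d \<one> h * (1 - d \<one> h) \<le> 4 * \<delta>" using hV by (simp add: prob_rel mult.commute)
  next
    show "\<And>a. a \<in> A \<Longrightarrow> d \<one> a \<le> \<eta>" using small by auto
    show "2 * (4 * \<delta>) + \<eta> < 1 / 2" "0 \<le> 4 * \<delta>" using \<delta> by linarith+
  qed fact+
  obtain h k where hk': "h \<in> H" "k \<in> K" "g = h \<otimes> k"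
    using generate_commuting_subgroups[OF H(1) K(1) comm] gen \<open>g \<in> V\<close> by blast
  have "d \<one> g \<le> d \<one> h + d \<one> k" unfolding hk'(3) using hk' HV KV by (intro d_one_mult) auto
  also have "\<dots> \<le> 10 * \<delta>" using dH[OF hk'(1)] dK[OF hk'(2)] by linarith
  finally show ?thesis using \<delta> \<open>0 \<le> \<eta>\<close> by linarith
qed

text \<open>The uniform measure on \<open>verts W\<close> turns an almost invariant measure on the finite sets \<open>W\<close> of
  coordinates, as produced by the Fourier expansion, into one on the group.\<close>

definition verts :: "('a set \<times> nat) set \<Rightarrow> 'a set" where
  "verts W = \<Union> (fst ` W)"

lemma percolation_gap:
  assumes F: "finite F" "F \<subseteq> V" and "0 < e"
    and not_ai: "\<And>\<nu>. set_pmf \<nu> \<subseteq> V \<Longrightarrow>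
      \<exists>h\<in>F. \<exists>A. e < \<bar>measure_pmf.prob \<nu> {x. h \<otimes> x \<in> A} - measure_pmf.prob \<nu> A\<bar>"
    and D: "D \<in> P.events"
  shows "P.prob D * (1 - P.prob D) \<le> 4 / e\<^sup>2 * (\<Sum>h\<in>F. P.prob (sym_diff D (act h -` D \<inter> space \<Omega>)))"
proof (rule spectral_gap[OF F(1) _ par_t \<open>0 < e\<close> _ D])
  show "shift Bern ind (t h)" if "h \<in> F" for h using that F by (intro shift_t) auto
  fix \<mu> :: "('a set \<times> nat) set pmf"
  assume \<mu>: "finite (set_pmf \<mu>)" "set_pmf \<mu> \<subseteq> {W. finite W \<and> W \<noteq> {} \<and> W \<subseteq> ind}"
  have W: "finite (verts W)" "verts W \<noteq> {}" "verts W \<subseteq> V" if "W \<in> set_pmf \<mu>" for W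
  proof -
    have W: "finite W" "W \<noteq> {}" "W \<subseteq> ind" using that \<mu>(2) by auto
    then have fst_W: "e \<in> E" if "e \<in> fst ` W" for e using that by auto
    show "finite (verts W)"
      unfolding verts_def using W(1) by (intro finite_Union finite_imageI edge_finite fst_W)
    show "verts W \<subseteq> V"
      unfolding verts_def by (intro Union_least edge_sub fst_W)
    obtain i where "i \<in> W" using W(2) by auto
    then have "fst i \<noteq> {}" "fst i \<subseteq> verts W"
      unfolding verts_def by (auto intro!: edge_nonempty fst_W)
    then show "verts W \<noteq> {}" by auto
  qed
  define \<nu> where "\<nu> = bind_pmf \<mu> (\<lambda>W. pmf_of_set (verts W))"
  have "set_pmf \<nu> \<subseteq> V" unfolding \<nu>_def using W by (auto simp: set_pmf_of_set)
  from not_ai[OF this] obtain h A where h: "h \<in> F"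
    "e < \<bar>measure_pmf.prob \<nu> {x. h \<otimes> x \<in> A} - measure_pmf.prob \<nu> A\<bar>" by blast
  have hV: "h \<in> V" using h F by auto
  \<comment> \<open>\<nu> of \<open>A\<close> is the \<mu>-mean of \<phi>, and the translated
    probability is its mean under the image of \<mu>. As \<phi> takes values between 0 and 1, a
    large displacement of \<nu> forces one of \<mu>.\<close>
  define \<phi> where "\<phi> W = measure_pmf.prob (pmf_of_set (verts W)) A" for W
  have "measure_pmf.prob \<nu> A = (\<integral>W. \<phi> W \<partial>measure_pmf \<mu>)"
    by (simp add: \<nu>_def prob_bind_pmf \<phi>_def)
  moreover have "measure_pmf.prob \<nu> {x. h \<otimes> x \<in> A} = (\<integral>W. \<phi> (t h ` W) \<partial>measure_pmf \<mu>)"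
    unfolding \<nu>_def prob_bind_pmf
  proof (intro integral_cong_AE AE_pmfI)
    fix W assume W': "W \<in> set_pmf \<mu>"
    have "verts (t h ` W) = (\<lambda>x. h \<otimes> x) ` verts W"
      unfolding verts_def by (auto simp: t_def tr_def image_iff)
    moreover have "inj_on (\<lambda>x. h \<otimes> x) (verts W)"
      using hV W(3)[OF W'] by (intro inj_onI) (metis inv_mult_cancel(1) subsetD)
    ultimately have "pmf_of_set (verts (t h ` W)) = map_pmf (\<lambda>x. h \<otimes> x) (pmf_of_set (verts W))"
      using W[OF W'] by (simp add: map_pmf_of_set_inj)
    then show "measure_pmf.prob (pmf_of_set (verts W)) {x. h \<otimes> x \<in> A} = \<phi> (t h ` W)"
      by (simp add: \<phi>_def vimage_def)
  qed auto
  moreover have "(\<integral>W. \<phi> (t h ` W) \<partial>measure_pmf \<mu>) = (\<integral>W. \<phi> W \<partial>measure_pmf (map_pmf (\<lambda>W. t h ` W) \<mu>))"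
    by simp
  ultimately have "\<not> \<bar>(\<integral>W. \<phi> W \<partial>measure_pmf (map_pmf (\<lambda>W. t h ` W) \<mu>)) - (\<integral>W. \<phi> W \<partial>measure_pmf \<mu>)\<bar> \<le> e"
    using h(2) by linarith
  then have "\<not> (\<forall>\<A>. \<bar>measure_pmf.prob (map_pmf (\<lambda>W. t h ` W) \<mu>) \<A> - measure_pmf.prob \<mu> \<A>\<bar> \<le> e)"
    using \<mu>(1) abs_integral_pmf_diff_le_variation[of "map_pmf (\<lambda>W. t h ` W) \<mu>" \<mu> e \<phi>]
    by (auto simp: \<phi>_def)
  then show "\<exists>h\<in>F. \<exists>\<A>. e < \<bar>measure_pmf.prob \<mu> {W. t h ` W \<in> \<A>} - measure_pmf.prob \<mu> \<A>\<bar>"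
    using h(1) by (auto simp: vimage_def not_le)
qed

end

section \<open>An invariant choice of one cluster\<close>

text \<open>The matrix of an equivalence relation is block diagonal with blocks of ones. The block
  of \<open>x\<close> contributes a perfect square and can be peeled off, which allows induction on
  the number of remaining indices.\<close>

lemma quadratic_form_split:
  fixes u :: "'x \<Rightarrow> real"
  assumes R: "\<And>x y. R x y \<Longrightarrow> R y x" "\<And>x y z. R x y \<Longrightarrow> R y z \<Longrightarrow> R x z" and "finite A"
  shows "(\<Sum>g\<in>A. \<Sum>h\<in>A. u g * u h * of_bool (R g h)) =
    (\<Sum>g\<in>{g\<in>A. R g x}. u g)\<^sup>2 + (\<Sum>g\<in>{g\<in>A. \<not> R g x}. \<Sum>h\<in>{g\<in>A. \<not> R g x}. u g * u h * of_bool (R g h))"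
proof -
  let ?X = "{g\<in>A. R g x}" and ?B = "{g\<in>A. \<not> R g x}"
  let ?f = "\<lambda>g h. u g * u h * of_bool (R g h)"
  have split: "(\<Sum>g\<in>A. k g) = (\<Sum>g\<in>?X. k g) + (\<Sum>g\<in>?B. k g)" for k :: "'x \<Rightarrow> real"
    using assms(3) by (subst sum.union_disjoint[symmetric]) (auto intro: sum.cong)
  have in_in: "R g h" if "g \<in> ?X" "h \<in> ?X" for g h using that R by blast
  have in_out: "\<not> R g h" "\<not> R h g" if "g \<in> ?X" "h \<in> ?B" for g h using that R by blast+
  have "(\<Sum>g\<in>A. \<Sum>h\<in>A. ?f g h) = (\<Sum>g\<in>?X. \<Sum>h\<in>A. ?f g h) + (\<Sum>g\<in>?B. \<Sum>h\<in>A. ?f g h)"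
    by (rule split)
  also have "(\<Sum>g\<in>?X. \<Sum>h\<in>A. ?f g h) = (\<Sum>g\<in>?X. \<Sum>h\<in>?X. u g * u h)"
  proof (rule sum.cong[OF refl])
    fix g assume g: "g \<in> ?X"
    have "(\<Sum>h\<in>?B. ?f g h) = 0" by (rule sum.neutral) (use in_out(1)[OF g] in auto)
    moreover have "(\<Sum>h\<in>?X. ?f g h) = (\<Sum>h\<in>?X. u g * u h)"
      by (rule sum.cong[OF refl]) (use in_in[OF g] in simp)
    ultimately show "(\<Sum>h\<in>A. ?f g h) = (\<Sum>h\<in>?X. u g * u h)" unfolding split[of "?f g"] by linarith
  qed
  also have "\<dots> = (\<Sum>g\<in>?X. u g)\<^sup>2" by (simp add: power2_eq_square sum_product)
  also have "(\<Sum>g\<in>?B. \<Sum>h\<in>A. ?f g h) = (\<Sum>g\<in>?B. \<Sum>h\<in>?B. ?f g h)"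
  proof (rule sum.cong[OF refl])
    fix g assume g: "g \<in> ?B"
    have "(\<Sum>h\<in>?X. ?f g h) = 0" by (rule sum.neutral) (use in_out(2)[OF _ g] in auto)
    then show "(\<Sum>h\<in>A. ?f g h) = (\<Sum>h\<in>?B. ?f g h)" unfolding split[of "?f g"] by linarith
  qed
  finally show ?thesis .
qed

lemma quadratic_form_nonneg:
  fixes u :: "'x \<Rightarrow> real"
  assumes R: "\<And>x. R x x" "\<And>x y. R x y \<Longrightarrow> R y x" "\<And>x y z. R x y \<Longrightarrow> R y z \<Longrightarrow> R x z" and "finite A"
  shows "0 \<le> (\<Sum>g\<in>A. \<Sum>h\<in>A. u g * u h * of_bool (R g h))"
  using assms(4)
proof (induction A rule: finite_psubset_induct)
  case (psubset A)
  show ?case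
  proof (cases "A = {}")
    case False
    then obtain x where x: "x \<in> A" by auto
    have "{g\<in>A. \<not> R g x} \<subset> A" using x R(1)[of x] by auto
    from psubset.IH[OF this] show ?thesis
      by (subst quadratic_form_split[where R = R and x = x, OF R(2,3) psubset.hyps(1)]; simp)
  qed simp
qed

text \<open>The square on the left is the block of \<open>x\<close>, and the other blocks contribute
  nonnegative amounts. In Hilbert space terms, one coordinate is bounded by the norm.\<close>

lemma quadratic_form_ge:
  fixes u :: "'x \<Rightarrow> real"
  assumes R: "\<And>x. R x x" "\<And>x y. R x y \<Longrightarrow> R y x" "\<And>x y z. R x y \<Longrightarrow> R y z \<Longrightarrow> R x z" and A: "finite A"
  shows "(\<Sum>g\<in>A. u g * of_bool (R g x))\<^sup>2 \<le> (\<Sum>g\<in>A. \<Sum>h\<in>A. u g * u h * of_bool (R g h))"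
proof -
  have "(\<Sum>g\<in>A. u g * of_bool (R g x)) = (\<Sum>g\<in>A. if R g x then u g else 0)"
    by (rule sum.cong) auto
  also have "\<dots> = (\<Sum>g\<in>{g\<in>A. R g x}. u g)" using A by (rule sum.inter_filter[symmetric])
  finally show ?thesis
    using quadratic_form_split[where R = R and u = u and x = x, OF R(2,3) A]
      quadratic_form_nonneg[where R = R and u = u and A = "{g\<in>A. \<not> R g x}", OF R] A by simp
qed

section \<open>Convex combinations of random classes\<close>

context percolation
begin

definition supp :: "('a \<Rightarrow> real) \<Rightarrow> 'a set" where
  "supp w = {x. w x \<noteq> 0}"

text \<open>A weight \<open>w\<close> stands for the random vector that sums \<open>w g\<close>
  times the unit vector of the class of \<open>g\<close>; so \<open>weights\<close> parametrises the
  convex hull of the translates of the class of \<one>, and \<open>mass w c x\<close> is the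
  coordinate at the class of \<open>x\<close>.\<close>

definition weights :: "('a \<Rightarrow> real) set" where
  "weights = {w. finite (supp w) \<and> supp w \<subseteq> V \<and> (\<forall>x. 0 \<le> w x) \<and> (\<Sum>x\<in>supp w. w x) = 1}"

definition mass :: "('a \<Rightarrow> real) \<Rightarrow> ('a set \<times> nat \<Rightarrow> bool) \<Rightarrow> 'a \<Rightarrow> real" where
  "mass w c x = (\<Sum>g\<in>supp w. w g * of_bool (rel c g x))"

text \<open>The expected squared norm of that vector, since \<open>1 - d g h\<close> is the
  probability that \<open>g\<close> and \<open>h\<close> lie in one class.\<close>

definition energy :: "('a \<Rightarrow> real) \<Rightarrow> real" where
  "energy w = (\<Sum>g\<in>supp w. \<Sum>h\<in>supp w. w g * w h * (1 - d g h))"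

lemma weightsD:
  assumes "w \<in> weights"
  shows "finite (supp w)" "supp w \<subseteq> V" "0 \<le> w x" "(\<Sum>x\<in>supp w. w x) = 1" "x \<notin> supp w \<Longrightarrow> w x = 0"
  using assms by (auto simp: weights_def supp_def)

lemma sum_supp:
  assumes "finite A" "supp w \<subseteq> A"
  shows "(\<Sum>x\<in>supp w. w x * f x) = (\<Sum>x\<in>A. w x * f x)"
  using assms by (intro sum.mono_neutral_left) (auto simp: supp_def)

lemma mass_eq: "finite A \<Longrightarrow> supp w \<subseteq> A \<Longrightarrow> mass w c x = (\<Sum>g\<in>A. w g * of_bool (rel c g x))"
  unfolding mass_def by (rule sum_supp)

lemma energy_eq: "finite A \<Longrightarrow> supp w \<subseteq> A \<Longrightarrow> energy w = (\<Sum>g\<in>A. \<Sum>h\<in>A. w g * w h * (1 - d g h))"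
  unfolding energy_def mult.assoc sum_distrib_left[symmetric] by (simp only: sum_supp)

lemma mass_bounds: "w \<in> weights \<Longrightarrow> 0 \<le> mass w c x" "w \<in> weights \<Longrightarrow> mass w c x \<le> 1"
proof -
  assume w: "w \<in> weights"
  show "0 \<le> mass w c x" unfolding mass_def using weightsD(3)[OF w] by (intro sum_nonneg) simp
  have "mass w c x \<le> (\<Sum>g\<in>supp w. w g)" unfolding mass_def using weightsD(3)[OF w] by (intro sum_mono) simp
  then show "mass w c x \<le> 1" using weightsD(4)[OF w] by simp
qed

text \<open>Different classes collect disjoint parts of a total weight 1. This is why at most one
  class can have mass above \<open>1 / 2\<close>.\<close>

lemma mass_unrelated:
  assumes "w \<in> weights" "\<not> rel c x y"
  shows "mass w c x + mass w c y \<le> 1"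
proof -
  have "mass w c x + mass w c y = (\<Sum>g\<in>supp w. w g * (of_bool (rel c g x) + of_bool (rel c g y)))"
    by (simp add: mass_def sum.distrib distrib_left)
  also have "\<dots> \<le> (\<Sum>g\<in>supp w. w g * 1)"
  proof (intro sum_mono mult_left_mono weightsD(3)[OF assms(1)])
    fix g
    have "\<not> (rel c g x \<and> rel c g y)" using assms(2) rel_sym rel_trans by meson
    then show "of_bool (rel c g x) + of_bool (rel c g y) \<le> (1::real)" by auto
  qed
  also have "\<dots> = 1" using weightsD(4)[OF assms(1)] by simp
  finally show ?thesis .
qed

lemma measurable_mass[measurable]: "w \<in> weights \<Longrightarrow> x \<in> V \<Longrightarrow> (\<lambda>c. mass w c x) \<in> borel_measurable \<Omega>"
  unfolding mass_def
  by (intro borel_measurable_sum borel_measurable_times borel_measurable_const measurable_compose[OF pred_rel])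
    (auto dest: weightsD(2))

lemma integrable_rel: "x \<in> V \<Longrightarrow> y \<in> V \<Longrightarrow> integrable \<Omega> (\<lambda>c. of_bool (rel c x y) :: real)"
  by (intro P.integrable_const_bound[where B = 1] measurable_compose[OF pred_rel]) auto

lemma integral_rel:
  assumes "x \<in> V" "y \<in> V"
  shows "(\<integral>c. of_bool (rel c x y) \<partial>\<Omega>) = 1 - d x y"
proof -
  have "(\<integral>c. of_bool (rel c x y) \<partial>\<Omega>) = (\<integral>c. indicator {c\<in>space \<Omega>. rel c x y} c \<partial>\<Omega>)"
    by (intro Bochner_Integration.integral_cong) (auto simp: indicator_def)
  also have "\<dots> = \<P>(c in \<Omega>. rel c x y)" using assms by simp
  finally show ?thesis using prob_rel[OF assms] by simp
qed

lemma expectation_mass: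
  assumes "w \<in> weights" "x \<in> V"
  shows "(\<integral>c. mass w c x \<partial>\<Omega>) = (\<Sum>g\<in>supp w. w g * (1 - d g x))"
proof -
  have "g \<in> V" if "g \<in> supp w" for g using that weightsD(2)[OF assms(1)] by auto
  then show ?thesis
    unfolding mass_def using assms(2)
    by (simp add: integral_sum integrable_rel integral_rel)
qed

lemma midpoint_weights:
  assumes "w \<in> weights" "w' \<in> weights"
  shows "(\<lambda>x. (w x + w' x) / 2) \<in> weights"
proof -
  let ?m = "\<lambda>x. (w x + w' x) / 2"
  have "supp ?m = supp w \<union> supp w'"
  proof -
    have "w x + w' x = 0 \<longleftrightarrow> w x = 0 \<and> w' x = 0" for x
      using weightsD(3)[OF assms(1), of x] weightsD(3)[OF assms(2), of x] by linarith
    then show ?thesis by (auto simp: supp_def)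
  qed
  moreover have "(\<Sum>x\<in>supp w \<union> supp w'. ?m x) = 1"
  proof -
    let ?A = "supp w \<union> supp w'"
    have A: "finite ?A" using assms weightsD(1) by simp
    have "(\<Sum>x\<in>?A. w x) = 1" "(\<Sum>x\<in>?A. w' x) = 1"
      using sum_supp[OF A, of w "\<lambda>_. 1"] sum_supp[OF A, of w' "\<lambda>_. 1"]
        weightsD(4)[OF assms(1)] weightsD(4)[OF assms(2)] by simp_all
    then show ?thesis by (simp add: sum_divide_distrib[symmetric] sum.distrib)
  qed
  ultimately show ?thesis
    using assms by (auto simp: weights_def)
qed

text \<open>The parallelogram identity of the Hilbert space in which \<open>energy\<close> is the squared norm.\<close>

lemma mass_diff_sq_le:
  assumes w: "w \<in> weights" "w' \<in> weights" and "x \<in> V" and m: "\<And>v. v \<in> weights \<Longrightarrow> m \<le> energy v"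
  shows "(\<integral>c. (mass w c x - mass w' c x)\<^sup>2 \<partial>\<Omega>) \<le> 2 * (energy w - m) + 2 * (energy w' - m)"
proof -
  define A where "A = supp w \<union> supp w'"
  have A: "finite A" "A \<subseteq> V" "supp w \<subseteq> A" "supp w' \<subseteq> A"
    using weightsD(1,2)[OF w(1)] weightsD(1,2)[OF w(2)] by (auto simp: A_def)
  \<comment> \<open>The midpoint is again a weight, so its energy is at least \<open>m\<close>; this
    lower bound is what forces two near-minimisers to be close.\<close>
  define v where "v x = (w x + w' x) / 2" for x
  have v: "v \<in> weights" unfolding v_def using w by (rule midpoint_weights)
  have vA: "supp v \<subseteq> A" by (auto simp: A_def supp_def v_def)
  define u where "u x = w x - w' x" for x
  define q where "q c = (\<Sum>g\<in>A. \<Sum>h\<in>A. u g * u h * of_bool (rel c g h))" for c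
  have int: "integrable \<Omega> (\<lambda>c. u g * u h * of_bool (rel c g h))" if "g \<in> A" "h \<in> A" for g h
    using that A(2) by (intro integrable_mult_right integrable_rel) auto
  have "mass w c x - mass w' c x = (\<Sum>g\<in>A. u g * of_bool (rel c g x))" for c
    unfolding mass_eq[OF A(1,3)] mass_eq[OF A(1,4)] u_def by (simp add: sum_subtractf left_diff_distrib)
  then have le: "(mass w c x - mass w' c x)\<^sup>2 \<le> q c" for c
    unfolding q_def using A(1) by (simp only:) (rule quadratic_form_ge[where R = "rel c", OF rel_refl rel_sym rel_trans])
  have "(\<integral>c. (mass w c x - mass w' c x)\<^sup>2 \<partial>\<Omega>) \<le> (\<integral>c. q c \<partial>\<Omega>)"
  proof (rule integral_mono')
    show "integrable \<Omega> q" unfolding q_def by (intro Bochner_Integration.integrable_sum int)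
  qed (use le in \<open>auto intro: order_trans[OF zero_le_power2 le]\<close>)
  also have "(\<integral>c. q c \<partial>\<Omega>) = (\<Sum>g\<in>A. \<integral>c. (\<Sum>h\<in>A. u g * u h * of_bool (rel c g h)) \<partial>\<Omega>)"
    unfolding q_def by (intro Bochner_Integration.integral_sum Bochner_Integration.integrable_sum int)
  also have "\<dots> = (\<Sum>g\<in>A. \<Sum>h\<in>A. \<integral>c. u g * u h * of_bool (rel c g h) \<partial>\<Omega>)"
    by (intro sum.cong refl Bochner_Integration.integral_sum int)
  also have "\<dots> = (\<Sum>g\<in>A. \<Sum>h\<in>A. u g * u h * (1 - d g h))"
    using A(2) by (intro sum.cong refl) (simp add: integral_rel subset_iff)
  also have "\<dots> = (\<Sum>g\<in>A. \<Sum>h\<in>A. 2 * (w g * w h * (1 - d g h)) + 2 * (w' g * w' h * (1 - d g h)) -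
      4 * (v g * v h * (1 - d g h)))"
    by (intro sum.cong refl) (simp add: u_def v_def field_simps)
  also have "\<dots> = 2 * energy w + 2 * energy w' - 4 * energy v"
    unfolding energy_eq[OF A(1,3)] energy_eq[OF A(1,4)] energy_eq[OF A(1) vA]
    by (simp add: sum.distrib sum_subtractf sum_distrib_left)
  also have "\<dots> \<le> 2 * (energy w - m) + 2 * (energy w' - m)" using m[OF v] by (simp add: algebra_simps)
  finally show ?thesis .
qed

definition translate :: "'a \<Rightarrow> ('a \<Rightarrow> real) \<Rightarrow> 'a \<Rightarrow> real" where
  "translate g w x = (if x \<in> V then w (inv g \<otimes> x) else 0)"

lemma supp_translate:
  assumes "w \<in> weights" "g \<in> V"
  shows "supp (translate g w) = (\<lambda>x. g \<otimes> x) ` supp w" "inj_on (\<lambda>x. g \<otimes> x) (supp w)"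
    "x \<in> supp w \<Longrightarrow> translate g w (g \<otimes> x) = w x"
proof -
  note V = weightsD(2)[OF assms(1)]
  show "inj_on (\<lambda>x. g \<otimes> x) (supp w)"
    using V assms(2) by (intro inj_onI) (metis inv_mult_cancel(1) subsetD)
  show *: "translate g w (g \<otimes> x) = w x" if "x \<in> supp w" for x
    using that V assms(2) by (auto simp: translate_def inv_mult_cancel)
  show "supp (translate g w) = (\<lambda>x. g \<otimes> x) ` supp w"
  proof (intro equalityI subsetI)
    fix y assume "y \<in> supp (translate g w)"
    then have y: "y \<in> V" "inv g \<otimes> y \<in> supp w" by (auto simp: supp_def translate_def split: if_splits)
    then show "y \<in> (\<lambda>x. g \<otimes> x) ` supp w"
      using assms(2) by (intro image_eqI[of _ _ "inv g \<otimes> y"]) (auto simp: inv_mult_cancel)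
  next
    fix y assume "y \<in> (\<lambda>x. g \<otimes> x) ` supp w"
    then obtain x where "x \<in> supp w" "y = g \<otimes> x" by blast
    then show "y \<in> supp (translate g w)" using *[of x] by (simp add: supp_def)
  qed
qed

lemma sum_translate:
  assumes "w \<in> weights" "g \<in> V"
  shows "(\<Sum>x\<in>supp (translate g w). translate g w x * f x) = (\<Sum>x\<in>supp w. w x * f (g \<otimes> x))"
  unfolding supp_translate(1)[OF assms] using supp_translate(2,3)[OF assms]
  by (subst sum.reindex) auto

lemma translate_weights:
  assumes "w \<in> weights" "g \<in> V"
  shows "translate g w \<in> weights"
  unfolding weights_def
proof (intro CollectI conjI allI)
  show "finite (supp (translate g w))" "supp (translate g w) \<subseteq> V"
    using supp_translate(1)[OF assms] weightsD(1,2)[OF assms(1)] assms(2) by auto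
  show "0 \<le> translate g w x" for x using weightsD(3)[OF assms(1)] by (simp add: translate_def)
  show "(\<Sum>x\<in>supp (translate g w). translate g w x) = 1"
    using sum_translate[OF assms, of "\<lambda>_. 1"] weightsD(4)[OF assms(1)] by simp
qed

lemma energy_translate:
  assumes "w \<in> weights" "g \<in> V"
  shows "energy (translate g w) = energy w"
proof -
  note V = weightsD(2)[OF assms(1)]
  have "energy (translate g w) =
      (\<Sum>x\<in>supp w. w x * (\<Sum>y\<in>supp w. w y * (1 - d (g \<otimes> x) (g \<otimes> y))))"
    unfolding energy_def mult.assoc sum_distrib_left[symmetric] by (simp only: sum_translate[OF assms])
  also have "\<dots> = (\<Sum>x\<in>supp w. w x * (\<Sum>y\<in>supp w. w y * (1 - d x y)))"
    using V assms(2) by (intro sum.cong refl arg_cong2[where f = times]) (auto simp: d_act subset_iff)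
  finally show ?thesis unfolding energy_def mult.assoc sum_distrib_left[symmetric] .
qed

lemma mass_act:
  assumes "w \<in> weights" "g \<in> V" "x \<in> V"
  shows "mass w (act g c) x = mass (translate g w) c (g \<otimes> x)"
  unfolding mass_def sum_translate[OF assms(1,2)] using assms weightsD(2)[OF assms(1)]
  by (intro sum.cong refl) (auto simp: rel_act subset_iff)

end

lemma convergent_if_geometric_differences:
  fixes a :: "nat \<Rightarrow> real"
  assumes "\<forall>\<^sub>F n in sequentially. (a n - a (Suc n))\<^sup>2 < (1 / 4) ^ n"
  shows "convergent a"
proof -
  have "summable (\<lambda>n. a (Suc n) - a n)"
  proof (rule summable_comparison_test_ev)
    show "\<forall>\<^sub>F n in sequentially. norm (a (Suc n) - a n) \<le> (1 / 2) ^ n"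
      using assms
    proof (rule eventually_mono)
      fix n assume "(a n - a (Suc n))\<^sup>2 < (1 / 4) ^ n"
      also have "(1 / 4 :: real) ^ n = ((1 / 2) ^ n)\<^sup>2" by (simp add: power2_eq_square power_mult_distrib[symmetric])
      finally have "\<bar>a n - a (Suc n)\<bar> < (1 / 2) ^ n" by (intro power2_less_imp_less[of "\<bar>a n - a (Suc n)\<bar>"]) simp_all
      then show "norm (a (Suc n) - a n) \<le> (1 / 2) ^ n" by (simp add: abs_minus_commute)
    qed
  qed (simp add: summable_geometric)
  then have "convergent (\<lambda>n. \<Sum>k<n. a (Suc k) - a k)" by (simp add: summable_iff_convergent)
  then have "convergent (\<lambda>n. a n - a 0)" by (simp only: sum_lessThan_telescope)
  then have "convergent (\<lambda>n. a n - a 0 + a 0)" by (intro convergent_add convergent_const)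
  then show ?thesis by simp
qed

lemma tendsto_zero_if_geometric:
  fixes a b :: "nat \<Rightarrow> real"
  assumes "\<forall>\<^sub>F n in sequentially. (a n - b n)\<^sup>2 < (1 / 4) ^ n"
  shows "(\<lambda>n. b n - a n) \<longlonglongrightarrow> 0"
proof (rule Lim_null_comparison)
  show "\<forall>\<^sub>F n in sequentially. norm (b n - a n) \<le> sqrt ((1 / 4) ^ n)"
    using assms by (rule eventually_mono) (metis abs_minus_commute less_imp_le real_norm_def real_sqrt_abs real_sqrt_le_iff)
  have "(\<lambda>n. (1 / 4 :: real) ^ n) \<longlonglongrightarrow> 0" by (intro LIMSEQ_power_zero) simp
  then show "(\<lambda>n. sqrt ((1 / 4) ^ n)) \<longlonglongrightarrow> 0" using tendsto_real_sqrt by fastforce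
qed

section \<open>The minimal vector and its heavy class\<close>

context percolation
begin

text \<open>Two near-minimisers differ by at most \<open>(1 / 16) ^ n\<close> in mean square.
  Markov's inequality at level \<open>(1 / 4) ^ n\<close> leaves exceptional probabilities
  \<open>(1 / 4) ^ n\<close>, which Borel-Cantelli sums.\<close>

lemma AE_mass_close:
  assumes w: "\<And>n. w n \<in> weights" "\<And>n. energy (w n) - m \<le> (1 / 16) ^ n / 4"
    and v: "\<And>n. v n \<in> weights" "\<And>n. energy (v n) - m \<le> (1 / 16) ^ n / 4"
    and m: "\<And>u. u \<in> weights \<Longrightarrow> m \<le> energy u" and x: "x \<in> V"
  shows "AE c in \<Omega>. \<forall>\<^sub>F n in sequentially. (mass (w n) c x - mass (v n) c x)\<^sup>2 < (1 / 4) ^ n"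
proof -
  let ?f = "\<lambda>n c. (mass (w n) c x - mass (v n) c x)\<^sup>2"
  let ?A = "\<lambda>n. {c\<in>space \<Omega>. (1 / 4) ^ n \<le> ?f n c}"
  note [measurable] = measurable_mass[OF w(1) x] measurable_mass[OF v(1) x]
  have le1: "?f n c \<le> 1" for n c
  proof -
    have "\<bar>mass (w n) c x - mass (v n) c x\<bar> \<le> 1"
      using mass_bounds[OF w(1)[of n], of c x] mass_bounds[OF v(1)[of n], of c x] by linarith
    then show ?thesis by (simp add: abs_square_le_1)
  qed
  have A: "?A n \<in> P.events" for n by measurable
  have prob_A: "P.prob (?A n) \<le> (1 / 4) ^ n" for n
  proof -
    have int: "integrable \<Omega> (?f n)"
      by (intro P.integrable_const_bound[where B = 1]) (auto simp: le1)
    have "P.prob (?A n) \<le> (\<integral>c. ?f n c \<partial>\<Omega>) / (1 / 4) ^ n"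
      by (rule integral_Markov_inequality_measure[OF int sets.empty_sets]) auto
    also have "\<dots> \<le> (1 / 16) ^ n / (1 / 4) ^ n"
    proof (intro divide_right_mono)
      have "(\<integral>c. ?f n c \<partial>\<Omega>) \<le> 2 * (energy (w n) - m) + 2 * (energy (v n) - m)"
        by (intro mass_diff_sq_le w v m x)
      also have "\<dots> \<le> (1 / 16) ^ n" using w(2)[of n] v(2)[of n] by simp
      finally show "(\<integral>c. ?f n c \<partial>\<Omega>) \<le> (1 / 16) ^ n" .
    qed simp
    also have "(1 / 16 :: real) ^ n / (1 / 4) ^ n = (1 / 4) ^ n"
    proof -
      have "(1 / 16 :: real) ^ n = (1 / 4) ^ n * (1 / 4) ^ n" by (simp add: power_mult_distrib[symmetric])
      then show ?thesis by simp
    qed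
    finally show ?thesis .
  qed
  have "summable (\<lambda>n. P.prob (?A n))"
    by (rule summable_comparison_test'[of "\<lambda>n. (1 / 4) ^ n" 0]) (auto simp: prob_A summable_geometric)
  from borel_cantelli_AE1[OF A _ this]
  have "AE c in \<Omega>. \<forall>\<^sub>F n in sequentially. c \<in> space \<Omega> - ?A n" by (simp add: P.emeasure_eq_measure)
  then show ?thesis
    by (rule AE_mp, intro AE_I2 impI) (erule eventually_mono, auto simp: not_le)
qed

text \<open>A minimising sequence converges almost surely in every coordinate. Its limit
  \<open>z\<close> is equivariant because translates of the sequence are again minimising and merge
  with it. The expected mass at \<one> is at least \<open>3 / 4\<close>, so a class of mass above
  \<open>1 / 2\<close> exists with positive probability, and the spectral gap raises this to 1. The
  last conjunct records that only layers 0 and 1 were consulted, so that layer 2 remains available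
  for restoring edges.\<close>

lemma heavy_class:
  assumes unif: "\<forall>g\<in>V. d \<one> g < 1 / 4" and F: "F \<subseteq> V"
    and gap: "\<forall>D\<in>P.events.
      P.prob D * (1 - P.prob D) \<le> C * (\<Sum>h\<in>F. P.prob (sym_diff D (act h -` D \<inter> space \<Omega>)))"
  shows "\<exists>hv. (\<forall>x\<in>V. Measurable.pred \<Omega> (\<lambda>c. hv c x)) \<and>
    (AE c in \<Omega>. \<forall>x\<in>V. \<forall>y\<in>V. hv c x \<longrightarrow> hv c y \<longrightarrow> rel c x y) \<and>
    (AE c in \<Omega>. \<exists>x\<in>V. hv c x) \<and>
    (\<forall>g\<in>V. AE c in \<Omega>. \<forall>x\<in>V. hv (act g c) x \<longleftrightarrow> hv c (g \<otimes> x)) \<and>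
    (\<forall>c c'. O\<^sub>0 c = O\<^sub>0 c' \<longrightarrow> O\<^sub>1 c = O\<^sub>1 c' \<longrightarrow> hv c = hv c')"
proof -
  have d_lt: "d x y < 1 / 4" if "x \<in> V" "y \<in> V" for x y
    using bspec[OF unif, of "inv x \<otimes> y"] d_act[of x \<one> "inv x \<otimes> y"] that by (simp add: inv_mult_cancel)
  define m where "m = Inf (energy ` weights)"
  have d_le1: "d x y \<le> 1" for x y by (simp add: d_def)
  have "0 \<le> energy u" if "u \<in> weights" for u
    unfolding energy_def using weightsD(3)[OF that] d_le1 by (intro sum_nonneg mult_nonneg_nonneg) auto
  then have bdd: "bdd_below (energy ` weights)" by (intro bdd_belowI[of _ 0]) auto
  then have m: "m \<le> energy u" if "u \<in> weights" for u
    unfolding m_def using that by (intro cInf_lower) auto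
  have "supp (\<lambda>x. of_bool (x = \<one>)) = {\<one>}" by (auto simp: supp_def)
  then have "(\<lambda>x. of_bool (x = \<one>)) \<in> weights" by (simp add: weights_def)
  then have ne: "energy ` weights \<noteq> {}" by blast
  have "\<exists>u\<in>weights. energy u < m + (1 / 16) ^ n / 4" for n
    using cInf_lessD[OF ne, of "m + (1 / 16) ^ n / 4"] by (auto simp: m_def)
  then obtain w where w: "\<And>n. w n \<in> weights" "\<And>n. energy (w n) < m + (1 / 16) ^ n / 4" by metis
  have en: "energy (w n) - m \<le> (1 / 16) ^ n / 4" for n using w(2)[of n] by simp
  have en_Suc: "energy (w (Suc n)) - m \<le> (1 / 16) ^ n / 4" for n
  proof -
    have "(1 / 16 :: real) ^ Suc n \<le> (1 / 16) ^ n" by (rule power_decreasing) auto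
    then show ?thesis using en[of "Suc n"] by linarith
  qed
  have conv: "AE c in \<Omega>. \<forall>x\<in>V. convergent (\<lambda>n. mass (w n) c x)"
  proof (intro AE_ball_countable' countable_V)
    fix x assume "x \<in> V"
    then have "AE c in \<Omega>. \<forall>\<^sub>F n in sequentially. (mass (w n) c x - mass (w (Suc n)) c x)\<^sup>2 < (1 / 4) ^ n"
      by (intro AE_mass_close[OF w(1) en w(1) en_Suc] m)
    then show "AE c in \<Omega>. convergent (\<lambda>n. mass (w n) c x)"
      by (rule AE_mp, intro AE_I2 impI) (rule convergent_if_geometric_differences)
  qed
  \<comment> \<open>Where the sequence diverges, \<open>Lim\<close> is an unspecified value; for
    vertices this happens on a null set only.\<close>
  define z where "z c x = Lim sequentially (\<lambda>n. mass (w n) c x)" for c x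
  have z_meas[measurable]: "(\<lambda>c. z c x) \<in> borel_measurable \<Omega>" if "x \<in> V" for x
    unfolding z_def using that by (intro borel_measurable_lim_metric measurable_mass w)
  have z_lim: "(\<lambda>n. mass (w n) c x) \<longlonglongrightarrow> z c x" if "convergent (\<lambda>n. mass (w n) c x)" for c x
    using that by (simp add: z_def convergent_LIMSEQ_iff)
  define hv where "hv c x \<longleftrightarrow> 1 / 2 < z c x" for c x
  have hv1: "Measurable.pred \<Omega> (\<lambda>c. hv c x)" if "x \<in> V" for x
    unfolding hv_def using that by measurable
  have hv3: "AE c in \<Omega>. \<forall>x\<in>V. \<forall>y\<in>V. hv c x \<longrightarrow> hv c y \<longrightarrow> rel c x y"
    using conv
  proof (rule AE_mp, intro AE_I2 impI ballI)
    fix c x y assume *: "\<forall>x\<in>V. convergent (\<lambda>n. mass (w n) c x)" "x \<in> V" "y \<in> V" "hv c x" "hv c y"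
    show "rel c x y"
    proof (rule ccontr)
      assume "\<not> rel c x y"
      have "(\<lambda>n. mass (w n) c x + mass (w n) c y) \<longlonglongrightarrow> z c x + z c y"
        using * by (intro tendsto_add z_lim) auto
      then have "z c x + z c y \<le> 1"
        by (rule LIMSEQ_le_const2) (use mass_unrelated[OF w(1) \<open>\<not> rel c x y\<close>] in auto)
      then show False using * by (simp add: hv_def)
    qed
  qed
  have hv5: "AE c in \<Omega>. \<forall>x\<in>V. hv (act g c) x \<longleftrightarrow> hv c (g \<otimes> x)" if g: "g \<in> V" for g
  proof -
    have en': "energy (translate g (w n)) - m \<le> (1 / 16) ^ n / 4" for n
      using en[of n] g by (simp only: energy_translate[OF w(1)])
    have close: "AE c in \<Omega>. \<forall>x\<in>V. \<forall>\<^sub>F n in sequentially.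
        (mass (w n) c (g \<otimes> x) - mass (translate g (w n)) c (g \<otimes> x))\<^sup>2 < (1 / 4) ^ n"
      using g by (intro AE_ball_countable' countable_V AE_mass_close[OF w(1) en] translate_weights w m en') auto
    show ?thesis
      using conv close
    proof (eventually_elim, intro ballI)
      fix c x assume *: "\<forall>x\<in>V. convergent (\<lambda>n. mass (w n) c x)" "\<forall>x\<in>V. \<forall>\<^sub>F n in sequentially.
        (mass (w n) c (g \<otimes> x) - mass (translate g (w n)) c (g \<otimes> x))\<^sup>2 < (1 / 4) ^ n" and x: "x \<in> V"
      have "(\<lambda>n. mass (w n) c (g \<otimes> x)) \<longlonglongrightarrow> z c (g \<otimes> x)" using * x g by (intro z_lim) auto
      moreover have "(\<lambda>n. mass (translate g (w n)) c (g \<otimes> x) - mass (w n) c (g \<otimes> x)) \<longlonglongrightarrow> 0"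
        using * x by (intro tendsto_zero_if_geometric) auto
      ultimately have "(\<lambda>n. mass (translate g (w n)) c (g \<otimes> x)) \<longlonglongrightarrow> z c (g \<otimes> x)"
        using tendsto_add by fastforce
      then have "z (act g c) x = z c (g \<otimes> x)"
        unfolding z_def[of "act g c"] mass_act[OF w(1) g x] by (rule limI)
      then show "hv (act g c) x \<longleftrightarrow> hv c (g \<otimes> x)" by (simp add: hv_def)
    qed
  qed
  define B where "B = {c\<in>space \<Omega>. \<exists>x\<in>V. hv c x}"
  have B: "B \<in> P.events"
    using pred_Bex_countable[OF countable_V hv1, of "\<lambda>x. x"] by (simp add: B_def pred_def)
  have "0 < P.prob B"
  proof (rule ccontr)
    assume "\<not> 0 < P.prob B"
    then have "P.prob B = 0" by (simp add: zero_less_measure_iff)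
    then have "AE c in \<Omega>. c \<notin> B" using B by (simp add: P.prob_eq_0)
    then have AE_le: "AE c in \<Omega>. z c \<one> \<le> 1 / 2"
      by (rule AE_mp, intro AE_I2 impI) (auto simp: B_def hv_def not_less)
    have "(\<lambda>n. \<integral>c. mass (w n) c \<one> \<partial>\<Omega>) \<longlonglongrightarrow> (\<integral>c. z c \<one> \<partial>\<Omega>)"
    proof (rule integral_dominated_convergence[where w = "\<lambda>_. 1"])
      show "AE c in \<Omega>. (\<lambda>n. mass (w n) c \<one>) \<longlonglongrightarrow> z c \<one>"
        using conv by (rule AE_mp, intro AE_I2 impI z_lim) auto
    qed (auto intro!: measurable_mass z_meas w simp: abs_le_iff mass_bounds[OF w(1)]
        intro: order_trans[OF _ mass_bounds(1)[OF w(1)]])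
    then have "3 / 4 \<le> (\<integral>c. z c \<one> \<partial>\<Omega>)"
    proof (rule LIMSEQ_le_const, intro exI allI impI)
      fix n
      have "3 / 4 = (\<Sum>g\<in>supp (w n). w n g * (3 / 4))"
        using weightsD(4)[OF w(1)[of n]] by (simp only: sum_distrib_right[symmetric] mult_1_left)
      also have "\<dots> \<le> (\<Sum>g\<in>supp (w n). w n g * (1 - d g \<one>))"
      proof (intro sum_mono mult_left_mono weightsD(3)[OF w(1)])
        fix g assume "g \<in> supp (w n)"
        then have "g \<in> V" using weightsD(2)[OF w(1)] by auto
        then show "3 / 4 \<le> 1 - d g \<one>" using d_lt[of g \<one>] by simp
      qed
      finally show "3 / 4 \<le> (\<integral>c. mass (w n) c \<one> \<partial>\<Omega>)" using expectation_mass[OF w(1)] by simp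
    qed
    moreover have "(\<integral>c. z c \<one> \<partial>\<Omega>) \<le> 1 / 2"
    \<comment> \<open>A non-integrable function has integral 0 by convention, so this case satisfies
      the bound as well.\<close>
    proof (cases "integrable \<Omega> (\<lambda>c. z c \<one>)")
      case True
      then have "(\<integral>c. z c \<one> \<partial>\<Omega>) \<le> (\<integral>c. 1 / 2 \<partial>\<Omega>)" using AE_le by (intro integral_mono_AE) auto
      then show ?thesis by (simp add: P.prob_space)
    qed (simp add: not_integrable_integral_eq)
    ultimately show False by simp
  qed
  \<comment> \<open>Equivariance makes \<open>B\<close> invariant up to null sets under
    \<open>F\<close>, and the gap inequality then leaves only the probabilities 0 and 1.\<close>
  moreover have "P.prob B * (1 - P.prob B) \<le> 0"
  proof -
    have "P.prob (sym_diff B (act h -` B \<inter> space \<Omega>)) = 0" if "h \<in> F" for h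
    proof -
      have h: "h \<in> V" using that F by auto
      have [measurable]: "act h \<in> measurable \<Omega> \<Omega>" by (rule shift.measurable_act[OF shift_t[OF h]])
      have "AE c in \<Omega>. c \<notin> sym_diff B (act h -` B \<inter> space \<Omega>)"
        using hv5[OF h]
      proof (rule AE_mp, intro AE_I2 impI)
        fix c assume c: "c \<in> space \<Omega>" and *: "\<forall>x\<in>V. hv (act h c) x \<longleftrightarrow> hv c (h \<otimes> x)"
        have "(\<exists>x\<in>V. hv (act h c) x) \<longleftrightarrow> (\<exists>x\<in>V. hv c x)"
        proof
          assume "\<exists>x\<in>V. hv (act h c) x" then show "\<exists>x\<in>V. hv c x" using * h by blast
        next
          assume "\<exists>x\<in>V. hv c x"
          then obtain x where "x \<in> V" "hv c x" by blast
          then show "\<exists>x\<in>V. hv (act h c) x"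
            using * h by (intro bexI[of _ "inv h \<otimes> x"]) (auto simp: inv_mult_cancel)
        qed
        then show "c \<notin> sym_diff B (act h -` B \<inter> space \<Omega>)"
          using c measurable_space[of "act h" \<Omega> \<Omega> c] by (auto simp: B_def)
      qed
      moreover have "sym_diff B (act h -` B \<inter> space \<Omega>) \<in> P.events"
        using B by measurable
      ultimately show ?thesis by (simp add: P.prob_eq_0)
    qed
    then show ?thesis using bspec[OF gap B] by simp
  qed
  ultimately have "P.prob B = 1"
    using P.prob_le_1[of B] by (auto simp: mult_le_0_iff)
  then have hv4: "AE c in \<Omega>. \<exists>x\<in>V. hv c x"
    using P.prob_eq_1[OF B] by (auto simp: B_def elim: AE_mp)
  have hv6: "hv c = hv c'" if "O\<^sub>0 c = O\<^sub>0 c'" "O\<^sub>1 c = O\<^sub>1 c'" for c c'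
    using that by (simp add: fun_eq_iff hv_def z_def mass_def rel_def)
  show ?thesis by (intro exI[of _ hv] conjI ballI allI impI) (fact hv3 hv4 | erule hv1 hv5 | rule hv6, assumption+)+
qed

end

section \<open>Mass transport and sprinkling\<close>

text \<open>A greedy choice: the finitely many elements already used lie in only finitely many
  blocks, so an index with a fresh block remains.\<close>

lemma infinite_disjoint_subfamily:
  fixes B :: "'y \<Rightarrow> 'e set"
  assumes "infinite Y" and fin: "\<And>y. y \<in> Y \<Longrightarrow> finite (B y)" and loc: "\<And>e. finite {y\<in>Y. e \<in> B y}"
  obtains \<sigma> :: "nat \<Rightarrow> 'y" where "\<And>i. \<sigma> i \<in> Y" "disjoint_family (\<lambda>i. B (\<sigma> i))"
proof -
  have ex: "\<exists>y. y \<in> Y \<and> B y \<inter> W = {}" if "finite W" for W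
  proof (rule ccontr)
    assume "\<not> ?thesis"
    then have "Y \<subseteq> (\<Union>e\<in>W. {y\<in>Y. e \<in> B y})" by blast
    moreover have "finite (\<Union>e\<in>W. {y\<in>Y. e \<in> B y})" using that loc by (intro finite_UN_I)
    ultimately have "finite Y" by (rule finite_subset)
    with assms(1) show False by contradiction
  qed
  define pick where "pick W = (SOME y. y \<in> Y \<and> B y \<inter> W = {})" for W
  have pick: "pick W \<in> Y \<and> B (pick W) \<inter> W = {}" if "finite W" for W
    unfolding pick_def using ex[OF that] by (rule someI_ex)
  define W where "W = rec_nat {} (\<lambda>_ U. U \<union> B (pick U))"
  have W_Suc: "W (Suc n) = W n \<union> B (pick (W n))" for n by (simp add: W_def)
  have W_fin: "finite (W n)" for n
  proof (induction n)
    case 0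
    show ?case by (simp add: W_def)
  next
    case (Suc n)
    then show ?case using pick fin by (simp add: W_Suc)
  qed
  have W_mono: "W i \<subseteq> W j" if "i \<le> j" for i j
    using that by (rule lift_Suc_mono_le[rotated]) (simp add: W_Suc)
  have disj: "B (pick (W i)) \<inter> B (pick (W j)) = {}" if "i < j" for i j
  proof -
    have "B (pick (W i)) \<subseteq> W j" using W_mono[of "Suc i" j] that by (auto simp: W_Suc)
    moreover have "B (pick (W j)) \<inter> W j = {}" using pick[OF W_fin] by simp
    ultimately show ?thesis by blast
  qed
  show thesis
  proof (rule that[of "\<lambda>i. pick (W i)"])
    show "pick (W i) \<in> Y" for i using pick[OF W_fin] by simp
    show "disjoint_family (\<lambda>i. B (pick (W i)))"
      unfolding disjoint_family_on_def
    proof (intro ballI impI)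
      fix i j :: nat assume "i \<noteq> j"
      then show "B (pick (W i)) \<inter> B (pick (W j)) = {}" using disj[of i j] disj[of j i] by (cases "i < j") auto
    qed
  qed
qed

text \<open>Disjoint blocks are independent, and each is entirely open with probability at least
  \<open>s ^ L\<close>. The first N blocks all fail with probability at most
  \<open>(1 - s ^ L) ^ N\<close>, which tends to 0.\<close>

lemma (in bernoulli) AE_some_block_open:
  fixes B :: "nat \<Rightarrow> 'i set"
  assumes B: "\<And>i. B i \<subseteq> I" "\<And>i. finite (B i)" "\<And>i. card (B i) \<le> L" "disjoint_family B"
    and p: "\<And>i j. j \<in> B i \<Longrightarrow> p j = s" and s: "0 < s" "s \<le> 1"
  shows "AE \<omega> in PiM I Bern. \<exists>i. \<forall>j\<in>B i. \<omega> j"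
proof -
  \<comment> \<open>The indicator that block \<open>i\<close> fails, written with a product so that
    its mean follows from independence.\<close>
  define Y where "Y i \<omega> = 1 - (\<Prod>j\<in>B i. of_bool (\<omega> j) :: real)" for i and \<omega> :: "'i \<Rightarrow> bool"
  have Y_eq: "Y i \<omega> = of_bool (\<not> (\<forall>j\<in>B i. \<omega> j))" for i \<omega>
    using B(2)[of i] by (auto simp: Y_def intro: prod_zero)
  have coord: "(\<lambda>\<omega>. \<omega> j) \<in> measurable (PiM J Bern) (count_space UNIV)" if "j \<in> J" for j J
    using measurable_component_singleton[OF that, of Bern] by (simp add: measurable_pmf_measure2)
  have Y_meas: "Y i \<in> borel_measurable (PiM (B i) Bern)" for i
    unfolding Y_def
    by (intro borel_measurable_diff borel_measurable_const borel_measurable_prod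
        measurable_compose[OF coord]) auto
  have ind: "P.indep_vars (\<lambda>_. borel) (\<lambda>i \<omega>. Y i (restrict \<omega> (B i))) UNIV"
    using B(4) by (intro P.indep_vars_compose2[OF P.indep_vars_restrict[OF indep_vars_coordinates, of UNIV B]] B(1) Y_meas)
  have Y_restrict: "Y i (restrict \<omega> (B i)) = Y i \<omega>" for i \<omega>
    unfolding Y_def by (intro arg_cong2[where f = "(-)"] refl prod.cong) auto
  have "(1 - s ^ L) < 1" using s by simp
  define A where "A N = {\<omega>\<in>space (PiM I Bern). \<forall>i\<in>{..<N}. \<not> (\<forall>j\<in>B i. \<omega> j)}" for N
  have int: "integrable (PiM I Bern) (Y i)" for i
    unfolding Y_def[abs_def] by (intro Bochner_Integration.integrable_diff P.integrable_const integrable_coordinate_prod B)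
  have A_ev: "A N \<in> P.events" for N
  proof -
    have "Measurable.pred (PiM I Bern) (\<lambda>\<omega>. \<omega> j)" if "j \<in> B i" for i j
      using coord[of j I] B(1)[of i] that by auto
    then have "Measurable.pred (PiM I Bern) (\<lambda>\<omega>. \<forall>i\<in>{..<N}. \<not> (\<forall>j\<in>B i. \<omega> j))"
      using B(2) by (intro pred_intros_finite pred_intros_logic) auto
    then show ?thesis unfolding A_def pred_def .
  qed
  have le: "P.prob (A N) \<le> (1 - s ^ L) ^ N" for N
  proof -
    have "P.prob (A N) = (\<integral>\<omega>. indicator (A N) \<omega> \<partial>PiM I Bern)" using A_ev by simp
    also have "\<dots> = (\<integral>\<omega>. (\<Prod>i<N. Y i (restrict \<omega> (B i))) \<partial>PiM I Bern)"
    proof (intro Bochner_Integration.integral_cong refl)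
      fix \<omega> assume \<omega>: "\<omega> \<in> space (PiM I Bern)"
      show "indicator (A N) \<omega> = (\<Prod>i<N. Y i (restrict \<omega> (B i)))"
      proof (cases "\<omega> \<in> A N")
        case True
        then have "(\<Prod>i<N. Y i (restrict \<omega> (B i))) = (\<Prod>i<N. 1)"
          unfolding Y_restrict Y_eq by (intro prod.cong) (auto simp: A_def)
        with True show ?thesis by simp
      next
        case False
        then obtain i where "i < N" "\<forall>j\<in>B i. \<omega> j" using \<omega> by (auto simp: A_def)
        then have "(\<Prod>i<N. Y i (restrict \<omega> (B i))) = 0"
          unfolding Y_restrict Y_eq by (intro prod_zero) auto
        with False show ?thesis by simp
      qed
    qed
    also have "\<dots> = (\<Prod>i<N. \<integral>\<omega>. Y i (restrict \<omega> (B i)) \<partial>PiM I Bern)"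
      using P.indep_vars_subset[OF ind, of "{..<N}"] int
      by (intro P.indep_vars_lebesgue_integral) (auto simp: Y_restrict)
    also have "\<dots> \<le> (\<Prod>i<N. 1 - s ^ L)"
    proof (intro prod_mono conjI)
      fix i
      show "0 \<le> (\<integral>\<omega>. Y i (restrict \<omega> (B i)) \<partial>PiM I Bern)"
        unfolding Y_restrict Y_eq by (intro integral_nonneg_AE) auto
      have "(\<integral>\<omega>. Y i \<omega> \<partial>PiM I Bern) = 1 - (\<Prod>j\<in>B i. p j)"
      proof -
        have "(\<integral>\<omega>. (\<Prod>j\<in>B i. of_bool (\<omega> j) :: real) \<partial>PiM I Bern) = (\<Prod>j\<in>B i. p j)"
          using integrable_coordinate_prod(2)[OF B(2,1), of "\<lambda>_ b. of_bool b" i] by simp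
        moreover have "integrable (PiM I Bern) (\<lambda>\<omega>. \<Prod>j\<in>B i. of_bool (\<omega> j) :: real)"
          by (intro integrable_coordinate_prod B)
        ultimately show ?thesis unfolding Y_def by (simp add: P.prob_space)
      qed
      also have "(\<Prod>j\<in>B i. p j) = s ^ card (B i)" using p by simp
      also have "1 - s ^ card (B i) \<le> 1 - s ^ L" using s B(3)[of i] by (simp add: power_decreasing)
      finally show "(\<integral>\<omega>. Y i (restrict \<omega> (B i)) \<partial>PiM I Bern) \<le> 1 - s ^ L" unfolding Y_restrict .
    qed
    finally show ?thesis by simp
  qed
  have lim: "(\<lambda>N. (1 - s ^ L) ^ N) \<longlonglongrightarrow> 0"
    using s by (intro LIMSEQ_power_zero) (simp add: power_le_one)
  define A' where "A' = {\<omega>\<in>space (PiM I Bern). \<forall>N. \<forall>i<N. \<not> (\<forall>j\<in>B i. \<omega> j)}"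
  have A'_eq: "A' = (\<Inter>N. A N)" by (auto simp: A'_def A_def)
  have A'_ev: "A' \<in> P.events" unfolding A'_eq using A_ev by (intro sets.countable_INT) auto
  have "P.prob A' \<le> (1 - s ^ L) ^ N" for N
    using P.finite_measure_mono[of A' "A N"] A_ev[of N] le[of N] unfolding A'_eq by (auto intro: order_trans)
  then have "P.prob A' \<le> 0" using lim by (intro LIMSEQ_le_const[OF lim]) auto
  then have "P.prob A' = 0" by (simp add: measure_le_0_iff)
  then have "AE \<omega> in PiM I Bern. \<omega> \<notin> A'" using A'_ev by (simp add: P.prob_eq_0)
  then show ?thesis
    by (rule AE_mp, intro AE_I2 impI) (auto simp: A'_def)
qed

section \<open>Paths of bounded length\<close>

context cayley_graph
begin

text \<open>Both distance bounds matter later. Every edge has an endpoint at distance strictly less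
  than \<open>n\<close> from the end \<open>u\<close>, so the path uses only edges that touch the
  smaller neighbourhood; and every edge is near the start \<open>y\<close>, so an edge can serve
  only finitely many starting points.\<close>

lemma path_edges_ex:
  assumes "(y, u) \<in> adj X ^^ n"
  shows "\<exists>B. finite B \<and> card B \<le> n \<and> B \<subseteq> X \<and> conn B y u \<and>
    (\<forall>e\<in>B. \<exists>v\<in>e. \<exists>j<n. (v, u) \<in> adj X ^^ j) \<and> (\<forall>e\<in>B. \<forall>v\<in>e. \<exists>j\<le>n. (y, v) \<in> adj X ^^ j)"
  using assms
proof (induction n arbitrary: y)
  case 0
  then show ?case by (intro exI[of _ "{}"]) auto
next
  case (Suc n)
  then obtain v where v: "(y, v) \<in> adj X" "(v, u) \<in> adj X ^^ n" by (metis relpow_Suc_D2)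
  from Suc.IH[OF v(2)] obtain B where B: "finite B" "card B \<le> n" "B \<subseteq> X" "conn B v u"
    "\<forall>e\<in>B. \<exists>v\<in>e. \<exists>j<n. (v, u) \<in> adj X ^^ j" "\<forall>e\<in>B. \<forall>w\<in>e. \<exists>j\<le>n. (v, w) \<in> adj X ^^ j" by blast
  let ?B = "insert {y, v} B"
  have "finite ?B" "?B \<subseteq> X" using B v by (auto simp: adj_def)
  moreover have "card ?B \<le> Suc n" using B(1,2) by (simp add: card_insert_if)
  moreover have "conn ?B y u"
  proof (rule converse_rtrancl_into_rtrancl)
    show "(y, v) \<in> adj ?B" by (simp add: adj_def)
    show "conn ?B v u" using B(4) by (rule conn_mono) auto
  qed
  moreover have "\<forall>e\<in>?B. \<exists>v\<in>e. \<exists>j<Suc n. (v, u) \<in> adj X ^^ j"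
  proof
    fix e assume "e \<in> ?B"
    then consider "e = {y, v}" | "e \<in> B" by blast
    then show "\<exists>v\<in>e. \<exists>j<Suc n. (v, u) \<in> adj X ^^ j"
    proof cases
      case 1
      then show ?thesis using v(2) by (intro bexI[of _ v] exI[of _ n]) auto
    next
      case 2
      then obtain w j where "w \<in> e" "j < n" "(w, u) \<in> adj X ^^ j" using B(5) by meson
      then show ?thesis by (intro bexI[of _ w] exI[of _ j]) auto
    qed
  qed
  moreover have "\<forall>e\<in>?B. \<forall>w\<in>e. \<exists>j\<le>Suc n. (y, w) \<in> adj X ^^ j"
  proof (intro ballI)
    fix e w assume "e \<in> ?B" "w \<in> e"
    then consider "w = y" | "w = v" | "e \<in> B" "w \<in> e" by blast
    then show "\<exists>j\<le>Suc n. (y, w) \<in> adj X ^^ j"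
    proof cases
      case 1
      then show ?thesis by (intro exI[of _ 0]) auto
    next
      case 2
      then show ?thesis using v(1) by (intro exI[of _ 1]) auto
    next
      case 3
      then obtain j where "j \<le> n" "(v, w) \<in> adj X ^^ j" using B(6) by meson
      then show ?thesis using relpow_Suc_I2[OF v(1)] by (intro exI[of _ "Suc j"]) auto
    qed
  qed
  ultimately show ?case by (intro exI[of _ ?B] conjI)
qed

lemma path_edges:
  assumes "(y, u) \<in> adj X ^^ n"
  obtains B where "finite B" "card B \<le> n" "B \<subseteq> X" "conn B y u"
    "\<forall>e\<in>B. \<exists>v\<in>e. \<exists>j<n. (v, u) \<in> adj X ^^ j"
    "\<forall>e\<in>B. \<forall>v\<in>e. \<exists>j\<le>n. (y, v) \<in> adj X ^^ j"
  using path_edges_ex[OF assms] by (elim exE conjE) (rule that)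

lemma pred_card_le:
  assumes "\<And>y. y \<in> V \<Longrightarrow> Measurable.pred M (\<lambda>c. y \<in> Y c)" "\<And>c. Y c \<subseteq> V"
  shows "Measurable.pred M (\<lambda>c. finite (Y c) \<and> card (Y c) \<le> n)"
proof -
  let ?F = "{F. finite F \<and> F \<subseteq> V \<and> card F \<le> n}"
  have eq: "finite (Y c) \<and> card (Y c) \<le> n \<longleftrightarrow> (\<exists>F\<in>?F. \<forall>y\<in>V. \<not> (y \<in> Y c \<and> y \<notin> F))" for c
  proof
    assume "finite (Y c) \<and> card (Y c) \<le> n"
    then show "\<exists>F\<in>?F. \<forall>y\<in>V. \<not> (y \<in> Y c \<and> y \<notin> F)"
      using assms(2) by (intro bexI[of _ "Y c"]) auto
  next
    assume "\<exists>F\<in>?F. \<forall>y\<in>V. \<not> (y \<in> Y c \<and> y \<notin> F)"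
    then obtain F where F: "finite F" "card F \<le> n" "\<forall>y\<in>V. \<not> (y \<in> Y c \<and> y \<notin> F)" by (elim bexE) blast
    then have "Y c \<subseteq> F" using assms(2)[of c] by blast
    then show "finite (Y c) \<and> card (Y c) \<le> n"
      using F(1,2) card_mono[OF F(1), of "Y c"] finite_subset[of "Y c" F] by linarith
  qed
  have "countable ?F"
    by (rule countable_subset[OF _ countable_Collect_finite_subset[OF countable_V]]) auto
  moreover have const: "Measurable.pred M (\<lambda>_. b)" for b by simp
  ultimately show ?thesis
    unfolding eq by (intro const pred_Ball_countable pred_Bex_countable pred_intros_logic assms(1) countable_V)
qed

end

section \<open>Mass transport\<close>

context percolation
begin

text \<open>Moving each sender to \<one> shows that the expected number of senders to
  \<open>x\<close> equals the expected number of receivers from \<one>, which is at most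
  \<open>n\<close>. The probabilities of receiving are thus summable, and Borel-Cantelli leaves
  finitely many senders.\<close>

lemma mass_transport:
  assumes meas: "\<And>x y. x \<in> V \<Longrightarrow> y \<in> V \<Longrightarrow> Measurable.pred \<Omega> (\<lambda>c. f c x y)"
    and inv: "\<And>g x y. g \<in> V \<Longrightarrow> x \<in> V \<Longrightarrow> y \<in> V \<Longrightarrow> AE c in \<Omega>. f (act g c) x y \<longleftrightarrow> f c (g \<otimes> x) (g \<otimes> y)"
    and out: "\<And>c. finite {y\<in>V. f c \<one> y}" "\<And>c. card {y\<in>V. f c \<one> y} \<le> n"
    and x: "x \<in> V"
  shows "AE c in \<Omega>. finite {y\<in>V. f c y x}"
proof -
  define A where "A i = {c\<in>space \<Omega>. f c (enum i) x}" for i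
  have A: "A i \<in> P.events" for i using meas[OF enum_V[of i] x] by (simp add: A_def pred_def)
  \<comment> \<open>The position of \<open>x\<close> after the sender \<open>enum i\<close> has been
    translated to \<one>; distinct senders give distinct positions.\<close>
  let ?y = "\<lambda>i. inv (enum i) \<otimes> x"
  have prob_A: "P.prob (A i) = (\<integral>c. of_bool (f c \<one> (?y i)) \<partial>\<Omega>)" for i
  proof -
    have "P.prob (A i) = \<P>(c in \<Omega>. f (act (enum i) c) \<one> (?y i))"
      unfolding A_def
    proof (rule P.finite_measure_eq_AE)
      show "AE c in \<Omega>. c \<in> {c\<in>space \<Omega>. f c (enum i) x} \<longleftrightarrow> c \<in> {c\<in>space \<Omega>. f (act (enum i) c) \<one> (?y i)}"
        using inv[of "enum i" \<one> "?y i"] x by (auto simp: inv_mult_cancel)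
      show "{c\<in>space \<Omega>. f c (enum i) x} \<in> P.events" using A[of i] by (simp add: A_def)
      have "Measurable.pred \<Omega> (\<lambda>c. f (act (enum i) c) \<one> (?y i))"
        using x by (intro measurable_compose[OF shift.measurable_act[OF shift_t] meas]) auto
      then show "{c\<in>space \<Omega>. f (act (enum i) c) \<one> (?y i)} \<in> P.events" by (simp add: pred_def)
    qed
    also have "\<dots> = \<P>(c in \<Omega>. f c \<one> (?y i))"
      using x by (intro shift.prob_act_Collect[OF shift_t] meas) auto
    also have "\<dots> = (\<integral>c. indicator {c\<in>space \<Omega>. f c \<one> (?y i)} c \<partial>\<Omega>)"
      using meas[of \<one> "?y i"] x by (simp add: pred_def)
    also have "\<dots> = (\<integral>c. of_bool (f c \<one> (?y i)) \<partial>\<Omega>)"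
      by (intro Bochner_Integration.integral_cong) (auto simp: indicator_def)
    finally show ?thesis .
  qed
  have int: "integrable \<Omega> (\<lambda>c. of_bool (f c \<one> (?y i)) :: real)" for i
    using x by (intro P.integrable_const_bound[where B = 1] measurable_compose[OF meas]) auto
  have "(\<Sum>i<N. P.prob (A i)) \<le> n" for N
  proof -
    have "(\<Sum>i<N. P.prob (A i)) = (\<integral>c. (\<Sum>i<N. of_bool (f c \<one> (?y i))) \<partial>\<Omega>)"
      unfolding prob_A by (intro Bochner_Integration.integral_sum[symmetric] int)
    also have "\<dots> \<le> (\<integral>c. real n \<partial>\<Omega>)"
    proof (intro integral_mono Bochner_Integration.integrable_sum int P.integrable_const)
      fix c
      have "(\<Sum>i<N. of_bool (f c \<one> (?y i)) :: real) = card {i\<in>{..<N}. f c \<one> (?y i)}"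
        by (simp add: of_bool_def sum.If_cases Int_def)
      also have "card {i\<in>{..<N}. f c \<one> (?y i)} \<le> card {y\<in>V. f c \<one> y}"
      proof (rule card_inj_on_le[where f = ?y])
        show "inj_on ?y {i\<in>{..<N}. f c \<one> (?y i)}"
        proof (rule inj_onI)
          fix i j assume "?y i = ?y j"
          then have "inv (enum i) = inv (enum j)" using x by simp
          then have "inv (inv (enum i)) = inv (inv (enum j))" by simp
          then have "enum i = enum j" by (simp only: inv_inv enum_V)
          then show "i = j" using bij_enum by (auto simp: bij_betw_def dest: injD)
        qed
      qed (use x out in auto)
      also have "\<dots> \<le> n" by (rule out)
      finally show "(\<Sum>i<N. of_bool (f c \<one> (?y i)) :: real) \<le> real n" by simp
    qed
    finally show ?thesis by (simp add: P.prob_space)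
  qed
  then have "summable (\<lambda>i. P.prob (A i))"
    by (intro summableI_nonneg_bounded[where x = "real n"]) auto
  from borel_cantelli_AE1[OF A _ this]
  have "AE c in \<Omega>. \<forall>\<^sub>F i in sequentially. c \<in> space \<Omega> - A i" by (simp add: P.emeasure_eq_measure)
  then show ?thesis
  proof (rule AE_mp, intro AE_I2 impI)
    fix c assume c: "c \<in> space \<Omega>" "\<forall>\<^sub>F i in sequentially. c \<in> space \<Omega> - A i"
    then obtain N where N: "\<And>i. N \<le> i \<Longrightarrow> c \<notin> A i" by (auto simp: eventually_sequentially)
    have "{y\<in>V. f c y x} \<subseteq> enum ` {..<N}"
    proof
      fix y assume y: "y \<in> {y\<in>V. f c y x}"
      then obtain i where i: "y = enum i" using enum_surj by auto
      then have "c \<in> A i" using y c by (simp add: A_def)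
      then have "i < N" using N[of i] by (cases "i < N") auto
      then show "y \<in> enum ` {..<N}" using i by simp
    qed
    then show "finite {y\<in>V. f c y x}" by (rule finite_subset) simp
  qed
qed

end

section \<open>The distinguished cluster and its neighbourhoods\<close>

locale heavy_percolation = percolation G S q r s for G (structure) and S q r s +
  fixes hv :: "('a set \<times> nat \<Rightarrow> bool) \<Rightarrow> 'a \<Rightarrow> bool"
  assumes hv_pred: "x \<in> V \<Longrightarrow> Measurable.pred \<Omega> (\<lambda>c. hv c x)"
    and hv_unique: "AE c in \<Omega>. \<forall>x\<in>V. \<forall>y\<in>V. hv c x \<longrightarrow> hv c y \<longrightarrow> rel c x y"
    and hv_ex: "AE c in \<Omega>. \<exists>x\<in>V. hv c x"
    and hv_act: "g \<in> V \<Longrightarrow> AE c in \<Omega>. \<forall>x\<in>V. hv (act g c) x \<longleftrightarrow> hv c (g \<otimes> x)"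
    and hv_local: "O\<^sub>0 c = O\<^sub>0 c' \<Longrightarrow> O\<^sub>1 c = O\<^sub>1 c' \<Longrightarrow> hv c = hv c'"
    and O\<^sub>0_unique: "AE c in \<Omega>. \<forall>x\<in>U (O\<^sub>0 c). \<forall>y\<in>U (O\<^sub>0 c). conn (O\<^sub>0 c) x y"
    and s_pos: "0 < s"
begin

text \<open>By \<open>hv_unique\<close> this is almost surely contained in a single cluster of
  \<open>O\<^sub>1\<close>, even though it is written as a union over all heavy vertices.\<close>

definition Z :: "('a set \<times> nat \<Rightarrow> bool) \<Rightarrow> 'a set" where
  "Z c = {v\<in>V. \<exists>x\<in>V. hv c x \<and> conn (O\<^sub>1 c) v (\<pi> (O\<^sub>0 c) x)}"

text \<open>Distances are taken in \<open>O\<^sub>0\<close>: uniqueness there puts every vertex of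
  its infinite cluster in some \<open>N m c\<close>, and every edge of a path in
  \<open>O\<^sub>0\<close> can be restored by layer 2.\<close>

definition N :: "nat \<Rightarrow> ('a set \<times> nat \<Rightarrow> bool) \<Rightarrow> 'a set" where
  "N m c = {v\<in>V. \<exists>u\<in>Z c. \<exists>k\<in>{..m}. (v, u) \<in> adj (O\<^sub>0 c) ^^ k}"

abbreviation cl :: "('a set \<times> nat \<Rightarrow> bool) \<Rightarrow> 'a \<Rightarrow> 'a set" where
  "cl c x \<equiv> {y. conn (O\<^sub>2 c) x y}"

lemma cl_V: "x \<in> V \<Longrightarrow> cl c x \<subseteq> V"
  using conn_V[OF _ O_sub(3)] by auto

lemma Z_V: "Z c \<subseteq> V" and N_V: "N m c \<subseteq> V"
  by (auto simp: Z_def N_def)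

lemma N_0: "N 0 c = Z c"
  by (auto simp: N_def Z_def)

lemma N_mono: "m \<le> n \<Longrightarrow> N m c \<subseteq> N n c"
  unfolding N_def by (intro subsetI CollectI conjI; elim CollectE conjE bexE) (simp, meson atMost_iff order_trans)

lemma ex_mult_iff: "g \<in> V \<Longrightarrow> (\<exists>u\<in>V. Q (g \<otimes> u)) \<longleftrightarrow> (\<exists>u\<in>V. Q u)"
proof
  assume "g \<in> V" "\<exists>u\<in>V. Q u"
  then obtain u where "u \<in> V" "Q u" by blast
  then show "\<exists>u\<in>V. Q (g \<otimes> u)"
    using \<open>g \<in> V\<close> by (intro bexI[of _ "inv g \<otimes> u"]) (simp_all add: inv_mult_cancel)
qed blast

lemma pred_Z: "Measurable.pred \<Omega> (\<lambda>c. v \<in> Z c)"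
proof (cases "v \<in> V")
  case True
  have eq: "v \<in> Z c \<longleftrightarrow> (\<exists>x\<in>V. hv c x \<and> (\<exists>u\<in>V. \<pi> (O\<^sub>0 c) x = u \<and> conn (O\<^sub>1 c) v u))" for c
    using True \<pi>_V by (auto simp: Z_def)
  have P: "Measurable.pred \<Omega> (\<lambda>c. \<pi> (O\<^sub>0 c) x = u)" for x u
    by (rule measurable_compose[OF measurable_\<pi>[OF pred_O(1) O_sub(1)]]) (assumption | rule measurable_count_space)+
  show ?thesis
    unfolding eq by (intro pred_Bex_countable countable_V pred_intros_logic hv_pred P pred_conn pred_O O_sub)
qed (simp add: Z_def)

lemma pred_N: "Measurable.pred \<Omega> (\<lambda>c. v \<in> N m c)"
proof (cases "v \<in> V")
  case True
  have eq: "v \<in> N m c \<longleftrightarrow> (\<exists>u\<in>V. u \<in> Z c \<and> (\<exists>k\<in>{..m}. (v, u) \<in> adj (O\<^sub>0 c) ^^ k))" for c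
    using True Z_V by (auto simp: N_def)
  show ?thesis
    unfolding eq
    by (intro pred_Bex_countable countable_V pred_intros_logic pred_Z pred_relpow pred_O O_sub countable_finite finite_atMost)
qed (simp add: N_def)

lemma pred_conn\<^sub>2: "Measurable.pred \<Omega> (\<lambda>c. conn (O\<^sub>2 c) x y)"
  by (intro pred_conn pred_O O_sub)

lemma Z_act:
  assumes g: "g \<in> V"
  shows "AE c in \<Omega>. \<forall>v\<in>V. v \<in> Z (act g c) \<longleftrightarrow> g \<otimes> v \<in> Z c"
  using hv_act[OF g]
proof (rule AE_mp, intro AE_I2 impI ballI)
  fix c v assume hv: "\<forall>x\<in>V. hv (act g c) x \<longleftrightarrow> hv c (g \<otimes> x)" and v: "v \<in> V"
  have "hv (act g c) x \<and> conn (O\<^sub>1 (act g c)) v (\<pi> (O\<^sub>0 (act g c)) x) \<longleftrightarrow>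
      hv c (g \<otimes> x) \<and> conn (O\<^sub>1 c) (g \<otimes> v) (\<pi> (O\<^sub>0 c) (g \<otimes> x))" if x: "x \<in> V" for x
  proof -
    have "g \<otimes> \<pi> (O\<^sub>0 (act g c)) x = \<pi> (O\<^sub>0 c) (g \<otimes> x)"
      using x g by (intro \<pi>_tr O_sub O_act)
    moreover have "conn (O\<^sub>1 (act g c)) v (\<pi> (O\<^sub>0 (act g c)) x) \<longleftrightarrow>
        conn (O\<^sub>1 c) (g \<otimes> v) (g \<otimes> \<pi> (O\<^sub>0 (act g c)) x)"
      using x g v by (intro conn_tr O_sub O_act \<pi>_V)
    ultimately show ?thesis using hv x by simp
  qed
  then have "v \<in> Z (act g c) \<longleftrightarrow> (\<exists>x\<in>V. hv c (g \<otimes> x) \<and> conn (O\<^sub>1 c) (g \<otimes> v) (\<pi> (O\<^sub>0 c) (g \<otimes> x)))"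
    using v by (simp add: Z_def)
  also have "\<dots> \<longleftrightarrow> g \<otimes> v \<in> Z c"
    using ex_mult_iff[OF g, of "\<lambda>x. hv c x \<and> conn (O\<^sub>1 c) (g \<otimes> v) (\<pi> (O\<^sub>0 c) x)"] g v by (simp add: Z_def)
  finally show "v \<in> Z (act g c) \<longleftrightarrow> g \<otimes> v \<in> Z c" .
qed

lemma N_act:
  assumes g: "g \<in> V"
  shows "AE c in \<Omega>. \<forall>v\<in>V. v \<in> N m (act g c) \<longleftrightarrow> g \<otimes> v \<in> N m c"
  using Z_act[OF g]
proof (rule AE_mp, intro AE_I2 impI ballI)
  fix c v assume Z: "\<forall>v\<in>V. v \<in> Z (act g c) \<longleftrightarrow> g \<otimes> v \<in> Z c" and v: "v \<in> V"
  have rp: "(v, u) \<in> adj (O\<^sub>0 (act g c)) ^^ k \<longleftrightarrow> (g \<otimes> v, g \<otimes> u) \<in> adj (O\<^sub>0 c) ^^ k" if "u \<in> V" for u k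
    using that g v by (intro relpow_tr O_sub O_act)
  have N_iff: "v \<in> N m c \<longleftrightarrow> (\<exists>u\<in>V. u \<in> Z c \<and> (\<exists>k\<in>{..m}. (v, u) \<in> adj (O\<^sub>0 c) ^^ k))"
    if "v \<in> V" for v c using that Z_V[of c] unfolding N_def by blast
  have "v \<in> N m (act g c) \<longleftrightarrow>
      (\<exists>u\<in>V. g \<otimes> u \<in> Z c \<and> (\<exists>k\<in>{..m}. (g \<otimes> v, g \<otimes> u) \<in> adj (O\<^sub>0 c) ^^ k))"
    unfolding N_iff[OF v] using Z rp by (intro bex_cong refl) simp
  also have "\<dots> \<longleftrightarrow> g \<otimes> v \<in> N m c"
    using ex_mult_iff[OF g, of "\<lambda>u. u \<in> Z c \<and> (\<exists>k\<in>{..m}. (g \<otimes> v, u) \<in> adj (O\<^sub>0 c) ^^ k)"]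
      N_iff[of "g \<otimes> v"] g v by simp
  finally show "v \<in> N m (act g c) \<longleftrightarrow> g \<otimes> v \<in> N m c" .
qed

lemma bij_betw_mult:
  assumes "g \<in> V" "A \<subseteq> V" "B \<subseteq> V" "\<And>v. v \<in> V \<Longrightarrow> v \<in> A \<longleftrightarrow> g \<otimes> v \<in> B"
  shows "bij_betw (\<lambda>v. g \<otimes> v) A B"
proof (rule bij_betwI[where g = "\<lambda>v. inv g \<otimes> v"])
  show "(\<lambda>v. g \<otimes> v) \<in> A \<rightarrow> B" using assms by (auto simp: subset_iff)
  show "(\<lambda>v. inv g \<otimes> v) \<in> B \<rightarrow> A"
  proof
    fix v assume v: "v \<in> B"
    then have "v \<in> V" using assms(3) by blast
    then show "inv g \<otimes> v \<in> A" using assms(4)[of "inv g \<otimes> v"] v assms(1) by (simp add: inv_mult_cancel)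
  qed
  show "inv g \<otimes> (g \<otimes> x) = x" if "x \<in> A" for x using that assms by (auto simp: inv_mult_cancel)
  show "g \<otimes> (inv g \<otimes> x) = x" if "x \<in> B" for x using that assms by (auto simp: inv_mult_cancel)
qed

lemma Z_conn: "AE c in \<Omega>. \<forall>u\<in>Z c. \<forall>v\<in>Z c. conn (O\<^sub>1 c) u v"
  using hv_unique
proof (rule AE_mp, intro AE_I2 impI ballI)
  fix c u v assume *: "\<forall>x\<in>V. \<forall>y\<in>V. hv c x \<longrightarrow> hv c y \<longrightarrow> rel c x y" "u \<in> Z c" "v \<in> Z c"
  then obtain x y where xy: "x \<in> V" "hv c x" "conn (O\<^sub>1 c) u (\<pi> (O\<^sub>0 c) x)"
    "y \<in> V" "hv c y" "conn (O\<^sub>1 c) v (\<pi> (O\<^sub>0 c) y)" unfolding Z_def by blast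
  have "rel c x y" using * xy by simp
  then have "conn (O\<^sub>1 c) (\<pi> (O\<^sub>0 c) x) (\<pi> (O\<^sub>0 c) y)" by (simp add: rel_def)
  with xy(3) conn_sym[OF xy(6)] show "conn (O\<^sub>1 c) u v" by (meson conn_trans)
qed

text \<open>A finite \<open>Z\<close> would receive mass from every vertex.\<close>

lemma Z_infinite: "AE c in \<Omega>. infinite (Z c)"
proof -
  \<comment> \<open>The cutoff by \<open>n\<close> bounds the mass sent out, as mass transport
    demands; afterwards all \<open>n\<close> are treated at once.\<close>
  define f where "f n c x y \<longleftrightarrow> y \<in> Z c \<and> finite (Z c) \<and> card (Z c) \<le> n" for n :: nat and c and x y :: 'a
  have fin: "AE c in \<Omega>. \<forall>x\<in>V. finite {y\<in>V. f n c y x}" for n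
  proof (intro AE_ball_countable' countable_V mass_transport[where n = n])
    show "Measurable.pred \<Omega> (\<lambda>c. f n c x y)" for x y
      unfolding f_def by (intro pred_intros_logic pred_Z pred_card_le Z_V)
    show "finite {y\<in>V. f n c \<one> y}" for c
      by (cases "finite (Z c)") (auto simp: f_def)
    show "card {y\<in>V. f n c \<one> y} \<le> n" for c
    proof (cases "finite (Z c) \<and> card (Z c) \<le> n")
      case True
      moreover have "{y\<in>V. f n c \<one> y} \<subseteq> Z c" by (auto simp: f_def)
      ultimately show ?thesis using card_mono[of "Z c" "{y\<in>V. f n c \<one> y}"] by linarith
    qed (auto simp: f_def)
    fix g x y assume g: "g \<in> V" "x \<in> V" "y \<in> V"
    show "AE c in \<Omega>. f n (act g c) x y \<longleftrightarrow> f n c (g \<otimes> x) (g \<otimes> y)"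
      using Z_act[OF g(1)]
    proof (rule AE_mp, intro AE_I2 impI)
      fix c assume Z: "\<forall>v\<in>V. v \<in> Z (act g c) \<longleftrightarrow> g \<otimes> v \<in> Z c"
      then have "bij_betw (\<lambda>v. g \<otimes> v) (Z (act g c)) (Z c)"
        using g by (intro bij_betw_mult Z_V) auto
      from bij_betw_finite[OF this] bij_betw_same_card[OF this]
      show "f n (act g c) x y \<longleftrightarrow> f n c (g \<otimes> x) (g \<otimes> y)" using Z g by (simp add: f_def)
    qed
  qed
  then have "AE c in \<Omega>. \<forall>n. \<forall>x\<in>V. finite {y\<in>V. f n c y x}" by (simp only: AE_all_countable) blast
  then show ?thesis
    using hv_ex
  proof (eventually_elim)
    fix c assume *: "\<forall>n. \<forall>x\<in>V. finite {y\<in>V. f n c y x}" "\<exists>x\<in>V. hv c x"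
    show "infinite (Z c)"
    proof
      assume "finite (Z c)"
      obtain x where "x \<in> V" "hv c x" using *(2) by (elim bexE)
      then have v: "\<pi> (O\<^sub>0 c) x \<in> Z c" unfolding Z_def using \<pi>_V by blast
      then have "\<pi> (O\<^sub>0 c) x \<in> V" using Z_V by blast
      then have "finite {y\<in>V. f (card (Z c)) c y (\<pi> (O\<^sub>0 c) x)}" using *(1) by simp
      also have "{y\<in>V. f (card (Z c)) c y (\<pi> (O\<^sub>0 c) x)} = V"
        using v \<open>finite (Z c)\<close> by (simp add: f_def)
      finally show False using infinite_carrier by contradiction
    qed
  qed
qed

text \<open>Otherwise every vertex of the cluster sends mass to the finitely many vertices of the
  cluster in \<open>N m c\<close>.\<close>

lemma cluster_near_Z:
  "AE c in \<Omega>. \<forall>x\<in>V. infinite (cl c x) \<longrightarrow> cl c x \<inter> N m c \<noteq> {} \<longrightarrow> infinite (cl c x \<inter> N m c)"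
proof -
  define D where "D c x = {y\<in>V. conn (O\<^sub>2 c) x y \<and> y \<in> N m c}" for c x
  define f where "f n c x y \<longleftrightarrow> y \<in> D c x \<and> finite (D c x) \<and> card (D c x) \<le> n" for n :: nat and c and x y :: 'a
  have D_V: "D c x \<subseteq> V" for c x by (auto simp: D_def)
  have pred_D: "Measurable.pred \<Omega> (\<lambda>c. y \<in> D c x)" if "y \<in> V" for x y
    using that unfolding D_def by (simp) (intro pred_intros_logic pred_conn\<^sub>2 pred_N)
  have fin: "AE c in \<Omega>. \<forall>x\<in>V. finite {y\<in>V. f n c y x}" for n
  proof (intro AE_ball_countable' countable_V mass_transport[where n = n])
    show "Measurable.pred \<Omega> (\<lambda>c. f n c x y)" if "y \<in> V" for x y
      unfolding f_def by (intro pred_intros_logic pred_D that pred_card_le D_V)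
    show "finite {y\<in>V. f n c \<one> y}" for c
      by (cases "finite (D c \<one>)") (auto simp: f_def)
    show "card {y\<in>V. f n c \<one> y} \<le> n" for c
    proof (cases "finite (D c \<one>) \<and> card (D c \<one>) \<le> n")
      case True
      moreover have "{y\<in>V. f n c \<one> y} \<subseteq> D c \<one>" by (auto simp: f_def)
      ultimately show ?thesis using card_mono[of "D c \<one>" "{y\<in>V. f n c \<one> y}"] by linarith
    qed (auto simp: f_def)
    fix g x y assume g: "g \<in> V" "x \<in> V" "y \<in> V"
    show "AE c in \<Omega>. f n (act g c) x y \<longleftrightarrow> f n c (g \<otimes> x) (g \<otimes> y)"
      using N_act[OF g(1)]
    proof (rule AE_mp, intro AE_I2 impI)
      fix c assume N: "\<forall>v\<in>V. v \<in> N m (act g c) \<longleftrightarrow> g \<otimes> v \<in> N m c"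
      have D: "v \<in> D (act g c) x \<longleftrightarrow> g \<otimes> v \<in> D c (g \<otimes> x)" if "v \<in> V" for v
      proof -
        have "conn (O\<^sub>2 (act g c)) x v \<longleftrightarrow> conn (O\<^sub>2 c) (g \<otimes> x) (g \<otimes> v)"
          using that g by (intro conn_tr O_sub O_act)
        then show ?thesis using that g N by (simp add: D_def)
      qed
      then have "bij_betw (\<lambda>v. g \<otimes> v) (D (act g c) x) (D c (g \<otimes> x))"
        using g by (intro bij_betw_mult D_V)
      from bij_betw_finite[OF this] bij_betw_same_card[OF this]
      show "f n (act g c) x y \<longleftrightarrow> f n c (g \<otimes> x) (g \<otimes> y)" using D g by (simp add: f_def)
    qed
  qed
  then have "AE c in \<Omega>. \<forall>n. \<forall>x\<in>V. finite {y\<in>V. f n c y x}" by (simp only: AE_all_countable) blast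
  then show ?thesis
  proof (rule AE_mp, intro AE_I2 impI ballI notI)
    fix c x assume *: "\<forall>n. \<forall>x\<in>V. finite {y\<in>V. f n c y x}" and x: "x \<in> V"
      and inf: "infinite (cl c x)" and ne: "cl c x \<inter> N m c \<noteq> {}" and "finite (cl c x \<inter> N m c)"
    have D_eq: "D c x = cl c x \<inter> N m c" using N_V[of m c] by (auto simp: D_def)
    obtain v where v: "v \<in> D c x" "v \<in> V" using ne N_V[of m c] unfolding D_eq by blast
    have "D c y = D c x" if "conn (O\<^sub>2 c) x y" for y
      unfolding D_def using that by (intro Collect_cong conj_cong refl) (meson conn_trans conn_sym)
    note D_const = this
    have "finite (D c x)" unfolding D_eq by fact
    have "cl c x \<subseteq> {y\<in>V. f (card (D c x)) c y v}"
    proof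
      fix y assume y: "y \<in> cl c x"
      then have "y \<in> V" using cl_V[OF x] by (rule subsetD[rotated])
      moreover have "D c y = D c x" using y by (intro D_const) (rule CollectD)
      ultimately show "y \<in> {y\<in>V. f (card (D c x)) c y v}"
        using v(1) \<open>finite (D c x)\<close> by (simp add: f_def)
    qed
    moreover have "finite {y\<in>V. f (card (D c x)) c y v}" using * v(2) by simp
    ultimately have "finite (cl c x)" by (rule finite_subset)
    with inf show False by contradiction
  qed
qed

end

section \<open>Sprinkling and uniqueness\<close>

context heavy_percolation
begin

text \<open>Given layers \<open>0\<close> and \<open>1\<close>, the set \<open>N k c\<close> is determined. A cluster avoiding \<open>N k c\<close> depends
  only on the layer-\<open>2\<close> variables of the edges \<open>E\<^sub>1\<close> not touching \<open>N k c\<close>, whereas each of its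
  infinitely many vertices in \<open>N (Suc k) c\<close> is joined to \<open>Z c\<close> by a path of \<open>Suc k\<close> edges of the
  independent remainder \<open>E\<^sub>2\<close>.\<close>

lemma sprinkling:
  assumes x: "x \<in> V"
  shows "AE c in \<Omega>. \<not> (cl c x \<inter> N k c = {} \<and> infinite (cl c x \<inter> N (Suc k) c))" (is "AE c in \<Omega>. ?Q c")
proof (rule AE_PiM_split[of "E \<times> {..1}" "E \<times> {2}"])
  show "E \<times> {..1} \<union> E \<times> {2} = ind"
  proof -
    have "{..1} \<union> {2} = {..2::nat}" by auto
    then show ?thesis by (simp only: Sigma_Un_distrib2[symmetric])
  qed
  show "E \<times> {..1} \<inter> E \<times> {2::nat} = {}" by auto
  show Q_meas: "Measurable.pred \<Omega> ?Q"
  proof -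
    have eq: "cl c x \<inter> N k c = {} \<longleftrightarrow> \<not> (\<exists>v\<in>V. conn (O\<^sub>2 c) x v \<and> v \<in> N k c)" for c
      using cl_V[OF x, of c] by blast
    have pred_mem: "Measurable.pred \<Omega> (\<lambda>c. y \<in> cl c x \<inter> N (Suc k) c)" for y
      unfolding Int_iff mem_Collect_eq by (intro pred_intros_logic pred_conn\<^sub>2 pred_N)
    have sub: "cl c x \<inter> N (Suc k) c \<subseteq> V" for c using N_V by blast
    show ?thesis
      unfolding eq
      by (intro pred_intros_logic pred_Bex_countable countable_V pred_conn\<^sub>2 pred_N pred_infinite pred_mem sub)
  qed
  show "AE a in PiM (E \<times> {..1}) Bern. AE b in PiM (E \<times> {2}) Bern. ?Q (merge (E \<times> {..1}) (E \<times> {2}) (a, b))"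
  proof (rule AE_I2)
    fix a assume a: "a \<in> space (PiM (E \<times> {..1}) Bern)"
    define C where "C b = merge (E \<times> {..1}) (E \<times> {2}) (a, b)" for b :: "'a set \<times> nat \<Rightarrow> bool"
    have C: "C b (e, 0) = a (e, 0)" "C b (e, Suc 0) = a (e, Suc 0)" "C b (e, 2) = b (e, 2)" if "e \<in> E" for b e
      using that by (simp_all add: C_def merge_def)
    have C_meas: "C \<in> measurable (PiM (E \<times> {2}) Bern) \<Omega>"
    proof -
      have "merge (E \<times> {..1}) (E \<times> {2}) \<in> measurable (PiM (E \<times> {..1}) Bern \<Otimes>\<^sub>M PiM (E \<times> {2}) Bern) \<Omega>"
        using measurable_merge[of "E \<times> {..1}" "E \<times> {2}" Bern]
        by (simp only: \<open>E \<times> {..1} \<union> E \<times> {2} = ind\<close>)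
      from measurable_compose[OF measurable_Pair1'[OF a] this] show ?thesis
        unfolding C_def[abs_def] .
    qed
    \<comment> \<open>Closing all of layer 2 is an arbitrary completion of \<open>a\<close>; by
      \<open>hv_local\<close> every completion gives the same \<open>Z\<close> and
      \<open>N\<close>.\<close>
    define c0 where "c0 = C (\<lambda>_. False)"
    have O_C: "O\<^sub>0 (C b) = O\<^sub>0 c0" "O\<^sub>1 (C b) = O\<^sub>1 c0" for b
      unfolding O\<^sub>0_def O\<^sub>1_def c0_def by (auto simp: C)
    have Z_C: "Z (C b) = Z c0" and N_C: "N m (C b) = N m c0" for b m
      using O_C[of b] hv_local[OF O_C[of b]] by (simp_all add: Z_def N_def)
    define E\<^sub>1 where "E\<^sub>1 = {e\<in>E. e \<inter> N k c0 = {}}"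
    define E\<^sub>2 where "E\<^sub>2 = E - E\<^sub>1"
    interpret K: bernoulli par "E \<times> {2}" by unfold_locales (auto simp: p_nonneg p_le_1)
    have "AE b in PiM (E \<times> {2}) Bern. ?Q (C b)"
    proof (rule K.AE_PiM_split[of "E\<^sub>1 \<times> {2}" "E\<^sub>2 \<times> {2}"])
      show "E\<^sub>1 \<times> {2} \<union> E\<^sub>2 \<times> {2} = E \<times> {2::nat}" by (auto simp: E\<^sub>1_def E\<^sub>2_def)
      show "E\<^sub>1 \<times> {2} \<inter> E\<^sub>2 \<times> {2::nat} = {}" by (auto simp: E\<^sub>2_def)
      show "Measurable.pred (PiM (E \<times> {2}) Bern) (\<lambda>b. ?Q (C b))"
        by (rule measurable_compose[OF C_meas Q_meas])
      show "AE b\<^sub>1 in PiM (E\<^sub>1 \<times> {2}) Bern. AE b\<^sub>2 in PiM (E\<^sub>2 \<times> {2}) Bern.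
          ?Q (C (merge (E\<^sub>1 \<times> {2}) (E\<^sub>2 \<times> {2}) (b\<^sub>1, b\<^sub>2)))"
      proof (rule AE_I2)
        fix b\<^sub>1 :: "'a set \<times> nat \<Rightarrow> bool"
        define M where "M b\<^sub>2 = C (merge (E\<^sub>1 \<times> {2}) (E\<^sub>2 \<times> {2}) (b\<^sub>1, b\<^sub>2))" for b\<^sub>2 :: "'a set \<times> nat \<Rightarrow> bool"
        define X where "X = {e\<in>E\<^sub>1. a (e, 0) \<and> (a (e, 1) \<or> b\<^sub>1 (e, 2))}"
        define D where "D = {y. conn X x y}"
        \<comment> \<open>Once \<open>a\<close> and \<open>b\<^sub>1\<close> are fixed, so is
          \<open>Y\<close>. If the cluster of \<open>x\<close> avoids \<open>N k c0\<close>, these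
          are its vertices at distance exactly \<open>Suc k\<close> from
          \<open>Z c0\<close>.\<close>
        define Y where "Y = D \<inter> N (Suc k) c0 - N k c0"
        have E\<^sub>1_E: "e \<in> E" if "e \<in> E\<^sub>1" for e using that by (simp add: E\<^sub>1_def)
        have E\<^sub>2_E: "e \<in> E" "e \<notin> E\<^sub>1" if "e \<in> E\<^sub>2" for e using that by (simp_all add: E\<^sub>2_def)
        have M\<^sub>1: "e \<in> O\<^sub>2 (M b\<^sub>2) \<longleftrightarrow> e \<in> X" if "e \<in> E\<^sub>1" for b\<^sub>2 e
          using that E\<^sub>1_E[OF that] by (simp add: O\<^sub>2_def M_def C X_def merge_def)
        have M\<^sub>2: "e \<in> O\<^sub>2 (M b\<^sub>2) \<longleftrightarrow> a (e, 0) \<and> (a (e, 1) \<or> b\<^sub>2 (e, 2))" if "e \<in> E\<^sub>2" for b\<^sub>2 e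
          using that E\<^sub>2_E[OF that] by (simp add: O\<^sub>2_def M_def C merge_def)
        have N_M: "N m (M b\<^sub>2) = N m c0" for m b\<^sub>2 unfolding M_def by (rule N_C)
        \<comment> \<open>A cluster that avoids \<open>N k c0\<close> uses only edges disjoint from
          that set, all of which lie in \<open>E\<^sub>1\<close>; the variables on
          \<open>E\<^sub>2\<close> then have no influence on it.\<close>
        have cl_eq: "cl (M b\<^sub>2) x = D" if disj: "cl (M b\<^sub>2) x \<inter> N k c0 = {}" for b\<^sub>2
        proof (intro equalityI subsetI)
          fix y assume "y \<in> D"
          then have "conn X x y" by (simp add: D_def)
          moreover have "X \<subseteq> O\<^sub>2 (M b\<^sub>2)"
          proof
            fix e assume e: "e \<in> X"
            then have "e \<in> E\<^sub>1" by (simp add: X_def)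
            with e show "e \<in> O\<^sub>2 (M b\<^sub>2)" using M\<^sub>1 by simp
          qed
          ultimately have "conn (O\<^sub>2 (M b\<^sub>2)) x y" by (rule conn_mono)
          then show "y \<in> cl (M b\<^sub>2) x" by simp
        next
          fix y assume "y \<in> cl (M b\<^sub>2) x"
          then have "conn (O\<^sub>2 (M b\<^sub>2)) x y" by simp
          then have "conn X x y"
          proof (induction rule: rtrancl_induct)
            case (step y z)
            have yz: "{y, z} \<in> O\<^sub>2 (M b\<^sub>2)" using step.hyps(2) by (simp add: adj_def)
            have "conn (O\<^sub>2 (M b\<^sub>2)) x z" using step.hyps by (rule rtrancl_into_rtrancl)
            then have "y \<notin> N k c0" "z \<notin> N k c0" using disj step.hyps(1) by blast+
            moreover have "{y, z} \<in> E" using yz O_sub(3) by blast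
            ultimately have "{y, z} \<in> E\<^sub>1" by (simp add: E\<^sub>1_def)
            then have "{y, z} \<in> X" using yz M\<^sub>1 by simp
            then have "(y, z) \<in> adj X" by (simp add: adj_def)
            with step.IH show ?case by (rule rtrancl_into_rtrancl)
          qed simp
          then show "y \<in> D" by (simp add: D_def)
        qed
        have Y_eq: "Y = cl (M b\<^sub>2) x \<inter> N (Suc k) c0" if disj: "cl (M b\<^sub>2) x \<inter> N k c0 = {}" for b\<^sub>2
          using disj unfolding Y_def cl_eq[OF disj] by blast
        show "AE b\<^sub>2 in PiM (E\<^sub>2 \<times> {2}) Bern. ?Q (C (merge (E\<^sub>1 \<times> {2}) (E\<^sub>2 \<times> {2}) (b\<^sub>1, b\<^sub>2)))"
        proof (cases "finite Y")
          case True
          have "?Q (M b\<^sub>2)" for b\<^sub>2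
            unfolding N_M using Y_eq[of b\<^sub>2] True by (intro notI) (elim conjE, simp)
          then show ?thesis unfolding M_def by (intro AE_I2)
        next
          case False
          have "\<exists>B u. finite B \<and> card B \<le> Suc k \<and> B \<subseteq> O\<^sub>0 c0 \<and> B \<subseteq> E\<^sub>2 \<and> u \<in> Z c0 \<and> conn B y u \<and>
              (\<forall>e\<in>B. \<forall>v\<in>e. \<exists>j\<le>Suc k. (y, v) \<in> adj E ^^ j)" if y: "y \<in> Y" for y
          proof -
            have y': "y \<in> V" "y \<in> N (Suc k) c0" "y \<notin> N k c0" using y N_V[of "Suc k" c0] by (auto simp: Y_def)
            then obtain u j where u: "u \<in> Z c0" "j \<le> Suc k" "(y, u) \<in> adj (O\<^sub>0 c0) ^^ j"
              unfolding N_def by blast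
            have near: "v \<in> N k c0" if "v \<in> V" "i \<le> k" "(v, u) \<in> adj (O\<^sub>0 c0) ^^ i" for v i
              using that u(1) unfolding N_def by blast
            have "\<not> j \<le> k" using near[OF y'(1) _ u(3)] y'(3) by blast
            then have "j = Suc k" using u(2) by simp
            with u(3) have path: "(y, u) \<in> adj (O\<^sub>0 c0) ^^ Suc k" by simp
            obtain B where B: "finite B" "card B \<le> Suc k" "B \<subseteq> O\<^sub>0 c0" "conn B y u"
              "\<forall>e\<in>B. \<exists>v\<in>e. \<exists>j<Suc k. (v, u) \<in> adj (O\<^sub>0 c0) ^^ j"
              "\<forall>e\<in>B. \<forall>v\<in>e. \<exists>j\<le>Suc k. (y, v) \<in> adj (O\<^sub>0 c0) ^^ j"
              by (rule path_edges[OF path]) (rule that)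
            \<comment> \<open>Each edge of the path has an endpoint at distance at most
              \<open>k\<close> from \<open>u\<close>, hence in \<open>N k c0\<close>. So the path is
              built from variables independent of \<open>Y\<close>.\<close>
            have "B \<subseteq> E\<^sub>2"
            proof
              fix e assume e: "e \<in> B"
              then have eE: "e \<in> E" using B(3) O_sub(1) by blast
              obtain v j where v: "v \<in> e" "j < Suc k" "(v, u) \<in> adj (O\<^sub>0 c0) ^^ j" using bspec[OF B(5) e] by blast
              have "v \<in> V" using v(1) edge_sub[OF eE] by blast
              then have "v \<in> N k c0" by (rule near[OF _ _ v(3)]) (use v(2) in simp)
              then have "e \<notin> E\<^sub>1" using v(1) unfolding E\<^sub>1_def by blast
              with eE show "e \<in> E\<^sub>2" by (simp add: E\<^sub>2_def)
            qed
            moreover have "\<forall>e\<in>B. \<forall>v\<in>e. \<exists>j\<le>Suc k. (y, v) \<in> adj E ^^ j"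
            proof (intro ballI)
              fix e v assume e: "e \<in> B" "v \<in> e"
              obtain j where "j \<le> Suc k" "(y, v) \<in> adj (O\<^sub>0 c0) ^^ j" using bspec[OF bspec[OF B(6) e(1)] e(2)] by blast
              then show "\<exists>j\<le>Suc k. (y, v) \<in> adj E ^^ j" using relpow_adj_mono[OF _ O_sub(1)] by blast
            qed
            ultimately show ?thesis using B(1-4) u(1) by (intro exI[of _ B] exI[of _ u] conjI)
          qed
          then have "\<forall>y. \<exists>B u. y \<in> Y \<longrightarrow> finite B \<and> card B \<le> Suc k \<and> B \<subseteq> O\<^sub>0 c0 \<and> B \<subseteq> E\<^sub>2 \<and> u \<in> Z c0 \<and> conn B y u \<and>
              (\<forall>e\<in>B. \<forall>v\<in>e. \<exists>j\<le>Suc k. (y, v) \<in> adj E ^^ j)" by simp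
          then obtain B u where Bu: "\<forall>y. y \<in> Y \<longrightarrow> finite (B y) \<and> card (B y) \<le> Suc k \<and> B y \<subseteq> O\<^sub>0 c0 \<and> B y \<subseteq> E\<^sub>2 \<and>
              u y \<in> Z c0 \<and> conn (B y) y (u y) \<and> (\<forall>e\<in>B y. \<forall>v\<in>e. \<exists>j\<le>Suc k. (y, v) \<in> adj E ^^ j)"
            unfolding choice_iff by (elim exE)
          have B: "finite (B y)" "card (B y) \<le> Suc k" "B y \<subseteq> O\<^sub>0 c0" "B y \<subseteq> E\<^sub>2" "u y \<in> Z c0" "conn (B y) y (u y)"
            "\<And>e v. e \<in> B y \<Longrightarrow> v \<in> e \<Longrightarrow> \<exists>j\<le>Suc k. (y, v) \<in> adj E ^^ j" if "y \<in> Y" for y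
            using Bu that by simp_all
          \<comment> \<open>The starting points that use \<open>e\<close> lie in a ball around one
            of its endpoints; this local finiteness allows infinitely many disjoint paths to be
            extracted.\<close>
          have loc: "finite {y\<in>Y. e \<in> B y}" for e
          proof (cases "e \<in> E")
            case True
            then obtain v where v: "v \<in> e" using edge_nonempty by blast
            have "{y\<in>Y. e \<in> B y} \<subseteq> (\<Union>j\<in>{..Suc k}. {y. (v, y) \<in> adj E ^^ j})"
            proof
              fix y assume "y \<in> {y\<in>Y. e \<in> B y}"
              then obtain j where "j \<le> Suc k" "(y, v) \<in> adj E ^^ j" using B(7)[of y e v] v by blast
              then show "y \<in> (\<Union>j\<in>{..Suc k}. {y. (v, y) \<in> adj E ^^ j})"
                using relpow_adj_sym[of y v j E] by blast
            qed
            moreover have "finite (\<Union>j\<in>{..Suc k}. {y. (v, y) \<in> adj E ^^ j})"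
              by (intro finite_UN_I finite_atMost finite_ball)
            ultimately show ?thesis by (rule finite_subset)
          next
            case False
            have "{y\<in>Y. e \<in> B y} = {}" using B(3) O_sub(1)[of c0] False by blast
            then show ?thesis by (simp only: finite.emptyI)
          qed
          obtain \<sigma> :: "nat \<Rightarrow> 'a" where \<sigma>: "\<And>i. \<sigma> i \<in> Y" "disjoint_family (\<lambda>i. B (\<sigma> i))"
            using infinite_disjoint_subfamily[OF False B(1) loc] by blast
          interpret L: bernoulli par "E\<^sub>2 \<times> {2}" by unfold_locales (auto simp: p_nonneg p_le_1)
          have "AE b\<^sub>2 in PiM (E\<^sub>2 \<times> {2}) Bern. \<exists>i. \<forall>j\<in>B (\<sigma> i) \<times> {2}. b\<^sub>2 j"
          proof (rule L.AE_some_block_open[where L = "Suc k" and s = s])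
            show "B (\<sigma> i) \<times> {2} \<subseteq> E\<^sub>2 \<times> {2}" for i using B(4)[OF \<sigma>(1)[of i]] by blast
            show "finite (B (\<sigma> i) \<times> {2})" for i using B(1)[OF \<sigma>(1)[of i]] by simp
            show "card (B (\<sigma> i) \<times> {2}) \<le> Suc k" for i using B(2)[OF \<sigma>(1)[of i]] by (simp add: card_cartesian_product)
            show "disjoint_family (\<lambda>i. B (\<sigma> i) \<times> {2::nat})" using \<sigma>(2) by (fastforce simp: disjoint_family_on_def)
            show "par j = s" if "j \<in> B (\<sigma> i) \<times> {2}" for i j using that by (auto simp: par_def)
          qed (use s_pos params in auto)
          then show ?thesis
          proof (rule AE_mp, intro AE_I2 impI)
            fix b\<^sub>2 :: "'a set \<times> nat \<Rightarrow> bool" assume "\<exists>i. \<forall>j\<in>B (\<sigma> i) \<times> {2}. b\<^sub>2 j"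
            then obtain i where i: "\<And>e. e \<in> B (\<sigma> i) \<Longrightarrow> b\<^sub>2 (e, 2)" by blast
            note Bi = B[OF \<sigma>(1)[of i]]
            \<comment> \<open>A block that layer 2 opens completely joins \<open>x\<close> to
              \<open>Z c0\<close>, which lies in \<open>N k c0\<close>; the cluster therefore cannot
              avoid that set.\<close>
            have "?Q (M b\<^sub>2)"
            proof (rule notI, elim conjE)
              assume "cl (M b\<^sub>2) x \<inter> N k (M b\<^sub>2) = {}"
              then have disj: "cl (M b\<^sub>2) x \<inter> N k c0 = {}" by (simp only: N_M)
              have "\<sigma> i \<in> D" using \<sigma>(1)[of i] by (simp add: Y_def)
              then have "conn (O\<^sub>2 (M b\<^sub>2)) x (\<sigma> i)" using cl_eq[OF disj] by blast
              moreover have "B (\<sigma> i) \<subseteq> O\<^sub>2 (M b\<^sub>2)"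
              proof
                fix e assume e: "e \<in> B (\<sigma> i)"
                then have e2: "e \<in> E\<^sub>2" "e \<in> O\<^sub>0 c0" using Bi(3,4) by blast+
                then have "a (e, 0)" using C(1)[OF E\<^sub>2_E(1)[OF e2(1)]] by (simp add: O\<^sub>0_def c0_def)
                then show "e \<in> O\<^sub>2 (M b\<^sub>2)" using M\<^sub>2[OF e2(1)] i[OF e] by simp
              qed
              then have "conn (O\<^sub>2 (M b\<^sub>2)) (\<sigma> i) (u (\<sigma> i))" by (rule conn_mono[OF Bi(6)])
              ultimately have "conn (O\<^sub>2 (M b\<^sub>2)) x (u (\<sigma> i))" by (rule conn_trans)
              moreover have "u (\<sigma> i) \<in> N k c0" using Bi(5) N_mono[of 0 k c0] unfolding N_0 by blast
              ultimately show False using disj by blast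
            qed
            then show "?Q (C (merge (E\<^sub>1 \<times> {2}) (E\<^sub>2 \<times> {2}) (b\<^sub>1, b\<^sub>2)))" unfolding M_def .
          qed
        qed
      qed
    qed
    then show "AE b in PiM (E \<times> {2}) Bern. ?Q (merge (E \<times> {..1}) (E \<times> {2}) (a, b))"
      unfolding C_def .
  qed
qed

text \<open>Uniqueness of the infinite cluster of \<open>O\<^sub>0\<close> puts a vertex of any
  infinite cluster of \<open>O\<^sub>2\<close> in some \<open>N m c\<close>. From there the radius
  descends: meeting \<open>N (Suc m) c\<close> means meeting it infinitely often, and sprinkling
  then excludes that \<open>N m c\<close> is missed. At radius 0 the cluster meets
  \<open>Z c\<close>, which is connected already in \<open>O\<^sub>1\<close>.\<close>

lemma O\<^sub>2_unique:
  "AE c in \<Omega>. U (O\<^sub>2 c) \<noteq> {} \<and> (\<forall>x\<in>U (O\<^sub>2 c). \<forall>y\<in>U (O\<^sub>2 c). conn (O\<^sub>2 c) x y)"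
proof -
  have near: "AE c in \<Omega>. \<forall>m. \<forall>x\<in>V. infinite (cl c x) \<longrightarrow> cl c x \<inter> N m c \<noteq> {} \<longrightarrow> infinite (cl c x \<inter> N m c)"
    unfolding AE_all_countable by (intro allI cluster_near_Z)
  have spr: "AE c in \<Omega>. \<forall>k. \<forall>x\<in>V. \<not> (cl c x \<inter> N k c = {} \<and> infinite (cl c x \<inter> N (Suc k) c))"
    unfolding AE_all_countable by (intro allI AE_ball_countable' countable_V sprinkling)
  show ?thesis
    using near spr Z_conn Z_infinite O\<^sub>0_unique
  proof eventually_elim
    fix c
    assume near: "\<forall>m. \<forall>x\<in>V. infinite (cl c x) \<longrightarrow> cl c x \<inter> N m c \<noteq> {} \<longrightarrow> infinite (cl c x \<inter> N m c)"
      and spr: "\<forall>k. \<forall>x\<in>V. \<not> (cl c x \<inter> N k c = {} \<and> infinite (cl c x \<inter> N (Suc k) c))"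
      and Zc: "\<forall>u\<in>Z c. \<forall>v\<in>Z c. conn (O\<^sub>1 c) u v" and Zi: "infinite (Z c)"
      and uniq: "\<forall>x\<in>U (O\<^sub>0 c). \<forall>y\<in>U (O\<^sub>0 c). conn (O\<^sub>0 c) x y"
    have Z_U: "z \<in> U X" if "z \<in> Z c" "O\<^sub>1 c \<subseteq> X" for z X
    proof -
      have "conn X z v" if "v \<in> Z c" for v using Zc \<open>z \<in> Z c\<close> that conn_mono[OF _ \<open>O\<^sub>1 c \<subseteq> X\<close>] by blast
      then have "Z c \<subseteq> {y. conn X z y}" by blast
      then have "infinite {y. conn X z y}" using Zi by (rule infinite_super)
      moreover have "z \<in> V" using that(1) Z_V by blast
      ultimately show ?thesis by (simp add: U_def)
    qed
    obtain z where z: "z \<in> Z c" using Zi infinite_imp_nonempty by blast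
    have meets: "cl c x \<inter> N m c \<noteq> {} \<Longrightarrow> cl c x \<inter> Z c \<noteq> {}" if x: "x \<in> V" "infinite (cl c x)" for x m
    proof (induction m)
      case 0
      then show ?case by (simp only: N_0) simp
    next
      case (Suc m)
      then have "infinite (cl c x \<inter> N (Suc m) c)" using near x by simp
      then have "cl c x \<inter> N m c \<noteq> {}" using bspec[OF spec[OF spr, of m] x(1)] by blast
      then show ?case by (rule Suc.IH)
    qed
    have to_z: "conn (O\<^sub>2 c) x z" if x: "x \<in> U (O\<^sub>2 c)" for x
    proof -
      have xV: "x \<in> V" "infinite (cl c x)" using x by (simp_all add: U_def)
      have "cl c x \<subseteq> {y. conn (O\<^sub>0 c) x y}" using conn_mono[OF _ O_sub(6)] by blast
      then have "x \<in> U (O\<^sub>0 c)" using xV infinite_super by (auto simp: U_def)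
      then have "conn (O\<^sub>0 c) x z" using uniq Z_U[OF z O_sub(4)] by simp
      then obtain m where "(x, z) \<in> adj (O\<^sub>0 c) ^^ m" unfolding rtrancl_power by blast
      then have "x \<in> N m c" using z xV(1) unfolding N_def by blast
      moreover have "x \<in> cl c x" by simp
      ultimately have "cl c x \<inter> Z c \<noteq> {}" by (intro meets[OF xV, of m]) blast
      then obtain v where v: "conn (O\<^sub>2 c) x v" "v \<in> Z c" by blast
      have "conn (O\<^sub>2 c) v z" using Zc v(2) z conn_mono[OF _ O_sub(5)] by blast
      with v(1) show ?thesis by (rule conn_trans)
    qed
    show "U (O\<^sub>2 c) \<noteq> {} \<and> (\<forall>x\<in>U (O\<^sub>2 c). \<forall>y\<in>U (O\<^sub>2 c). conn (O\<^sub>2 c) x y)"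
    proof (intro conjI ballI)
      show "U (O\<^sub>2 c) \<noteq> {}" using Z_U[OF z O_sub(5)] by blast
      fix x y assume "x \<in> U (O\<^sub>2 c)" "y \<in> U (O\<^sub>2 c)"
      then show "conn (O\<^sub>2 c) x y" using to_z[of x] conn_sym[OF to_z[of y]] by (meson conn_trans)
    qed
  qed
qed

end

section \<open>Lowering the percolation parameter\<close>

context cayley_graph
begin

lemma prob_space_bond: "prob_space (bond_percolation G S p)"
  unfolding bond_percolation_def by (intro prob_space_PiM prob_space_measure_pmf)

lemma pred_open: "e \<in> E \<Longrightarrow> Measurable.pred (bond_percolation G S p) (\<lambda>\<omega>. e \<in> {e\<in>E. \<omega> e})"
  using measurable_component_singleton[of e E "\<lambda>_. measure_pmf (bernoulli_pmf p)"]
  by (simp add: bond_percolation_def measurable_pmf_measure2)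

lemma no_edges_U: "U {} = {}"
  by (simp add: U_def adj_def)

definition unique_cluster :: "'a set set \<Rightarrow> bool" where
  "unique_cluster X \<longleftrightarrow> U X \<noteq> {} \<and> (\<forall>x\<in>U X. \<forall>y\<in>U X. conn X x y)"

lemma pred_unique_cluster:
  assumes "\<And>e. e \<in> E \<Longrightarrow> Measurable.pred M (\<lambda>c. e \<in> X c)" "\<And>c. X c \<subseteq> E"
  shows "Measurable.pred M (\<lambda>c. unique_cluster (X c))"
proof -
  have eq: "unique_cluster (X c) \<longleftrightarrow> (\<exists>x\<in>V. x \<in> U (X c)) \<and>
      (\<forall>x\<in>V. \<forall>y\<in>V. x \<in> U (X c) \<longrightarrow> y \<in> U (X c) \<longrightarrow> conn (X c) x y)" for c
    unfolding unique_cluster_def by (auto simp: U_def)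
  show ?thesis
    unfolding eq
    by (intro pred_intros_logic pred_Bex_countable pred_Ball_countable countable_V pred_U pred_conn assms)
qed

lemma uniqueness_phase_iff:
  "p \<in> uniqueness_phase G S \<longleftrightarrow>
     0 \<le> p \<and> p \<le> 1 \<and> (AE \<omega> in bond_percolation G S p. unique_cluster {e\<in>E. \<omega> e})"
  unfolding uniqueness_phase_def unique_infinite_cluster_iff unique_cluster_def by auto

text \<open>Without open edges all clusters are single vertices. This makes \<open>q\<close>
  positive, so that multiplying it by a factor below 1 lowers it strictly.\<close>

lemma zero_not_in_uniqueness_phase: "0 \<notin> uniqueness_phase G S"
proof
  assume "0 \<in> uniqueness_phase G S"
  then have uc: "AE \<omega> in bond_percolation G S 0. unique_cluster {e\<in>E. \<omega> e}"
    by (simp add: uniqueness_phase_iff)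
  have "AE b in measure_pmf (bernoulli_pmf 0). \<not> b"
    by (auto simp: AE_measure_pmf_iff set_pmf_iff)
  then have "AE \<omega> in bond_percolation G S 0. \<forall>e\<in>E. \<not> \<omega> e"
    unfolding bond_percolation_def
    by (intro AE_ball_countable' countable_E AE_PiM_component prob_space_measure_pmf)
  with uc have "AE \<omega> in bond_percolation G S 0. False"
  proof eventually_elim
    fix \<omega> assume *: "unique_cluster {e\<in>E. \<omega> e}" "\<forall>e\<in>E. \<not> \<omega> e"
    then have "{e\<in>E. \<omega> e} = {}" by blast
    with *(1) show False by (simp add: unique_cluster_def no_edges_U)
  qed
  then show False using prob_space.AE_False[OF prob_space_bond] by blast
qed

text \<open>In the uniqueness phase both representatives lie in the one infinite cluster, so a
  finite open path joins them, and it is contained in one of an increasing sequence of finite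
  windows. Up to \<delta>, connection thus depends on finitely many edges surviving the
  thinning.\<close>

lemma finite_window:
  assumes p: "p \<in> uniqueness_phase G S" and xy: "x \<in> V" "y \<in> V" and "0 < \<delta>"
  obtains J where "finite J" "J \<subseteq> E"
    "measure (bond_percolation G S p) {\<omega>\<in>space (bond_percolation G S p).
       \<not> conn {e\<in>J. \<omega> e} (\<pi> {e\<in>E. \<omega> e} x) (\<pi> {e\<in>E. \<omega> e} y)} < \<delta>"
proof -
  let ?M = "bond_percolation G S p"
  interpret prob_space ?M by (rule prob_space_bond)
  \<comment> \<open>The intersection with \<open>E\<close> guards against the arbitrary values of
    \<open>from_nat_into\<close> when \<open>E\<close> is empty.\<close>
  define En where "En n = from_nat_into E ` {..<n} \<inter> E" for n
  have En: "finite (En n)" "En n \<subseteq> E" for n by (auto simp: En_def)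
  have En_mono: "En m \<subseteq> En n" if "m \<le> n" for m n using that by (auto simp: En_def)
  have En_ex: "\<exists>n. e \<in> En n" if e: "e \<in> E" for e
  proof -
    obtain i where i: "e = from_nat_into E i" using from_nat_into_surj[OF countable_E e] by metis
    then show ?thesis using e by (intro exI[of _ "Suc i"]) (auto simp: En_def)
  qed
  let ?c = "\<lambda>J \<omega>. conn {e\<in>J. \<omega> e} (\<pi> {e\<in>E. \<omega> e} x) (\<pi> {e\<in>E. \<omega> e} y)"
  have pred_c: "Measurable.pred ?M (?c J)" if J: "J \<subseteq> E" for J
  proof (intro pred_conn_\<pi> xy)
    show "Measurable.pred ?M (\<lambda>\<omega>. e \<in> {e\<in>E. \<omega> e})" if "e \<in> E" for e using that by (rule pred_open)
    show "Measurable.pred ?M (\<lambda>\<omega>. e \<in> {e\<in>J. \<omega> e})" if "e \<in> E" for e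
    proof (cases "e \<in> J")
      case True
      then show ?thesis using pred_open[OF that] that by simp
    qed simp
  qed (use J in auto)
  define W where "W n = {\<omega>\<in>space ?M. ?c (En n) \<omega>}" for n
  have W: "W n \<in> events" for n using pred_c[OF En(2)] by (simp add: W_def pred_def)
  have "incseq W"
  proof (intro monoI)
    fix m n :: nat assume "m \<le> n"
    then have sub: "{e\<in>En m. \<omega> e} \<subseteq> {e\<in>En n. \<omega> e}" for \<omega> using En_mono by blast
    have "?c (En n) \<omega>" if "?c (En m) \<omega>" for \<omega> by (rule conn_mono[OF that sub])
    then show "W m \<subseteq> W n" unfolding W_def by (intro Collect_mono impI) (elim conjE, intro conjI)
  qed
  have UN: "(\<Union>n. W n) = {\<omega>\<in>space ?M. ?c E \<omega>}"
  proof (intro equalityI subsetI)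
    fix \<omega> assume "\<omega> \<in> (\<Union>n. W n)"
    then obtain n where n: "\<omega> \<in> space ?M" "?c (En n) \<omega>" by (auto simp: W_def)
    have "{e\<in>En n. \<omega> e} \<subseteq> {e\<in>E. \<omega> e}" using En(2) by blast
    then have "?c E \<omega>" by (rule conn_mono[OF n(2)])
    with n(1) show "\<omega> \<in> {\<omega>\<in>space ?M. ?c E \<omega>}" by simp
  next
    fix \<omega> assume \<omega>: "\<omega> \<in> {\<omega>\<in>space ?M. ?c E \<omega>}"
    then obtain k where "(\<pi> {e\<in>E. \<omega> e} x, \<pi> {e\<in>E. \<omega> e} y) \<in> adj {e\<in>E. \<omega> e} ^^ k"
      unfolding rtrancl_power by blast
    then obtain B where B: "finite B" "B \<subseteq> {e\<in>E. \<omega> e}" "conn B (\<pi> {e\<in>E. \<omega> e} x) (\<pi> {e\<in>E. \<omega> e} y)"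
      by (rule path_edges)
    have "\<exists>n. B \<subseteq> En n"
      using B(1,2)
    proof (induction B rule: finite_induct)
      case (insert e B)
      then obtain n m where "B \<subseteq> En n" "e \<in> En m" using En_ex[of e] by auto
      then have "insert e B \<subseteq> En (max n m)" using En_mono[of n "max n m"] En_mono[of m "max n m"] by auto
      then show ?case by blast
    qed simp
    then obtain n where "B \<subseteq> En n" by blast
    then have "B \<subseteq> {e\<in>En n. \<omega> e}" using B(2) by blast
    then have "?c (En n) \<omega>" by (rule conn_mono[OF B(3)])
    then show "\<omega> \<in> (\<Union>n. W n)" using \<omega> by (auto simp: W_def)
  qed
  have "AE \<omega> in ?M. unique_cluster {e\<in>E. \<omega> e}" using p by (simp add: uniqueness_phase_iff)
  then have "AE \<omega> in ?M. \<omega> \<in> (\<Union>n. W n)"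
    unfolding UN
    by (rule AE_mp, intro AE_I2 impI) (simp add: unique_cluster_def \<pi>_U xy)
  then have "prob (\<Union>n. W n) = 1" using W by (subst prob_eq_1) auto
  then have "(\<lambda>n. prob (W n)) \<longlonglongrightarrow> 1"
    using finite_Lim_measure_incseq[of W] W \<open>incseq W\<close> by auto
  then have "\<forall>\<^sub>F n in sequentially. 1 - \<delta> < prob (W n)"
    using \<open>0 < \<delta>\<close> by (intro order_tendstoD(1)) auto
  then obtain n where n: "1 - \<delta> < prob (W n)" by (auto simp: eventually_sequentially)
  have "{\<omega>\<in>space ?M. \<not> ?c (En n) \<omega>} = space ?M - W n" by (auto simp: W_def)
  then have "prob {\<omega>\<in>space ?M. \<not> ?c (En n) \<omega>} = 1 - prob (W n)" using prob_compl[OF W] by simp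
  with n show thesis by (intro that[of "En n"] En) simp
qed

end

section \<open>Laws of the layers\<close>

context percolation
begin

lemma distr_layer_0:
  "distr \<Omega> (bond_percolation G S q) (\<lambda>c. \<lambda>e\<in>E. c (e, 0)) = bond_percolation G S q"
proof -
  have "distr \<Omega> (PiM E (\<lambda>e. Bern (e, 0))) (\<lambda>c. \<lambda>e\<in>E. c (e, 0)) = PiM E (\<lambda>e. Bern (e, 0))"
    by (rule distr_PiM_reindex) (auto simp: inj_on_def prob_space_measure_pmf)
  then show ?thesis by (simp add: bond_percolation_def par_def)
qed

lemma measurable_layer_0: "(\<lambda>c. \<lambda>e\<in>E. c (e, 0)) \<in> measurable \<Omega> (bond_percolation G S q)"
  unfolding bond_percolation_def
  by (rule measurable_restrict) (use pred_coordinate in \<open>simp add: measurable_pmf_measure2\<close>)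

lemma layer_0_open: "{e\<in>E. (\<lambda>e\<in>E. c (e, 0)) e} = O\<^sub>0 c"
  by (auto simp: O\<^sub>0_def)

lemma O\<^sub>0_unique_cluster:
  assumes "q \<in> uniqueness_phase G S"
  shows "AE c in \<Omega>. unique_cluster (O\<^sub>0 c)"
proof -
  have "AE \<omega> in distr \<Omega> (bond_percolation G S q) (\<lambda>c. \<lambda>e\<in>E. c (e, 0)). unique_cluster {e\<in>E. \<omega> e}"
    using assms unfolding distr_layer_0 by (simp add: uniqueness_phase_iff)
  from AE_distrD[OF measurable_layer_0 this] show ?thesis unfolding layer_0_open .
qed

text \<open>A connection inside the window survives if no edge of \<open>J\<close> is deleted by
  layer 1. The union bound charges \<open>1 - r\<close> for each of these edges.\<close>

lemma d_le_window:
  assumes xy: "x \<in> V" "y \<in> V" and J: "finite J" "J \<subseteq> E"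
    and win: "measure (bond_percolation G S q) {\<omega>\<in>space (bond_percolation G S q).
       \<not> conn {e\<in>J. \<omega> e} (\<pi> {e\<in>E. \<omega> e} x) (\<pi> {e\<in>E. \<omega> e} y)} \<le> \<delta>"
  shows "d x y \<le> \<delta> + card J * (1 - r)"
proof -
  let ?W = "{\<omega>\<in>space (bond_percolation G S q).
       \<not> conn {e\<in>J. \<omega> e} (\<pi> {e\<in>E. \<omega> e} x) (\<pi> {e\<in>E. \<omega> e} y)}"
  let ?l = "\<lambda>c. \<lambda>e\<in>E. c (e, 0)"
  let ?A = "?l -` ?W \<inter> space \<Omega>"
  let ?B = "\<lambda>e. {c\<in>space \<Omega>. \<not> c (e, 1)}"
  have W: "?W \<in> sets (bond_percolation G S q)"
  proof -
    have "Measurable.pred (bond_percolation G S q) (\<lambda>\<omega>. conn {e\<in>J. \<omega> e} (\<pi> {e\<in>E. \<omega> e} x) (\<pi> {e\<in>E. \<omega> e} y))"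
    proof (intro pred_conn_\<pi> xy)
      show "Measurable.pred (bond_percolation G S q) (\<lambda>\<omega>. e \<in> {e\<in>E. \<omega> e})" if "e \<in> E" for e
        using that by (rule pred_open)
      show "Measurable.pred (bond_percolation G S q) (\<lambda>\<omega>. e \<in> {e\<in>J. \<omega> e})" if "e \<in> E" for e
        using pred_open[OF that] that by (cases "e \<in> J") simp_all
    qed (use J in auto)
    then have "Measurable.pred (bond_percolation G S q) (\<lambda>\<omega>. \<not> conn {e\<in>J. \<omega> e} (\<pi> {e\<in>E. \<omega> e} x) (\<pi> {e\<in>E. \<omega> e} y))"
      by (rule pred_intros_logic)
    then show ?thesis unfolding pred_def .
  qed
  have A: "?A \<in> P.events" using measurable_sets[OF measurable_layer_0 W] .
  have "P.prob ?A = measure (distr \<Omega> (bond_percolation G S q) ?l) ?W"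
    by (rule measure_distr[OF measurable_layer_0 W, symmetric])
  then have prob_A: "P.prob ?A \<le> \<delta>" using win by (simp only: distr_layer_0)
  have B: "?B e \<in> P.events" "P.prob (?B e) = 1 - r" if "e \<in> J" for e
  proof -
    have e1: "(e, 1) \<in> ind" using that J by auto
    have "?B e = {c\<in>space \<Omega>. c (e, 1) \<in> {False}}" by auto
    moreover have "emeasure \<Omega> {c\<in>space \<Omega>. c (e, 1) \<in> {False}} = emeasure (Bern (e, 1)) {False}"
      using e1 by (intro emeasure_PiM_Collect_single) auto
    moreover have "emeasure (Bern (e, 1)) {False} = ennreal (1 - r)"
      using params by (simp add: emeasure_pmf_single par_def)
    ultimately show "P.prob (?B e) = 1 - r"
      using params by (simp add: measure_def)
    show "?B e \<in> P.events" using pred_coordinate[OF e1] by (simp add: pred_def)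
  qed
  have "{c\<in>space \<Omega>. \<not> rel c x y} \<subseteq> ?A \<union> (\<Union>e\<in>J. ?B e)"
  proof (rule subsetI, rule ccontr)
    fix c assume c: "c \<in> {c\<in>space \<Omega>. \<not> rel c x y}" and n: "c \<notin> ?A \<union> (\<Union>e\<in>J. ?B e)"
    have "?l c \<in> space (bond_percolation G S q)"
      using c measurable_space[OF measurable_layer_0] by auto
    then have "conn {e\<in>J. ?l c e} (\<pi> {e\<in>E. ?l c e} x) (\<pi> {e\<in>E. ?l c e} y)" using c n by auto
    then have "conn {e\<in>J. ?l c e} (\<pi> (O\<^sub>0 c) x) (\<pi> (O\<^sub>0 c) y)" unfolding layer_0_open .
    moreover have "{e\<in>J. ?l c e} \<subseteq> O\<^sub>1 c" using J n c by (auto simp: O\<^sub>1_def)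
    ultimately have "rel c x y" unfolding rel_def by (rule conn_mono)
    with c show False by simp
  qed
  then have "d x y \<le> P.prob (?A \<union> (\<Union>e\<in>J. ?B e))"
    unfolding d_def using A B(1) J(1) by (intro P.finite_measure_mono sets.Un sets.finite_UN)
  also have "\<dots> \<le> P.prob ?A + P.prob (\<Union>e\<in>J. ?B e)"
    using A B(1) J(1) by (intro measure_Un_le sets.finite_UN)
  also have "P.prob (\<Union>e\<in>J. ?B e) \<le> (\<Sum>e\<in>J. P.prob (?B e))"
    using B(1) J(1) by (intro P.finite_measure_subadditive_finite) auto
  also have "(\<Sum>e\<in>J. P.prob (?B e)) = card J * (1 - r)" using B(2) by simp
  finally show ?thesis using prob_A by linarith
qed

definition layer_2 :: "('a set \<times> nat \<Rightarrow> bool) \<Rightarrow> 'a set \<Rightarrow> bool" where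
  "layer_2 c e \<longleftrightarrow> c (e, 0) \<and> (c (e, 1) \<or> c (e, 2))"

lemma measurable_layer_2:
  assumes "e \<in> E" "{e} \<times> {..2} \<subseteq> L"
  shows "(\<lambda>c. layer_2 c e) \<in> measurable (PiM L Bern) (count_space UNIV)"
proof -
  have "Measurable.pred (PiM L Bern) (\<lambda>c. c (e, l))" if "l \<le> 2" for l
    using measurable_component_singleton[of "(e, l)" L Bern] that assms(2)
    by (simp add: measurable_pmf_measure2 subset_iff)
  then show ?thesis unfolding layer_2_def by (intro pred_intros_logic) auto
qed

text \<open>Inclusion-exclusion for the two ways in which an edge open in layer 0 stays open,
  through layer 1 or through layer 2, gives \<open>q * r + q * s - q * r * s\<close>.\<close>

lemma distr_layer_2_edge:
  assumes e: "e \<in> E"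
  shows "distr \<Omega> (measure_pmf (bernoulli_pmf (q * (r + s - r * s)))) (\<lambda>c. layer_2 c e) =
    measure_pmf (bernoulli_pmf (q * (r + s - r * s)))"
proof -
  let ?p = "q * (r + s - r * s)"
  have rs: "0 \<le> r + s - r * s" "r + s - r * s \<le> 1"
  proof -
    have "0 \<le> (1 - r) * (1 - s)" "0 \<le> s * (1 - r)" using params by auto
    then show "r + s - r * s \<le> 1" "0 \<le> r + s - r * s" using params by (auto simp: algebra_simps)
  qed
  have p: "0 \<le> ?p" "?p \<le> 1" using params rs mult_le_one[of q "r + s - r * s"] by auto
  have meas: "(\<lambda>c. layer_2 c e) \<in> measurable \<Omega> (count_space UNIV)"
    using e by (intro measurable_layer_2) auto
  have prob_True: "\<P>(c in \<Omega>. layer_2 c e) = ?p"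
  proof -
    let ?x = "\<lambda>L c. \<Prod>j\<in>L. of_bool (c j) :: real"
    let ?L1 = "{(e, 0), (e, 1::nat)}" and ?L2 = "{(e, 0), (e, 2::nat)}" and ?L3 = "{(e, 0), (e, 1), (e, 2::nat)}"
    have int: "integrable \<Omega> (?x L)" "(\<integral>c. ?x L c \<partial>\<Omega>) = (\<Prod>j\<in>L. par j)" if "L \<subseteq> {e} \<times> {..2}" for L
    proof -
      have L: "finite L" "L \<subseteq> ind" using that e finite_subset[OF that] by auto
      show "integrable \<Omega> (?x L)" by (rule integrable_coordinate_prod(1)[OF L])
      show "(\<integral>c. ?x L c \<partial>\<Omega>) = (\<Prod>j\<in>L. par j)"
        using integrable_coordinate_prod(2)[OF L, of "\<lambda>_ b. of_bool b"] by simp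
    qed
    have L: "?L1 \<subseteq> {e} \<times> {..2}" "?L2 \<subseteq> {e} \<times> {..2}" "?L3 \<subseteq> {e} \<times> {..2}" by auto
    have "\<P>(c in \<Omega>. layer_2 c e) = (\<integral>c. indicator {c\<in>space \<Omega>. layer_2 c e} c \<partial>\<Omega>)"
      using meas by (simp add: pred_def)
    also have "\<dots> = (\<integral>c. ?x ?L1 c + ?x ?L2 c - ?x ?L3 c \<partial>\<Omega>)"
      by (intro Bochner_Integration.integral_cong) (auto simp: layer_2_def indicator_def)
    also have "\<dots> = (\<Prod>j\<in>?L1. par j) + (\<Prod>j\<in>?L2. par j) - (\<Prod>j\<in>?L3. par j)"
      using int(1)[OF L(1)] int(1)[OF L(2)] int(1)[OF L(3)] int(2)[OF L(1)] int(2)[OF L(2)] int(2)[OF L(3)]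
      by (simp only: Bochner_Integration.integral_diff Bochner_Integration.integral_add Bochner_Integration.integrable_add)
    also have "\<dots> = ?p" by (simp add: par_def algebra_simps)
    finally show ?thesis .
  qed
  have prob_False: "\<P>(c in \<Omega>. \<not> layer_2 c e) = 1 - ?p"
    using prob_True meas by (subst P.prob_neg) (auto simp: pred_def)
  show ?thesis
  proof (rule measure_eqI_finite[where A = UNIV])
    show "sets (distr \<Omega> (measure_pmf (bernoulli_pmf ?p)) (\<lambda>c. layer_2 c e)) = Pow UNIV" by simp
    show "sets (measure_pmf (bernoulli_pmf ?p)) = Pow UNIV" by simp
    fix b :: bool
    have "emeasure (distr \<Omega> (measure_pmf (bernoulli_pmf ?p)) (\<lambda>c. layer_2 c e)) {b} =
        emeasure \<Omega> ((\<lambda>c. layer_2 c e) -` {b} \<inter> space \<Omega>)"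
      using meas by (intro emeasure_distr) (simp_all add: measurable_pmf_measure2)
    also have "(\<lambda>c. layer_2 c e) -` {b} \<inter> space \<Omega> = {c\<in>space \<Omega>. if b then layer_2 c e else \<not> layer_2 c e}" by auto
    also have "emeasure \<Omega> \<dots> = ennreal (if b then ?p else 1 - ?p)"
      using prob_True prob_False by (cases b) (simp_all add: P.emeasure_eq_measure)
    also have "\<dots> = emeasure (measure_pmf (bernoulli_pmf ?p)) {b}"
      using p by (cases b) (simp_all add: emeasure_pmf_single)
    finally show "emeasure (distr \<Omega> (measure_pmf (bernoulli_pmf ?p)) (\<lambda>c. layer_2 c e)) {b} =
      emeasure (measure_pmf (bernoulli_pmf ?p)) {b}" .
  qed simp
qed

lemma distr_layer_2:
  assumes "E \<noteq> {}"
  shows "distr \<Omega> (bond_percolation G S (q * (r + s - r * s))) (\<lambda>c. \<lambda>e\<in>E. layer_2 c e) =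
    bond_percolation G S (q * (r + s - r * s))"
proof -
  let ?p = "q * (r + s - r * s)"
  let ?M = "\<lambda>_ :: 'a set. measure_pmf (bernoulli_pmf ?p)"
  have rv: "P.random_variable (?M e) (\<lambda>c. layer_2 c e)" if "e \<in> E" for e
    using measurable_layer_2[of e ind] that by (auto simp: measurable_pmf_measure2)
  have "P.indep_vars ?M (\<lambda>e c. layer_2 (restrict c ({e} \<times> {..2})) e) E"
  proof (rule P.indep_vars_compose2[OF P.indep_vars_restrict[OF indep_vars_coordinates, of E "\<lambda>e. {e} \<times> {..2}"]])
    show "(\<lambda>c. layer_2 c e) \<in> measurable (PiM ({e} \<times> {..2}) Bern) (?M e)" if "e \<in> E" for e
      using measurable_layer_2[of e "{e} \<times> {..2}"] that by (auto simp: measurable_pmf_measure2)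
  qed (auto simp: disjoint_family_on_def)
  then have "P.indep_vars ?M (\<lambda>e c. layer_2 c e) E" by (simp add: layer_2_def)
  then have "distr \<Omega> (PiM E ?M) (\<lambda>c. \<lambda>e\<in>E. layer_2 c e) = PiM E (\<lambda>e. distr \<Omega> (?M e) (\<lambda>c. layer_2 c e))"
    by (subst (asm) P.indep_vars_iff_distr_eq_PiM'[OF assms rv]) auto
  also have "\<dots> = PiM E ?M" by (intro PiM_cong refl distr_layer_2_edge)
  finally show ?thesis by (simp only: bond_percolation_def)
qed

lemma uniqueness_phase_layer_2:
  assumes "E \<noteq> {}" and "AE c in \<Omega>. unique_cluster (O\<^sub>2 c)" and "0 \<le> q * (r + s - r * s)" "q * (r + s - r * s) \<le> 1"
  shows "q * (r + s - r * s) \<in> uniqueness_phase G S"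
proof -
  let ?p = "q * (r + s - r * s)"
  let ?l = "\<lambda>c. \<lambda>e\<in>E. layer_2 c e"
  have l: "?l \<in> measurable \<Omega> (bond_percolation G S ?p)"
    unfolding bond_percolation_def
    by (rule measurable_restrict) (use measurable_layer_2[of _ ind] in \<open>auto simp: measurable_pmf_measure2\<close>)
  have eq: "{e\<in>E. ?l c e} = O\<^sub>2 c" for c by (auto simp: O\<^sub>2_def layer_2_def)
  have "Measurable.pred (bond_percolation G S ?p) (\<lambda>\<omega>. unique_cluster {e\<in>E. \<omega> e})"
    by (rule pred_unique_cluster) (erule pred_open, blast)
  then have "{\<omega>\<in>space (bond_percolation G S ?p). unique_cluster {e\<in>E. \<omega> e}} \<in> sets (bond_percolation G S ?p)"
    by (simp only: pred_def)
  from AE_distr_iff[OF l this] have "AE \<omega> in distr \<Omega> (bond_percolation G S ?p) ?l. unique_cluster {e\<in>E. \<omega> e}"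
    unfolding eq using assms(2) by simp
  then show ?thesis unfolding distr_layer_2[OF assms(1)] using assms(3,4) by (simp add: uniqueness_phase_iff)
qed

end

section \<open>A smaller parameter in the uniqueness phase\<close>

context cayley_graph
begin

text \<open>The order of choices is decisive. Failure of Reiter's condition for \<open>H\<close>
  supplies \<open>F\<close> and \<open>e\<close>, which determine \<open>C\<close> and then \<eta>;
  only afterwards are the windows and \<open>r\<close> chosen, so that \<open>d \<one> x\<close> is
  at most \<eta> on the finite set of generators and elements of \<open>F\<close>.\<close>

lemma uniqueness_below:
  assumes q: "q \<in> uniqueness_phase G S"
    and H: "finitely_generated_subgroup G H" and K: "finitely_generated_subgroup G K"
    and comm: "commuting_subsets G H K" and gen: "generate G (H \<union> K) = V" and "infinite K"
    and na: "\<not> almost_invariant_measures G H"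
  obtains p where "p \<in> uniqueness_phase G S" "p < q"
proof -
  obtain A where A: "subgroup H G" "finite A" "A \<subseteq> V" "generate G A = H"
    using H by (auto simp: finitely_generated_subgroup_def)
  obtain B where B: "subgroup K G" "finite B" "B \<subseteq> V" "generate G B = K"
    using K by (auto simp: finitely_generated_subgroup_def)
  have HV: "H \<subseteq> V" using A(1) by (rule subgroup.subset)
  have q01: "0 \<le> q" "q \<le> 1" using q by (auto simp: uniqueness_phase_iff)
  have q0: "0 < q" using q q01 zero_not_in_uniqueness_phase by (cases "q = 0") auto
  obtain F e where F: "finite F" "F \<subseteq> H" "0 < (e::real)"
    and not_ai: "\<And>\<nu>. set_pmf \<nu> \<subseteq> V \<Longrightarrow>
      \<exists>h\<in>F. \<exists>A. e < \<bar>measure_pmf.prob \<nu> {x. h \<otimes> x \<in> A} - measure_pmf.prob \<nu> A\<bar>"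
    using na unfolding almost_invariant_measures_def by (auto simp: not_le)
  have FV: "F \<subseteq> V" using F(2) HV by (rule subset_trans)
  define C where "C = 4 / e\<^sup>2"
  have C: "0 \<le> C" by (simp add: C_def)
  \<comment> \<open>Chosen so that \<open>20 * (C * card F * \<eta>) + \<eta>\<close> equals
    \<open>1 / 8\<close>, below the bound \<open>1 / 4\<close> required for uniform
    connectivity.\<close>
  define \<eta> where "\<eta> = 1 / (8 * (20 * (C * card F) + 1))"
  have pos: "0 < 20 * (C * card F) + 1" using C by (simp add: add_nonneg_pos)
  then have \<eta>: "0 < \<eta>" by (simp add: \<eta>_def)
  have "20 * (C * card F * \<eta>) + \<eta> = (20 * (C * card F) + 1) * \<eta>" by (simp add: algebra_simps)
  also have "\<dots> = 1 / 8" using pos by (simp add: \<eta>_def)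
  finally have \<eta>_small: "20 * (C * card F * \<eta>) + \<eta> < 1 / 4" by simp
  have "0 \<le> 20 * (C * card F * \<eta>)" using C \<eta> by simp
  with \<eta>_small have "\<eta> \<le> 1" by linarith
  let ?T = "F \<union> A \<union> B"
  have T: "finite ?T" "?T \<subseteq> V" using F A B FV by auto
  have "\<forall>x\<in>?T. \<exists>J. finite J \<and> J \<subseteq> E \<and>
    measure (bond_percolation G S q) {\<omega>\<in>space (bond_percolation G S q).
       \<not> conn {e\<in>J. \<omega> e} (\<pi> {e\<in>E. \<omega> e} \<one>) (\<pi> {e\<in>E. \<omega> e} x)} < \<eta> / 2"
  proof
    fix x assume "x \<in> ?T"
    then have "x \<in> V" using T(2) by blast
    show "\<exists>J. finite J \<and> J \<subseteq> E \<and> measure (bond_percolation G S q) {\<omega>\<in>space (bond_percolation G S q).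
       \<not> conn {e\<in>J. \<omega> e} (\<pi> {e\<in>E. \<omega> e} \<one>) (\<pi> {e\<in>E. \<omega> e} x)} < \<eta> / 2"
      by (rule finite_window[OF q one_closed \<open>x \<in> V\<close>, of "\<eta> / 2"]) (use \<eta> in simp, blast)
  qed
  from bchoice[OF this] obtain J where J: "\<forall>x\<in>?T. finite (J x) \<and> J x \<subseteq> E \<and>
    measure (bond_percolation G S q) {\<omega>\<in>space (bond_percolation G S q).
       \<not> conn {e\<in>J x. \<omega> e} (\<pi> {e\<in>E. \<omega> e} \<one>) (\<pi> {e\<in>E. \<omega> e} x)} < \<eta> / 2"
    by (elim exE)
  define L where "L = (\<Sum>x\<in>?T. card (J x))"
  \<comment> \<open>The sum \<open>L\<close> dominates the size of each window, so one density
    serves all of them: deletions cost at most \<open>\<eta> / 2\<close> and the window error is the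
    other half. Adding 1 avoids division by zero.\<close>
  define r where "r = 1 - \<eta> / (2 * (real L + 1))"
  have r: "0 \<le> r" "r < 1"
  proof -
    have "\<eta> / (2 * (real L + 1)) \<le> 1" using \<open>\<eta> \<le> 1\<close> by (simp add: divide_le_eq)
    moreover have "0 < \<eta> / (2 * (real L + 1))" using \<eta> by simp
    ultimately show "0 \<le> r" "r < 1" by (simp_all add: r_def)
  qed
  \<comment> \<open>Restoring a deleted edge with probability one half yields the parameter
    \<open>q * (1 + r) / 2\<close>, which is below \<open>q\<close>.\<close>
  define s :: real where "s = 1 / 2"
  interpret percolation G S q r s
    by unfold_locales (use q01 r in \<open>auto simp: s_def\<close>)
  have small: "d \<one> x \<le> \<eta>" if x: "x \<in> ?T" for x
  proof -
    have xV: "x \<in> V" using x T(2) by blast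
    have "d \<one> x \<le> \<eta> / 2 + card (J x) * (1 - r)"
      using bspec[OF J x] by (intro d_le_window xV one_closed) (elim conjE, simp)+
    also have "card (J x) * (1 - r) \<le> L * (1 - r)"
    proof (intro mult_right_mono)
      show "real (card (J x)) \<le> real L"
        unfolding L_def using T(1) x by (intro of_nat_mono member_le_sum) auto
    qed (use r in simp)
    also have "L * (1 - r) \<le> \<eta> / 2"
    proof -
      have "L * (1 - r) = \<eta> / 2 * (real L / (real L + 1))" by (simp add: r_def field_simps)
      also have "\<dots> \<le> \<eta> / 2 * 1" using \<eta> by (intro mult_left_mono) auto
      finally show ?thesis by simp
    qed
    finally show ?thesis by simp
  qed
  have gap: "P.prob D * (1 - P.prob D) \<le> C * (\<Sum>h\<in>F. P.prob (sym_diff D (act h -` D \<inter> space \<Omega>)))"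
    if "D \<in> P.events" for D
    unfolding C_def by (rule percolation_gap[OF F(1) FV F(3) not_ai that])
  have unif: "d \<one> g < 1 / 4" if "g \<in> V" for g
    by (rule uniform_connectivity[OF A(1,4) B(1,4) comm gen \<open>infinite K\<close> F(1,2) C gap small _ \<eta>_small that])
      (use \<eta> in auto)
  have unif': "\<forall>g\<in>V. d \<one> g < 1 / 4" by (rule ballI) (rule unif)
  have gap': "\<forall>D\<in>P.events. P.prob D * (1 - P.prob D) \<le>
      C * (\<Sum>h\<in>F. P.prob (sym_diff D (act h -` D \<inter> space \<Omega>)))"
    by (rule ballI) (rule gap)
  have uc0: "AE c in \<Omega>. unique_cluster (O\<^sub>0 c)" by (rule O\<^sub>0_unique_cluster[OF q])
  obtain hv where hv: "\<forall>x\<in>V. Measurable.pred \<Omega> (\<lambda>c. hv c x)"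
    "AE c in \<Omega>. \<forall>x\<in>V. \<forall>y\<in>V. hv c x \<longrightarrow> hv c y \<longrightarrow> rel c x y"
    "AE c in \<Omega>. \<exists>x\<in>V. hv c x"
    "\<forall>g\<in>V. AE c in \<Omega>. \<forall>x\<in>V. hv (act g c) x \<longleftrightarrow> hv c (g \<otimes> x)"
    "\<forall>c c'. O\<^sub>0 c = O\<^sub>0 c' \<longrightarrow> O\<^sub>1 c = O\<^sub>1 c' \<longrightarrow> hv c = hv c'"
    using heavy_class[OF unif' FV gap'] by (elim exE conjE)
  interpret heavy_percolation G S q r s hv
  proof
    show "AE c in \<Omega>. \<forall>x\<in>U (O\<^sub>0 c). \<forall>y\<in>U (O\<^sub>0 c). conn (O\<^sub>0 c) x y"
      using uc0 by (rule AE_mp) (intro AE_I2 impI, unfold unique_cluster_def, elim conjE)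
    show "0 < s" by (simp add: s_def)
  qed (fact hv bspec[OF hv(1)] bspec[OF hv(4)] | use hv(5) in blast)+
  have "E \<noteq> {}"
  proof
    assume "E = {}"
    then have "O\<^sub>0 c = {}" for c by (simp add: O\<^sub>0_def)
    then have "AE c in \<Omega>. False" using uc0 by (simp add: unique_cluster_def no_edges_U)
    then show False using P.AE_False by blast
  qed
  have rs: "r + s - r * s = (1 + r) / 2" by (simp add: s_def field_simps)
  have lt: "q * (r + s - r * s) < q" unfolding rs using q0 r by (simp add: field_simps)
  have "q * (r + s - r * s) \<in> uniqueness_phase G S"
  proof (rule uniqueness_phase_layer_2[OF \<open>E \<noteq> {}\<close>])
    show "AE c in \<Omega>. unique_cluster (O\<^sub>2 c)" using O\<^sub>2_unique by (simp only: unique_cluster_def)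
    show "0 \<le> q * (r + s - r * s)" unfolding rs using q0 r by simp
    show "q * (r + s - r * s) \<le> 1" using lt q01 by simp
  qed
  then show thesis using lt by (rule that)
qed

end

theorem theorem2p1:
  fixes G :: "('a, 'b) monoid_scheme" and H K :: "'a set"
  assumes "group G"
    and "\<not> amenable G"
    and "finitely_generated_subgroup G H" and "infinite H"
    and "finitely_generated_subgroup G K" and "infinite K"
    and "commuting_subsets G H K"
    and "generate G (H \<union> K) = carrier G"
  shows "\<forall>S. finite_generating_set G S \<longrightarrow> p_u G S \<notin> uniqueness_phase G S"
proof (intro allI impI notI)
  fix S assume S: "finite_generating_set G S" and pu: "p_u G S \<in> uniqueness_phase G S"
  interpret group G by fact
  have H: "subgroup H G" and K: "subgroup K G"
    using assms(3,5) by (auto simp: finitely_generated_subgroup_def)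
  have "infinite (carrier G)"
    using infinite_super[OF subgroup.subset[OF H] assms(4)] .
  with S interpret cayley_graph G S by unfold_locales
  have comm: "commuting_subsets G K H" using assms(7) by (simp add: commuting_subsets_def)
  have gen: "generate G (K \<union> H) = carrier G" using assms(8) by (simp add: Un_commute)
  \<comment> \<open>The two subgroups are interchangeable: whichever is non-amenable supplies the
    gap, and the other one, being infinite, supplies the mixing.\<close>
  obtain p where p: "p \<in> uniqueness_phase G S" "p < p_u G S"
    using nonamenable_commuting_factor[OF H K assms(7,8,2)]
  proof
    assume "\<not> almost_invariant_measures G H"
    then show thesis using that uniqueness_below[OF pu assms(3,5,7,8,6)] by blast
  next
    assume "\<not> almost_invariant_measures G K"
    then show thesis using that uniqueness_below[OF pu assms(5,3) comm gen assms(4)] by blast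
  qed
  have "bdd_below (uniqueness_phase G S)"
    by (rule bdd_belowI[of _ 0]) (simp add: uniqueness_phase_def)
  then have "p_u G S \<le> p" unfolding p_u_def using p(1) by (rule cInf_lower[rotated])
  with p(2) show False by simp
qed

end
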